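(* Let $F$ be a totally real number field of degree $n\geq 1$, let $\tau_1,\dots,\tau_n\colon F\hookrightarrow\mathbb{R}$ be its real embeddings, let $F':=\tau_1(F)\cdots\tau_n(F)\subset\mathbb{R}$ be the subfield of $\mathbb{R}$ generated by $\tau_1(F),\dots,\tau_n(F)$, and let $\mathfrak{a}\subset F$ be a fractional ideal. Then there exist finitely many totally positive $F'$-rational cones $C_1,\dots,C_m\subset\mathbb{R}_{>0}^n$ such that for every integer $k\geq 2$, \[ \zeta_{F,+}(\mathfrak{a}^{-1},k)\in \frac{1}{\sqrt{d_F}}\sum_{i=1}^m\sum_{\substack{\mathbf{k}\in\mathbb{Z}_{\geq1}^n\\ |\mathbf{k}|=nk}}\mathbb{Q}\,\zeta_{C_i}(\mathbf{k}), \] where $d_F$ is the discriminant of $F$ and $|\mathbf{k}|=k_1+\cdots+k_n$ for $\mathbf{k}=(k_1,\dots,k_n)$.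
   Context: For $I=(\alpha_1,\dots,\alpha_r)$ with $\alpha_i\in\mathbb{R}^n\setminus\{0\}$, set $C_I:=\sum_{i=1}^r\mathbb{R}_{>0}\alpha_i$ ($C_\emptyset=\{0\}$); a cone is a set of this form. For a subfield $K\subset\mathbb{R}$, a cone $C$ is $K$-rational if $C=C_I$ for some $I$ with all $\alpha_i\in K^n\setminus\{0\}$. A cone is totally positive if $C\subset\mathbb{R}_{>0}^n$. For a totally positive cone $C$ and $\mathbf{k}=(k_1,\dots,k_n)\in\mathbb{Z}_{\geq1}^n$, the conical zeta value is $\zeta_C(\mathbf{k}):=\sum_{x\in C\cap\mathbb{Z}^n}x_1^{-k_1}\cdots x_n^{-k_n}$ (whenever convergent). An element $a\in F$ is totally positive if $\tau_i(a)>0$ for all $i$; for a set $A$, $A_+$ denotes its totally positive elements. The narrow partial zeta function is $\zeta_{F,+}(\mathfrak{a}^{-1},s):=\sum_{x\in\mathfrak{a}_+/\mathcal{O}_{F,+}^\times}N_{F/\mathbb{Q}}(x)^{-s}$ for $\operatorname{Re}(s)>1$, where $\mathcal{O}_{F,+}^\times$ is the group of totally positive units of the ring of integers $\mathcal{O}_F$. *)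

theory Defs
  imports "HOL-Analysis.Analysis"
begin

section \<open>Cones and conical zeta values\<close>

text \<open>The relatively open cone spanned by a list of vectors; for the empty list it is \<open>{0}\<close>.\<close>

definition open_cone :: "(real ^ 'n) list \<Rightarrow> (real ^ 'n) set" where
  "open_cone vs = {(\<Sum>i<length vs. c i *\<^sub>R vs ! i) | c. \<forall>i<length vs. c i > (0::real)}"

definition rational_cone :: "real set \<Rightarrow> (real ^ 'n) set \<Rightarrow> bool" where
  "rational_cone K C \<longleftrightarrow>
     (\<exists>vs. (\<forall>v\<in>set vs. v \<noteq> 0 \<and> (\<forall>j. v $ j \<in> K)) \<and> C = open_cone vs)"

definition totally_positive_cone :: "(real ^ 'n) set \<Rightarrow> bool" where
  "totally_positive_cone C \<longleftrightarrow> (\<forall>x\<in>C. \<forall>j. x $ j > 0)"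

definition lattice_points :: "(real ^ 'n) set \<Rightarrow> (real ^ 'n) set" where
  "lattice_points C = {x \<in> C. \<forall>j. x $ j \<in> \<int>}"

definition conical_term :: "nat ^ 'n \<Rightarrow> real ^ 'n \<Rightarrow> real" where
  "conical_term \<kappa> x = (\<Prod>j\<in>UNIV. inverse (x $ j ^ (\<kappa> $ j)))"

definition conical_zeta_converges :: "(real ^ 'n) set \<Rightarrow> nat ^ 'n \<Rightarrow> bool" where
  "conical_zeta_converges C \<kappa> \<longleftrightarrow> conical_term \<kappa> summable_on lattice_points C"

definition conical_zeta :: "(real ^ 'n) set \<Rightarrow> nat ^ 'n \<Rightarrow> real" where
  "conical_zeta C \<kappa> = (\<Sum>\<^sub>\<infinity>x\<in>lattice_points C. conical_term \<kappa> x)"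

definition indices_of_weight :: "nat \<Rightarrow> (nat ^ 'n) set" where
  "indices_of_weight w = {\<kappa>. (\<forall>j. 1 \<le> \<kappa> $ j) \<and> (\<Sum>j\<in>UNIV. \<kappa> $ j) = w}"


section \<open>Totally real number fields\<close>

definition field_embedding :: "('a::field \<Rightarrow> 'b::field) \<Rightarrow> bool" where
  "field_embedding \<sigma> \<longleftrightarrow>
     \<sigma> 1 = 1 \<and> (\<forall>x y. \<sigma> (x + y) = \<sigma> x + \<sigma> y) \<and> (\<forall>x y. \<sigma> (x * y) = \<sigma> x * \<sigma> y)"

definition subfield_of_reals :: "real set \<Rightarrow> bool" where
  "subfield_of_reals K \<longleftrightarrow>
     0 \<in> K \<and> 1 \<in> K \<and> (\<forall>x\<in>K. \<forall>y\<in>K. x + y \<in> K \<and> x * y \<in> K) \<and>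
     (\<forall>x\<in>K. - x \<in> K \<and> inverse x \<in> K)"

text \<open>The field is an entire type \<open>'a\<close>, regarded as a vector space over the rationals.\<close>

definition rat_scale :: "rat \<Rightarrow> 'a::field_char_0 \<Rightarrow> 'a" where
  "rat_scale q x = of_rat q * x"

lemma vector_space_rat_scale: "vector_space (rat_scale :: rat \<Rightarrow> 'a::field_char_0 \<Rightarrow> 'a)"
  by unfold_locales (simp_all add: rat_scale_def algebra_simps of_rat_add of_rat_mult)

text \<open>Since \<^const>\<open>vector_space.dim\<close> is \<open>0\<close> in infinite dimension, a positive value of the
  degree entails that the field is a number field.\<close>

definition degree_over_rat :: "'a::field_char_0 itself \<Rightarrow> nat" where
  "degree_over_rat _ = vector_space.dim rat_scale (UNIV :: 'a set)"

definition totally_real_number_field :: "'a::field_char_0 itself \<Rightarrow> nat \<Rightarrow> bool" where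
  "totally_real_number_field F n \<longleftrightarrow>
     n \<ge> 1 \<and> degree_over_rat F = n \<and>
     (\<forall>\<sigma> :: 'a \<Rightarrow> complex. field_embedding \<sigma> \<longrightarrow> range \<sigma> \<subseteq> \<real>)"

text \<open>The type \<open>'n\<close> indexes bases; its cardinality is the degree.\<close>

definition rat_basis :: "('n::finite \<Rightarrow> 'a::field_char_0) \<Rightarrow> bool" where
  "rat_basis b \<longleftrightarrow>
     inj b \<and> \<not> module.dependent rat_scale (range b) \<and> module.span rat_scale (range b) = UNIV"

text \<open>The matrix, with respect to \<open>b\<close>, of multiplication by \<open>x\<close>: column \<open>j\<close> holds the coordinates
  of \<open>x * b j\<close>.\<close>

definition mult_matrix :: "('n::finite \<Rightarrow> 'a::field_char_0) \<Rightarrow> 'a \<Rightarrow> rat ^ 'n ^ 'n" where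
  "mult_matrix b x = (\<chi> i j. module.representation rat_scale (range b) (x * b j) (b i))"

text \<open>Norm and trace are the determinant and trace of the multiplication endomorphism, and so
  independent of the basis chosen.\<close>

definition field_norm :: "'n::finite itself \<Rightarrow> 'a::field_char_0 \<Rightarrow> rat" where
  "field_norm _ x = det (mult_matrix (SOME b :: 'n \<Rightarrow> 'a. rat_basis b) x)"

definition field_trace :: "'n::finite itself \<Rightarrow> 'a::field_char_0 \<Rightarrow> rat" where
  "field_trace _ x = trace (mult_matrix (SOME b :: 'n \<Rightarrow> 'a. rat_basis b) x)"

definition ring_of_integers :: "'a::field_char_0 set" where
  "ring_of_integers = {x. algebraic_int x}"

definition integral_basis :: "('n::finite \<Rightarrow> 'a::field_char_0) \<Rightarrow> bool" where
  "integral_basis \<omega> \<longleftrightarrow>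
     (\<forall>i. \<omega> i \<in> ring_of_integers) \<and>
     (\<forall>x\<in>ring_of_integers. \<exists>!c :: 'n \<Rightarrow> int. x = (\<Sum>i\<in>UNIV. of_int (c i) * \<omega> i))"

text \<open>Independent of the integral basis chosen, as two of them differ by a matrix of determinant
  \<open>1\<close> or \<open>-1\<close>.\<close>

definition field_discriminant :: "'n::finite itself \<Rightarrow> 'a::field_char_0 itself \<Rightarrow> rat" where
  "field_discriminant N _ =
     (let \<omega> = (SOME \<omega> :: 'n \<Rightarrow> 'a. integral_basis \<omega>)
      in det (\<chi> i j. field_trace N (\<omega> i * \<omega> j)))"

definition fractional_ideal :: "'a::field_char_0 set \<Rightarrow> bool" where
  "fractional_ideal I \<longleftrightarrow>
     0 \<in> I \<and> I \<noteq> {0} \<and> (\<forall>x\<in>I. \<forall>y\<in>I. x + y \<in> I) \<and>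
     (\<forall>r\<in>ring_of_integers. \<forall>x\<in>I. r * x \<in> I) \<and>
     (\<exists>d\<in>ring_of_integers. d \<noteq> 0 \<and> (\<forall>x\<in>I. d * x \<in> ring_of_integers))"


section \<open>The narrow partial zeta function\<close>

text \<open>Below, \<open>\<tau>\<close> enumerates the real embeddings of the field.\<close>

definition totally_positive :: "('n \<Rightarrow> 'a::field_char_0 \<Rightarrow> real) \<Rightarrow> 'a \<Rightarrow> bool" where
  "totally_positive \<tau> a \<longleftrightarrow> (\<forall>i. \<tau> i a > 0)"

definition totally_positive_part :: "('n \<Rightarrow> 'a::field_char_0 \<Rightarrow> real) \<Rightarrow> 'a set \<Rightarrow> 'a set" where
  "totally_positive_part \<tau> A = {a \<in> A. totally_positive \<tau> a}"

definition integer_units :: "'a::field_char_0 set" where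
  "integer_units = {u \<in> ring_of_integers. \<exists>v\<in>ring_of_integers. u * v = 1}"

definition unit_orbit_rel :: "('n \<Rightarrow> 'a::field_char_0 \<Rightarrow> real) \<Rightarrow> 'a set \<Rightarrow> ('a \<times> 'a) set" where
  "unit_orbit_rel \<tau> A =
     {(x, y). x \<in> totally_positive_part \<tau> A \<and> y \<in> totally_positive_part \<tau> A \<and>
              (\<exists>u\<in>totally_positive_part \<tau> integer_units. y = u * x)}"

text \<open>The value at \<open>s\<close> of the zeta function attached to the inverse of the fractional ideal \<open>\<aa>\<close>;
  the sum is over orbits \<open>X\<close>, on each of which the norm is constant.\<close>

definition narrow_partial_zeta_inv ::
    "('n::finite \<Rightarrow> 'a::field_char_0 \<Rightarrow> real) \<Rightarrow> 'a set \<Rightarrow> complex \<Rightarrow> complex" where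
  "narrow_partial_zeta_inv \<tau> \<aa> s =
     (\<Sum>\<^sub>\<infinity>X\<in>totally_positive_part \<tau> \<aa> // unit_orbit_rel \<tau> \<aa>.
        of_rat (the_elem (field_norm TYPE('n) ` X)) powr (- s))"

end

theory Submission
  imports Defs "Jordan_Normal_Form.Char_Poly" "HOL-Probability.Distributions"
begin

text \<open>
  Write \<open>N(x)\<^sup>-\<^sup>k (k-1)!\<^sup>n\<close> as the integral of \<open>N(y)\<^sup>k\<^sup>-\<^sup>1 e\<^sup>-\<^sup>x\<^sup>y\<close> over the positive orthant. By Dirichlet's
  pigeonhole argument the totally positive units act cocompactly on the norm-one hypersurface, so the
  translates of one rational simplicial cone cover the orthant; weighting its points by the inverse
  of their number of representatives and subdividing gives a weighted fundamental domain made of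
  rational cones. Star subdivisions also make these cones unimodular for the trace dual of \<open>\<aa>\<close>.

  Unfolding the orthant along the units turns the zeta value into a sum over \<open>x \<in> \<aa>\<^sub>+\<close> of integrals over
  cones with generators \<open>w\<^sub>1, \<dots>, w\<^sub>n\<close>. Since \<open>N(\<Sum> t\<^sub>i w\<^sub>i)\<close> is a form in \<open>t\<close> with rational coefficients, each
  integral is \<open>|det(\<tau>\<^sub>j w\<^sub>i)|\<close>, a rational multiple of \<open>1/\<surd>d\<^sub>F\<close>, times a rational combination of the
  products of \<open>Tr(x w\<^sub>i)\<^sup>-\<^sup>\<kappa>\<^sup>i\<close>. By unimodularity \<open>x \<mapsto> (Tr(x w\<^sub>i))\<^sub>i\<close> maps \<open>\<aa>\<^sub>+\<close> onto the integral points of the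
  cone spanned by the vectors \<open>(\<tau>\<^sub>j w\<^sub>i)\<^sub>i\<close>.
\<close>

section \<open>Algebraic integers form a ring\<close>

text \<open>An exact fundamental domain for the units would require deciding which boundary faces
  belong to which cone. Weights avoid this: an overlapping cover suffices once the multiplicity is
  constant on each part, and for that the covering cone is cut along the walls of those of its
  translates that meet it. Boundaries disappear because the decomposition is only used under an
  integral, where a point off all rational hyperplanes lies in at most one part. Integrals of
  nonnegative functions also allow sums and integrals to be exchanged before any convergence is
  known.

  The variables \<open>y\<close> (integration) and \<open>x\<close> (summation) live on dual sides
  of the trace form. The subdivided cones live in the space of \<open>y\<close>; those of the
  theorem are images of the orthant containing the conjugates of \<open>x\<close>, under pairing
  with the generators. Hence they are spanned by the columns, not the rows, of the matrix of all
  \<open>\<tau> j (w i)\<close>. A column has entries in a single conjugate field, but different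
  columns use different embeddings, whence \<open>F'\<close>. All cones are chosen before
  \<open>k\<close>, which enters only through the exponent of the norm.\<close>

lemma algebraic_int_if_eigenvalue:
  fixes z :: "'a :: field_char_0" and v :: "nat \<Rightarrow> 'a" and A :: "nat \<Rightarrow> nat \<Rightarrow> int"
  assumes eq: "\<And>i. i < m \<Longrightarrow> z * v i = (\<Sum>j<m. of_int (A i j) * v j)"
    and "i0 < m" "v i0 \<noteq> 0"
  shows "algebraic_int z"
proof -
  define M where "M = Matrix.mat m m (\<lambda>(i, j). A i j)"
  define B :: "'a mat" where "B = map_mat of_int M"
  have M: "M \<in> carrier_mat m m" and B: "B \<in> carrier_mat m m"
    by (simp_all add: M_def B_def)
  have "B *\<^sub>v Matrix.vec m v = z \<cdot>\<^sub>v Matrix.vec m v"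
    by (rule eq_vecI)
       (auto simp: B_def M_def scalar_prod_def eq atLeast0LessThan intro!: sum.cong)
  moreover have "Matrix.vec m v \<noteq> 0\<^sub>v m"
    using assms(2,3) by (metis index_vec index_zero_vec(1))
  ultimately have "eigenvalue B z"
    unfolding eigenvalue_def eigenvector_def
    by (intro exI[of _ "Matrix.vec m v"]) (simp add: B_def M_def)
  then have "poly (char_poly B) z = 0"
    using eigenvalue_root_char_poly[OF B] by simp
  moreover have "char_poly B = map_poly of_int (char_poly M)"
    unfolding B_def by (rule of_int_hom.char_poly_hom[OF M])
  moreover have "lead_coeff (char_poly M) = 1"
    using degree_monic_char_poly[OF M] by simp
  ultimately show ?thesis
    unfolding algebraic_int_altdef_ipoly by metis
qed

text \<open>The determinant trick: \<open>z\<close> is an eigenvalue of an integer matrix, hence a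
  root of its monic characteristic polynomial. The family \<open>v\<close> may be dependent, so any
  finitely generated stable group will do.\<close>

lemma algebraic_int_if_stable:
  fixes z :: "'a :: field_char_0" and v :: "'i \<Rightarrow> 'a"
  assumes I: "finite I" and nz: "i0 \<in> I" "v i0 \<noteq> 0"
    and stable: "\<And>i. i \<in> I \<Longrightarrow> \<exists>c :: 'i \<Rightarrow> int. z * v i = (\<Sum>j\<in>I. of_int (c j) * v j)"
  shows "algebraic_int z"
proof -
  obtain h where h: "bij_betw h {..<card I} I"
    using ex_bij_betw_nat_finite[OF I] by (auto simp: atLeast0LessThan)
  obtain c where c: "\<And>i. i \<in> I \<Longrightarrow> z * v i = (\<Sum>j\<in>I. of_int (c i j :: int) * v j)"
    using stable by metis
  obtain k where k: "k < card I" "h k = i0"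
    using h nz(1) by (metis bij_betw_iff_bijections lessThan_iff)
  show ?thesis
  proof (rule algebraic_int_if_eigenvalue[where m = "card I" and v = "v \<circ> h" and ?i0.0 = k
        and A = "\<lambda>i j. c (h i) (h j)"])
    fix i assume "i < card I"
    then have "h i \<in> I" using h by (auto simp: bij_betw_def)
    from c[OF this] show "z * (v \<circ> h) i = (\<Sum>j<card I. of_int (c (h i) (h j)) * (v \<circ> h) j)"
      by (simp add: sum.reindex_bij_betw[OF h, of "\<lambda>j. of_int (c (h i) j) * v j"])
  qed (use k nz in auto)
qed

no_notation vec_index (infixl "$" 100)
no_notation transpose_mat ("(_\<^sup>T)" [1000])
hide_const (open) Matrix.vec Matrix.mat Matrix.row Matrix.col Determinant.det Matrix.transpose_mat
hide_type (open) Matrix.vec Matrix.mat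
hide_fact (open) Matrix.vec_eq_iff Matrix.row_def Matrix.col_def Matrix.mat_def Matrix.vec_def
  Determinant.det_def Determinant.det_transpose Determinant.det_identical_rows Matrix.transpose_mat_def

lemma algebraic_int_pow_degree:
  fixes x :: "'a :: field_char_0"
  assumes "algebraic_int x"
  obtains m and a :: "nat \<Rightarrow> int" where "m > 0" "x ^ m = (\<Sum>i<m. of_int (a i) * x ^ i)"
proof -
  obtain p :: "int poly" where p: "poly (map_poly of_int p) x = 0" "lead_coeff p = 1"
    using assms unfolding algebraic_int_altdef_ipoly by auto
  have "0 = (\<Sum>i\<le>degree p. of_int (coeff p i) * x ^ i)"
    using p(1) by (simp add: poly_altdef degree_map_poly coeff_map_poly)
  also have "\<dots> = (\<Sum>i<degree p. of_int (coeff p i) * x ^ i) + x ^ degree p"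
    using p(2) by (simp flip: lessThan_Suc_atMost)
  finally have eq: "x ^ degree p = (\<Sum>i<degree p. of_int (- coeff p i) * x ^ i)"
    by (simp add: sum_negf eq_neg_iff_add_eq_0 add.commute)
  \<comment> \<open>A constant monic \<open>p\<close> would turn \<open>eq\<close> into
    \<open>1 = 0\<close>.\<close>
  have "degree p > 0"
  proof (rule ccontr)
    assume "\<not> degree p > 0"
    then have "degree p = 0" by simp
    from eq[unfolded this] show False by simp
  qed
  then show ?thesis using eq by (rule that)
qed

text \<open>The monomials \<open>x ^ i * y ^ j\<close> with \<open>i < p\<close>,
  \<open>j < q\<close> generate a group stable under \<open>x\<close> and \<open>y\<close>, hence
  under their sum and product.\<close>

lemma algebraic_int_add_mult:
  fixes x y :: "'a :: field_char_0"
  assumes "algebraic_int x" "algebraic_int y"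
  shows algebraic_int_add: "algebraic_int (x + y)"
    and algebraic_int_mult: "algebraic_int (x * y)"
proof -
  obtain p a where p: "p > 0" "x ^ p = (\<Sum>i<p. of_int (a i :: int) * x ^ i)"
    using algebraic_int_pow_degree[OF assms(1)] .
  obtain q b where q: "q > 0" "y ^ q = (\<Sum>i<q. of_int (b i :: int) * y ^ i)"
    using algebraic_int_pow_degree[OF assms(2)] .
  define I where "I = {..<p} \<times> {..<q}"
  define v where "v = (\<lambda>(i, j). x ^ i * y ^ j)"
  define S where "S = {(\<Sum>k\<in>I. of_int (c k) * v k) | c :: nat \<times> nat \<Rightarrow> int. True}"
  have fin: "finite I" by (simp add: I_def)
  have S_basis: "v k \<in> S" if "k \<in> I" for k
    using that fin unfolding S_def
    by (intro CollectI exI[of _ "\<lambda>l. if l = k then 1 else 0"])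
       (simp add: if_distrib[of of_int] if_distribR if_distrib[of "\<lambda>t. t * _"] cong: if_cong)
  have S_add: "s + t \<in> S" if st: "s \<in> S" "t \<in> S" for s t
  proof -
    obtain c d :: "nat \<times> nat \<Rightarrow> int" where "s = (\<Sum>k\<in>I. of_int (c k) * v k)" "t = (\<Sum>k\<in>I. of_int (d k) * v k)"
      using st unfolding S_def by blast
    then show ?thesis unfolding S_def
      by (intro CollectI exI[of _ "\<lambda>k. c k + d k"]) (simp add: sum.distrib algebra_simps)
  qed
  have S_scale: "of_int m * s \<in> S" if s: "s \<in> S" for s m
  proof -
    obtain c :: "nat \<times> nat \<Rightarrow> int" where "s = (\<Sum>k\<in>I. of_int (c k) * v k)"
      using s unfolding S_def by blast
    then show ?thesis unfolding S_def
      by (intro CollectI exI[of _ "\<lambda>k. m * c k"]) (simp add: sum_distrib_left algebra_simps)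
  qed
  have S_0: "0 \<in> S" unfolding S_def by (intro CollectI exI[of _ "\<lambda>_. 0"]) simp
  have S_sum: "sum f A \<in> S" if "\<And>i. i \<in> A \<Longrightarrow> f i \<in> S" for f and A :: "'i set"
    using that by (induction A rule: infinite_finite_induct) (auto intro: S_0 S_add)
  have x_basis: "x * v k \<in> S" if "k \<in> I" for k
  proof -
    obtain i j where k: "k = (i, j)" "i < p" "j < q" using \<open>k \<in> I\<close> by (auto simp: I_def)
    show ?thesis
    proof (cases "Suc i < p")
      case True
      then show ?thesis using S_basis[of "(Suc i, j)"] k by (simp add: I_def v_def mult_ac)
    next
      case False
      then have "p = Suc i" using k by simp
      then have "x * v k = x ^ p * y ^ j" using k by (simp add: v_def)
      also have "\<dots> = (\<Sum>i<p. of_int (a i) * v (i, j))"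
        unfolding p(2) by (simp add: v_def sum_distrib_right mult.assoc)
      also have "\<dots> \<in> S" using k by (intro S_sum S_scale S_basis) (auto simp: I_def)
      finally show ?thesis .
    qed
  qed
  have y_basis: "y * v k \<in> S" if "k \<in> I" for k
  proof -
    obtain i j where k: "k = (i, j)" "i < p" "j < q" using \<open>k \<in> I\<close> by (auto simp: I_def)
    show ?thesis
    proof (cases "Suc j < q")
      case True
      then show ?thesis using S_basis[of "(i, Suc j)"] k by (simp add: I_def v_def mult_ac)
    next
      case False
      then have "q = Suc j" using k by simp
      then have "y * v k = x ^ i * y ^ q" using k by (simp add: v_def mult_ac)
      also have "\<dots> = (\<Sum>j<q. of_int (b j) * v (i, j))"
        unfolding q(2) by (simp add: v_def sum_distrib_left mult.left_commute)
      also have "\<dots> \<in> S" using k by (intro S_sum S_scale S_basis) (auto simp: I_def)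
      finally show ?thesis .
    qed
  qed
  have S_mult: "z * s \<in> S" if basis: "\<And>k. k \<in> I \<Longrightarrow> z * v k \<in> S" and s: "s \<in> S" for z s
  proof -
    obtain c :: "nat \<times> nat \<Rightarrow> int" where "s = (\<Sum>k\<in>I. of_int (c k) * v k)"
      using s unfolding S_def by blast
    then have "z * s = (\<Sum>k\<in>I. of_int (c k) * (z * v k))"
      by (simp add: sum_distrib_left mult_ac)
    also have "\<dots> \<in> S" by (intro S_sum S_scale basis)
    finally show ?thesis .
  qed
  have *: "algebraic_int z" if "\<And>k. k \<in> I \<Longrightarrow> z * v k \<in> S" for z
  proof (rule algebraic_int_if_stable[where I = I and v = v and ?i0.0 = "(0, 0)"])
    show "(0, 0) \<in> I" "v (0, 0) \<noteq> 0" using p q by (auto simp: I_def v_def)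
    show "finite I" by (rule fin)
    show "\<exists>c :: nat \<times> nat \<Rightarrow> int. z * v i = (\<Sum>j\<in>I. of_int (c j) * v j)" if "i \<in> I" for i
      using \<open>\<And>k. k \<in> I \<Longrightarrow> z * v k \<in> S\<close>[OF that] by (auto simp: S_def)
  qed
  show "algebraic_int (x + y)"
    by (rule *) (auto simp: distrib_right intro: S_add x_basis y_basis)
  show "algebraic_int (x * y)"
    by (rule *, subst mult.assoc, rule S_mult) (use x_basis y_basis in auto)
qed

lemma algebraic_int_sum:
  fixes f :: "'i \<Rightarrow> 'a :: field_char_0"
  shows "(\<And>i. i \<in> A \<Longrightarrow> algebraic_int (f i)) \<Longrightarrow> algebraic_int (sum f A)"
  by (induction A rule: infinite_finite_induct) (auto intro: algebraic_int_add)

lemma algebraic_int_prod: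
  fixes f :: "'i \<Rightarrow> 'a :: field_char_0"
  shows "(\<And>i. i \<in> A \<Longrightarrow> algebraic_int (f i)) \<Longrightarrow> algebraic_int (prod f A)"
  by (induction A rule: infinite_finite_induct)
     (auto intro: algebraic_int_mult int_imp_algebraic_int)

lemma algebraic_int_diff:
  fixes x y :: "'a :: field_char_0"
  shows "algebraic_int x \<Longrightarrow> algebraic_int y \<Longrightarrow> algebraic_int (x - y)"
  using algebraic_int_add[of x "- y"] by auto

lemma algebraic_int_of_int: "algebraic_int (of_int m :: 'a :: field_char_0)"
  by (intro int_imp_algebraic_int) auto

text \<open>Multiplication by \<open>x\<close> acts on \<open>v\<close> through a rational matrix; a
  common multiple of its denominators makes it integral.\<close>

lemma exists_algebraic_int_multiple:
  fixes x :: "'a :: field_char_0"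
  assumes I: "finite I" and nz: "i0 \<in> I" "v i0 \<noteq> 0"
    and stable: "\<And>i. i \<in> I \<Longrightarrow> \<exists>c :: 'i \<Rightarrow> rat. x * v i = (\<Sum>j\<in>I. of_rat (c j) * v j)"
  shows "\<exists>m::int. m > 0 \<and> algebraic_int (of_int m * x)"
proof -
  obtain c where c: "\<And>i. i \<in> I \<Longrightarrow> x * v i = (\<Sum>j\<in>I. of_rat (c i j) * v j)"
    using stable by metis
  define m where "m = (\<Prod>(i, j)\<in>I \<times> I. snd (quotient_of (c i j)))"
  have "m > 0" unfolding m_def by (intro prod_pos) (auto intro: quotient_of_denom_pos')
  have "\<exists>d::int. of_int m * c i j = of_int d" if "i \<in> I" "j \<in> I" for i j
  proof -
    have "snd (quotient_of (c i j)) dvd m"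
      using dvd_prodI[of "I \<times> I" "(i, j)" "\<lambda>(i, j). snd (quotient_of (c i j))"] I that
      unfolding m_def by simp
    then obtain e where e: "m = snd (quotient_of (c i j)) * e" by auto
    have "snd (quotient_of (c i j)) \<noteq> 0" using quotient_of_denom_pos'[of "c i j"] by simp
    moreover have "c i j = of_int (fst (quotient_of (c i j))) / of_int (snd (quotient_of (c i j)))"
      by (rule quotient_of_div) simp
    ultimately have "of_int m * c i j = of_int (fst (quotient_of (c i j)) * e)"
      unfolding e by (simp add: field_simps)
    then show ?thesis by blast
  qed
  then obtain d where d: "\<And>i j. i \<in> I \<Longrightarrow> j \<in> I \<Longrightarrow> of_int m * c i j = of_int (d i j :: int)"
    by metis
  have "algebraic_int (of_int m * x)"
  proof (rule algebraic_int_if_stable[where I = I and v = v and ?i0.0 = i0])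
    fix i assume i: "i \<in> I"
    have "of_int m * x * v i = (\<Sum>j\<in>I. of_rat (of_int m * c i j) * v j)"
      by (simp add: mult.assoc c[OF i]) (simp add: sum_distrib_left of_rat_mult mult_ac)
    also have "\<dots> = (\<Sum>j\<in>I. of_int (d i j) * v j)"
      using d[OF i] by (intro sum.cong) auto
    finally show "\<exists>c :: 'i \<Rightarrow> int. of_int m * x * v i = (\<Sum>j\<in>I. of_int (c j) * v j)" by blast
  qed (use I nz in auto)
  with \<open>m > 0\<close> show ?thesis by blast
qed

section \<open>Embeddings, trace and norm\<close>

lemma of_rat_prod: "of_rat (\<Prod>i\<in>A. f i) = (\<Prod>i\<in>A. of_rat (f i) :: 'a :: field_char_0)"
  by (induction A rule: infinite_finite_induct) (auto simp: of_rat_mult)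

lemma of_rat_det: "of_rat (det A) = (det (\<chi> i j. of_rat (A $ i $ j)) :: 'b :: field_char_0)"
  for A :: "rat ^ 'n ^ 'n"
  unfolding det_def
  by (simp add: of_rat_sum of_rat_mult of_rat_prod sign_def)

lemma of_int_det: "of_int (det A) = (det (\<chi> i j. of_int (A $ i $ j)) :: 'b :: comm_ring_1)"
  for A :: "int ^ 'n ^ 'n"
  unfolding det_def by (simp add: sign_def)

lemma sum_of_bool_mult: "(\<Sum>k\<in>UNIV. f k * of_bool (k = i)) = (f (i :: 'n :: finite) :: 'b :: semiring_1)"
  "(\<Sum>k\<in>UNIV. f k * of_bool (i = k)) = f i"
  "(\<Sum>k\<in>UNIV. of_bool (k = i) * f k) = f i"
  "(\<Sum>k\<in>UNIV. of_bool (i = k) * f k) = f i"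
  by (simp_all add: of_bool_def if_distrib if_distribR cong: if_cong)

text \<open>Total reality in the form used below: as many distinct real embeddings as the degree.
  This makes the matrix of conjugates of a basis square.\<close>

locale real_embeddings =
  fixes \<tau> :: "'n::finite \<Rightarrow> 'a::field_char_0 \<Rightarrow> real"
  assumes embedding: "field_embedding (\<tau> i)"
    and inj_embeddings: "inj \<tau>"
    and degree: "degree_over_rat TYPE('a) = CARD('n)"
begin

lemma \<tau>_1 [simp]: "\<tau> i 1 = 1"
  and \<tau>_add: "\<tau> i (x + y) = \<tau> i x + \<tau> i y"
  and \<tau>_mult: "\<tau> i (x * y) = \<tau> i x * \<tau> i y"
  using embedding[of i] by (auto simp: field_embedding_def)

lemma \<tau>_0 [simp]: "\<tau> i 0 = 0"
  using \<tau>_add[of i 0 0] by simp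

lemma \<tau>_diff: "\<tau> i (x - y) = \<tau> i x - \<tau> i y"
  using \<tau>_add[of i "x - y" y] by simp

lemma \<tau>_eq_0_iff [simp]: "\<tau> i x = 0 \<longleftrightarrow> x = 0"
proof
  assume "\<tau> i x = 0"
  then show "x = 0" using \<tau>_mult[of i x "inverse x"] by (cases "x = 0") auto
qed simp

lemma \<tau>_eq_iff [simp]: "\<tau> i x = \<tau> i y \<longleftrightarrow> x = y"
  using \<tau>_eq_0_iff[of i "x - y"] by (simp add: \<tau>_diff)

lemma \<tau>_inverse: "\<tau> i (inverse x) = inverse (\<tau> i x)"
  using \<tau>_mult[of i x "inverse x"] by (cases "x = 0") (auto simp: field_simps)

lemma \<tau>_divide: "\<tau> i (x / y) = \<tau> i x / \<tau> i y"
  by (simp add: divide_inverse \<tau>_mult \<tau>_inverse)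

lemma \<tau>_power: "\<tau> i (x ^ k) = \<tau> i x ^ k"
  by (induction k) (auto simp: \<tau>_mult)

lemma \<tau>_sum: "\<tau> i (sum f A) = (\<Sum>a\<in>A. \<tau> i (f a))"
  by (induction A rule: infinite_finite_induct) (auto simp: \<tau>_add)

lemma \<tau>_of_nat [simp]: "\<tau> i (of_nat k) = of_nat k"
  by (induction k) (auto simp: \<tau>_add)

lemma \<tau>_of_int [simp]: "\<tau> i (of_int k) = of_int k"
  by (cases k rule: int_diff_cases) (simp add: \<tau>_diff)

lemma \<tau>_of_rat [simp]: "\<tau> i (of_rat q) = of_rat q"
  by (cases q rule: Rat_cases) (simp add: of_rat_divide of_rat_rat \<tau>_divide)

lemma \<tau>_algebraic_int: "algebraic_int x \<Longrightarrow> algebraic_int (\<tau> i x)"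
proof -
  assume "algebraic_int x"
  then obtain p :: "int poly" where p: "poly (map_poly of_int p) x = 0" "lead_coeff p = 1"
    unfolding algebraic_int_altdef_ipoly by auto
  have "poly (map_poly of_int p) (\<tau> i x) = \<tau> i (poly (map_poly of_int p) x)"
    by (simp add: poly_altdef degree_map_poly coeff_map_poly \<tau>_sum \<tau>_mult \<tau>_power)
  then show ?thesis using p unfolding algebraic_int_altdef_ipoly by auto
qed

text \<open>Trace and norm are taken here as sum and product of the conjugates, with real values;
  \<open>field_trace_eq\<close> and \<open>field_norm_eq\<close> identify them with the rational
  ones. Row \<open>i\<close> of \<open>emat w\<close> holds the conjugates of
  \<open>w i\<close>.\<close>

definition emb :: "'a \<Rightarrow> real ^ 'n" where "emb x = (\<chi> j. \<tau> j x)"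
definition tr :: "'a \<Rightarrow> real" where "tr x = (\<Sum>j\<in>UNIV. \<tau> j x)"
definition nrm :: "'a \<Rightarrow> real" where "nrm x = (\<Prod>j\<in>UNIV. \<tau> j x)"
definition emat :: "('n \<Rightarrow> 'a) \<Rightarrow> real ^ 'n ^ 'n" where "emat w = (\<chi> i. emb (w i))"

lemma emb_nth [simp]: "emb x $ j = \<tau> j x" by (simp add: emb_def)
lemma emat_nth [simp]: "emat w $ i = emb (w i)" by (simp add: emat_def)

lemma emb_0 [simp]: "emb 0 = 0" by (simp add: vec_eq_iff)
lemma emb_diff: "emb (x - y) = emb x - emb y" by (simp add: vec_eq_iff \<tau>_diff)
lemma emb_sum: "emb (sum f A) = (\<Sum>a\<in>A. emb (f a))" by (simp add: vec_eq_iff \<tau>_sum)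
lemma emb_of_rat_mult: "emb (of_rat q * x) = of_rat q *\<^sub>R emb x" by (simp add: vec_eq_iff \<tau>_mult)
lemma emb_of_int_mult: "emb (of_int q * x) = of_int q *\<^sub>R emb x" by (simp add: vec_eq_iff \<tau>_mult)
lemma emb_eq_iff [simp]: "emb x = emb y \<longleftrightarrow> x = y" by (auto simp: vec_eq_iff)

text \<open>The dictionary behind all the geometry: the trace form becomes the euclidean inner
  product, which also pairs field elements with arbitrary real vectors.\<close>

lemma inner_emb: "emb x \<bullet> emb y = tr (x * y)"
  by (simp add: inner_vec_def tr_def \<tau>_mult)

lemma tr_0 [simp]: "tr 0 = 0" by (simp add: tr_def)
lemma tr_add: "tr (x + y) = tr x + tr y" by (simp add: tr_def \<tau>_add sum.distrib)
lemma tr_diff: "tr (x - y) = tr x - tr y" by (simp add: tr_def \<tau>_diff sum_subtractf)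
lemma tr_sum: "tr (sum f A) = (\<Sum>a\<in>A. tr (f a))"
  by (induction A rule: infinite_finite_induct) (auto simp: tr_add)
lemma tr_of_rat_mult: "tr (of_rat q * x) = of_rat q * tr x"
  by (simp add: tr_def \<tau>_mult sum_distrib_left)
lemma tr_of_int_mult: "tr (of_int q * x) = of_int q * tr x"
  by (simp add: tr_def \<tau>_mult sum_distrib_left)

lemma nrm_mult: "nrm (x * y) = nrm x * nrm y" by (simp add: nrm_def \<tau>_mult prod.distrib)
lemma nrm_1 [simp]: "nrm 1 = 1" by (simp add: nrm_def)
lemma nrm_eq_0_iff [simp]: "nrm x = 0 \<longleftrightarrow> x = 0" by (simp add: nrm_def)

text \<open>Dedekind: by a minimal relation, with \<open>x\<close> separating two embeddings of its support.\<close>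

lemma embeddings_independent:
  assumes "\<And>x. (\<Sum>j\<in>UNIV. c j * \<tau> j x) = 0"
  shows "c j = 0"
proof -
  have "\<forall>j\<in>A. c j = 0" if "finite A" "\<And>x. (\<Sum>j\<in>A. c j * \<tau> j x) = 0" for A :: "'n set" and c
    using that
  proof (induction A arbitrary: c rule: finite_induct)
    case (insert k A)
    have zero: "c j = 0" if "j \<in> A" for j
    proof -
      have "j \<noteq> k" using that insert.hyps by auto
      then obtain y where y: "\<tau> j y \<noteq> \<tau> k y"
        using inj_embeddings by (metis ext injD)
      have "(\<Sum>i\<in>A. (c i * (\<tau> i y - \<tau> k y)) * \<tau> i x) = 0" for x
      proof -
        have "(\<Sum>i\<in>insert k A. c i * \<tau> i (y * x)) - \<tau> k y * (\<Sum>i\<in>insert k A. c i * \<tau> i x) = 0"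
          using insert.prems by simp
        then show ?thesis
          using insert.hyps by (simp add: \<tau>_mult algebra_simps sum_subtractf sum_distrib_left)
      qed
      from insert.IH[OF this] that have "c j * (\<tau> j y - \<tau> k y) = 0" by blast
      with y show ?thesis by simp
    qed
    moreover have "c k = 0"
      using insert.prems[of 1] insert.hyps zero by simp
    ultimately show ?case by auto
  qed simp
  from this[of UNIV c] assms show ?thesis by simp
qed

interpretation Q: vector_space "rat_scale :: rat \<Rightarrow> 'a \<Rightarrow> 'a"
  by (rule vector_space_rat_scale)

lemma rat_basis_expand:
  assumes "rat_basis (b :: 'n \<Rightarrow> 'a)"
  shows "x = (\<Sum>i\<in>UNIV. of_rat (Q.representation (range b) x (b i)) * b i)"
proof -
  have b: "inj b" "Q.independent (range b)" "Q.span (range b) = UNIV"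
    using assms by (auto simp: rat_basis_def)
  have "x = (\<Sum>v\<in>range b. rat_scale (Q.representation (range b) x v) v)"
    using Q.sum_representation_eq[of "range b" x "range b"] b by simp
  also have "\<dots> = (\<Sum>i\<in>UNIV. rat_scale (Q.representation (range b) x (b i)) (b i))"
    using b(1) by (simp add: sum.reindex)
  finally show ?thesis by (simp add: rat_scale_def)
qed

lemma rat_basis_exists: "\<exists>b :: 'n \<Rightarrow> 'a. rat_basis b"
proof -
  \<comment> \<open>\<open>Q.dim\<close> is the cardinality of a basis picked by choice; that very
    basis is extracted.\<close>
  obtain B :: "'a set" where B: "Q.independent B" "Q.span B = Q.span UNIV" "card B = Q.dim UNIV"
  proof -
    have "\<exists>B. Q.independent B \<and> Q.span B = Q.span (UNIV :: 'a set)"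
      using Q.basis_exists[of UNIV] by (metis Q.span_UNIV top.extremum_uniqueI)
    then show ?thesis using that unfolding Q.dim_def
      by (metis (mono_tags, lifting) someI_ex)
  qed
  have card: "card B = CARD('n)"
    using B(3) degree by (simp add: degree_over_rat_def)
  \<comment> \<open>\<open>card\<close> is \<open>0\<close> on infinite sets, so it is the positive
    degree that makes the basis finite.\<close>
  then have "finite B" using card_ge_0_finite by (metis zero_less_card_finite)
  then obtain b :: "'n \<Rightarrow> 'a" where "bij_betw b UNIV B"
    using card by (metis finite_same_card_bij finite)
  then have "rat_basis b" using B by (simp add: rat_basis_def bij_betw_def)
  then show ?thesis by blast
qed

text \<open>A kernel vector would be a linear relation between the embeddings on a basis, hence on
  the whole field, against their independence.\<close>

lemma det_emat_rat_basis:
  assumes "rat_basis (b :: 'n \<Rightarrow> 'a)"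
  shows "det (emat b) \<noteq> 0"
proof
  assume "det (emat b) = 0"
  then have "\<not> invertible (emat b)" by (simp add: invertible_det_nz)
  then obtain c where c: "c \<noteq> 0" "emat b *v c = 0"
    unfolding invertible_left_inverse matrix_left_invertible_ker by auto
  have bc: "(\<Sum>j\<in>UNIV. c $ j * \<tau> j (b i)) = 0" for i
    using c(2) by (simp add: vec_eq_iff matrix_vector_mult_def mult.commute)
  have "(\<Sum>j\<in>UNIV. c $ j * \<tau> j x) = 0" for x
  proof -
    define q where "q = (\<lambda>i. Q.representation (range b) x (b i))"
    have x: "x = (\<Sum>i\<in>UNIV. of_rat (q i) * b i)"
      unfolding q_def by (rule rat_basis_expand[OF assms])
    have "(\<Sum>j\<in>UNIV. c $ j * \<tau> j x) = (\<Sum>j\<in>UNIV. \<Sum>i\<in>UNIV. of_rat (q i) * (c $ j * \<tau> j (b i)))"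
      by (subst x) (simp add: \<tau>_sum \<tau>_mult sum_distrib_left mult_ac)
    also have "\<dots> = (\<Sum>i\<in>UNIV. of_rat (q i) * (\<Sum>j\<in>UNIV. c $ j * \<tau> j (b i)))"
      by (subst sum.swap) (simp add: sum_distrib_left)
    finally show ?thesis by (simp add: bc)
  qed
  then have "c $ j = 0" for j by (rule embeddings_independent)
  with c(1) show False by (simp add: vec_eq_iff)
qed

text \<open>\<open>emat b\<close> diagonalizes all multiplication matrices at once, with the
  conjugates of \<open>x\<close> as eigenvalues. Norm, trace and the norm form are all read off from
  this relation.\<close>

lemma mult_matrix_emat:
  assumes "rat_basis (b :: 'n \<Rightarrow> 'a)"
  shows "transpose (\<chi> i j. of_rat (mult_matrix b x $ i $ j)) ** emat b =
    emat b ** (\<chi> i j. if i = j then \<tau> i x else 0)"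
proof -
  have "(\<Sum>i\<in>UNIV. of_rat (mult_matrix b x $ i $ j) * \<tau> k (b i)) = \<tau> k (b j) * \<tau> k x" for j k
    using arg_cong[OF rat_basis_expand[OF assms, of "x * b j"], of "\<tau> k"]
    by (simp add: mult_matrix_def \<tau>_sum \<tau>_mult mult.commute)
  then show ?thesis
    by (simp add: vec_eq_iff matrix_matrix_mult_def transpose_def if_distrib cong: if_cong)
qed

text \<open>The coefficients \<open>t\<close> are real, so the left side is not the norm of a field
  element. But simultaneous diagonalization is linear in \<open>t\<close>, and the matrices
  \<open>A i\<close> are rational; this gives the rationality of the norm form without Galois
  theory.\<close>

lemma prod_linear_forms_eq_det:
  fixes w :: "'n \<Rightarrow> 'a"
  obtains A :: "'n \<Rightarrow> rat ^ 'n ^ 'n" where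
    "\<And>t. (\<Prod>j\<in>UNIV. \<Sum>i\<in>UNIV. t i * \<tau> j (w i)) = det (\<chi> r s. \<Sum>i\<in>UNIV. t i * of_rat (A i $ r $ s))"
proof -
  obtain b :: "'n \<Rightarrow> 'a" where b: "rat_basis b" using rat_basis_exists by blast
  define A where "A = (\<lambda>i. transpose (mult_matrix b (w i)))"
  have "(\<Prod>j\<in>UNIV. \<Sum>i\<in>UNIV. t i * \<tau> j (w i)) = det (\<chi> r s. \<Sum>i\<in>UNIV. t i * of_rat (A i $ r $ s))"
    (is "?P = det ?M") for t :: "'n \<Rightarrow> real"
  proof -
    define D :: "real ^ 'n ^ 'n" where "D = (\<chi> j k. if j = k then (\<Sum>i\<in>UNIV. t i * \<tau> j (w i)) else 0)"
    have "(\<Sum>k\<in>UNIV. (\<Sum>i\<in>UNIV. t i * of_rat (A i $ r $ k)) * \<tau> s (b k)) = \<tau> s (b r) * (\<Sum>i\<in>UNIV. t i * \<tau> s (w i))" for r s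
    proof -
      have "(\<Sum>k\<in>UNIV. of_rat (A i $ r $ k) * \<tau> s (b k)) = \<tau> s (b r) * \<tau> s (w i)" for i
        using mult_matrix_emat[OF b, of "w i"]
        by (simp add: A_def transpose_def vec_eq_iff matrix_matrix_mult_def if_distrib cong: if_cong)
      then have "(\<Sum>i\<in>UNIV. t i * (\<Sum>k\<in>UNIV. of_rat (A i $ r $ k) * \<tau> s (b k))) = \<tau> s (b r) * (\<Sum>i\<in>UNIV. t i * \<tau> s (w i))"
        by (simp add: sum_distrib_left mult_ac)
      then show ?thesis
        by (simp add: sum_distrib_left sum_distrib_right mult.assoc) (subst sum.swap, simp)
    qed
    then have eq: "?M ** emat b = emat b ** D"
      by (simp add: vec_eq_iff matrix_matrix_mult_def D_def if_distrib cong: if_cong)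
    have "det ?M * det (emat b) = det (emat b) * det D"
      using arg_cong[OF eq, of det] by (simp only: det_mul)
    moreover have "det D = ?P" unfolding D_def by (subst det_diagonal) auto
    ultimately show ?thesis using det_emat_rat_basis[OF b] by simp
  qed
  then show ?thesis by (rule that)
qed

lemma
  shows field_norm_eq: "of_rat (field_norm TYPE('n) x) = nrm x"
    and field_trace_eq: "of_rat (field_trace TYPE('n) x) = tr x"
proof -
  define b :: "'n \<Rightarrow> 'a" where "b = (SOME b. rat_basis b)"
  have b: "rat_basis b" unfolding b_def using rat_basis_exists by (rule someI_ex)
  define M :: "real ^ 'n ^ 'n" where "M = (\<chi> i j. of_rat (mult_matrix b x $ i $ j))"
  define D :: "real ^ 'n ^ 'n" where "D = (\<chi> i j. if i = j then \<tau> i x else 0)"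
  have eq: "transpose M ** emat b = emat b ** D"
    unfolding M_def D_def by (rule mult_matrix_emat[OF b])
  have nz: "det (emat b) \<noteq> 0" by (rule det_emat_rat_basis[OF b])
  have "det M * det (emat b) = det (emat b) * det D"
    using arg_cong[OF eq, of det] by (simp add: det_mul det_transpose)
  then have "det M = det D" using nz by simp
  also have "det D = nrm x" unfolding D_def nrm_def by (subst det_diagonal) auto
  also have "det M = of_rat (field_norm TYPE('n) x)"
    by (simp add: M_def of_rat_det field_norm_def b_def)
  finally show "of_rat (field_norm TYPE('n) x) = nrm x" .
  obtain E where E: "emat b ** E = mat 1" "E ** emat b = mat 1"
    using nz by (metis invertible_det_nz invertible_def)
  have "trace M = trace (transpose M ** (emat b ** E))"
    using E by (simp add: trace_def transpose_def)
  also have "\<dots> = trace ((emat b ** D) ** E)"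
    by (metis eq matrix_mul_assoc)
  also have "\<dots> = trace (E ** (emat b ** D))" by (rule trace_mul_sym)
  also have "\<dots> = trace D" by (metis E(2) matrix_mul_assoc matrix_mul_lid)
  also have "\<dots> = tr x" by (simp add: D_def trace_def tr_def)
  also have "trace M = of_rat (field_trace TYPE('n) x)"
    by (simp add: M_def field_trace_def b_def trace_def of_rat_sum)
  finally show "of_rat (field_trace TYPE('n) x) = tr x" .
qed

lemma tr_in_Rats [simp]: "tr x \<in> \<rat>"
  by (metis field_trace_eq Rats_of_rat)

lemma nrm_in_Rats [simp]: "nrm x \<in> \<rat>"
  by (metis field_norm_eq Rats_of_rat)

lemma tr_in_Ints: "algebraic_int x \<Longrightarrow> tr x \<in> \<int>"
  by (intro rational_algebraic_int_is_int tr_in_Rats) (auto simp: tr_def intro!: algebraic_int_sum \<tau>_algebraic_int)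

lemma nrm_in_Ints: "algebraic_int x \<Longrightarrow> nrm x \<in> \<int>"
  by (intro rational_algebraic_int_is_int nrm_in_Rats) (auto simp: nrm_def intro!: algebraic_int_prod \<tau>_algebraic_int)

section \<open>Trace-dual bases\<close>

definition indep :: "('n \<Rightarrow> 'a) \<Rightarrow> bool" where "indep w \<longleftrightarrow> det (emat w) \<noteq> 0"

lemma emat_gram: "emat w ** transpose (emat v) = (\<chi> i j. tr (w i * v j))"
  by (simp add: vec_eq_iff matrix_matrix_mult_def transpose_def tr_def \<tau>_mult)

lemma det_gram: "det (\<chi> i j. tr (w i * v j)) = det (emat w) * det (emat v)"
  unfolding emat_gram[symmetric] by (simp add: det_mul det_transpose)

text \<open>The Gram matrix of the trace form is rational with determinant
  \<open>det (emat w) ^ 2\<close>, so its inverse is rational too; the columns of the inverse give a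
  dual family inside the field, not merely in real space.\<close>

lemma dual_exists:
  assumes "indep w"
  shows "\<exists>w'. \<forall>i j. tr (w i * w' j) = of_bool (i = j)"
proof -
  define G :: "rat ^ 'n ^ 'n" where "G = (\<chi> i j. field_trace TYPE('n) (w i * w j))"
  have "of_rat (det G) = det (emat w) * det (emat w)"
    by (simp add: of_rat_det G_def field_trace_eq det_gram)
  then have "det G \<noteq> 0" using assms by (auto simp: indep_def)
  then obtain H where H: "G ** H = mat 1"
    by (metis invertible_det_nz invertible_def)
  define w' where "w' j = (\<Sum>k\<in>UNIV. of_rat (H $ k $ j) * w k)" for j
  have "tr (w i * w' j) = of_bool (i = j)" for i j
  proof -
    have "tr (w i * w' j) = (\<Sum>k\<in>UNIV. of_rat (H $ k $ j) * tr (w i * w k))"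
      unfolding w'_def by (simp add: sum_distrib_left tr_sum mult.left_commute[of "w i"] tr_of_rat_mult)
    also have "\<dots> = of_rat ((G ** H) $ i $ j)"
      by (simp add: G_def matrix_matrix_mult_def of_rat_sum of_rat_mult field_trace_eq mult.commute)
    finally show ?thesis by (simp add: H mat_def)
  qed
  then show ?thesis by blast
qed

definition dual :: "('n \<Rightarrow> 'a) \<Rightarrow> 'n \<Rightarrow> 'a" where
  "dual w = (SOME w'. \<forall>i j. tr (w i * w' j) = of_bool (i = j))"

lemma tr_dual: "indep w \<Longrightarrow> tr (w i * dual w j) = of_bool (i = j)"
  using someI_ex[OF dual_exists[of w]] unfolding dual_def by blast

lemma tr_dual': "indep w \<Longrightarrow> tr (dual w j * w i) = of_bool (i = j)"
  using tr_dual[of w i j] by (simp add: mult.commute)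

text \<open>Here \<open>y\<close> is an arbitrary real vector. Invertibility provides some
  coordinates, and pairing with the dual family identifies them.\<close>

lemma expand_vec:
  assumes "indep w"
  shows "y = (\<Sum>i\<in>UNIV. (emb (dual w i) \<bullet> y) *\<^sub>R emb (w i))"
proof -
  have "invertible (transpose (emat w))"
    using assms by (simp add: indep_def invertible_det_nz det_transpose)
  then obtain E where "transpose (emat w) ** E = mat 1" by (auto simp: invertible_def)
  then have "transpose (emat w) *v (E *v y) = y"
    by (simp add: matrix_vector_mul_assoc)
  then obtain s where s: "transpose (emat w) *v s = y" by blast
  have y: "y = (\<Sum>i\<in>UNIV. (s $ i) *\<^sub>R emb (w i))"
    unfolding s[symmetric] by (simp add: vec_eq_iff matrix_vector_mult_def transpose_def mult.commute)
  have "emb (dual w i) \<bullet> y = s $ i" for i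
    by (subst y) (simp add: inner_sum_right inner_emb tr_dual'[OF assms] sum_of_bool_mult)
  then show ?thesis using y by simp
qed

lemma expand:
  assumes "indep w"
  shows "x = (\<Sum>i\<in>UNIV. of_rat (field_trace TYPE('n) (dual w i * x)) * w i)"
proof -
  have "emb x = emb (\<Sum>i\<in>UNIV. of_rat (field_trace TYPE('n) (dual w i * x)) * w i)"
    by (subst expand_vec[OF assms, of "emb x"])
       (simp add: inner_emb emb_sum emb_of_rat_mult field_trace_eq)
  then show ?thesis by simp
qed

lemma det_emat_lincomb:
  fixes A :: "'n \<Rightarrow> 'n \<Rightarrow> rat"
  assumes "\<And>i. w i = (\<Sum>k\<in>UNIV. of_rat (A i k) * v k)"
  shows "det (emat w) = det (\<chi> i j. of_rat (A i j)) * det (emat v)"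
proof -
  have "emat w = (\<chi> i j. of_rat (A i j)) ** emat v"
    by (simp add: vec_eq_iff matrix_matrix_mult_def assms \<tau>_sum \<tau>_mult)
  then show ?thesis by (simp add: det_mul)
qed

text \<open>Cramer's rule. With a fractional part as \<open>c i\<close> the determinant shrinks,
  which drives both descents below: towards lattice bases and towards unimodular cones.\<close>

lemma emat_upd_lincomb:
  fixes c :: "'n \<Rightarrow> rat"
  assumes "v = (\<Sum>k\<in>UNIV. of_rat (c k) * w k)"
  shows "det (emat (w(i := v))) = of_rat (c i) * det (emat w)"
proof -
  have "det (emat (w(i := v))) =
    det (\<chi> k. if k = i then (\<Sum>l\<in>UNIV. of_rat (c l) *\<^sub>R emb (w l)) else emb (w k))"
    by (rule arg_cong[of _ _ det]) (simp add: vec_eq_iff assms \<tau>_sum \<tau>_mult)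
  also have "\<dots> = (\<Sum>l\<in>UNIV. det (\<chi> k. if k = i then of_rat (c l) *\<^sub>R emb (w l) else emb (w k)))"
    by (rule det_linear_row_sum) simp
  also have "\<dots> = (\<Sum>l\<in>UNIV. of_rat (c l) * det (\<chi> k. if k = i then emb (w l) else emb (w k)))"
  proof (intro sum.cong refl)
    fix l
    show "det (\<chi> k. if k = i then of_rat (c l) *\<^sub>R emb (w l) else emb (w k)) =
      of_rat (c l) * det (\<chi> k. if k = i then emb (w l) else emb (w k))"
      using Determinants.det_row_mul[of i "of_rat (c l)" "\<lambda>_. emb (w l)" "\<lambda>k. emb (w k)"]
      unfolding scalar_mult_eq_scaleR .
  qed
  also have "\<dots> = (\<Sum>l\<in>UNIV. if l = i then of_rat (c l) * det (emat w) else 0)"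
  proof (intro sum.cong refl)
    fix l
    show "of_rat (c l) * det (\<chi> k. if k = i then emb (w l) else emb (w k)) =
      (if l = i then of_rat (c l) * det (emat w) else 0)"
    proof (cases "l = i")
      case True
      then have "(\<chi> k. if k = i then emb (w l) else emb (w k)) = emat w" by (simp add: vec_eq_iff)
      with True show ?thesis by simp
    next
      case False
      have "det (\<chi> k. if k = i then emb (w l) else emb (w k)) = 0"
        by (rule det_identical_rows[OF False]) (use False in \<open>simp add: row_def vec_eq_iff\<close>)
      with False show ?thesis by simp
    qed
  qed
  finally show ?thesis by simp
qed

section \<open>Lattices and the discriminant\<close>

lemma emat_scale: "det (emat (\<lambda>i. e * w i)) = nrm e * det (emat w)"
proof -
  have "emat (\<lambda>i. e * w i) = emat w ** (\<chi> i j. if i = j then \<tau> i e else 0)"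
    by (simp add: vec_eq_iff matrix_matrix_mult_def \<tau>_mult if_distrib mult.commute cong: if_cong)
  moreover have "det (\<chi> i j. if i = j then \<tau> i e else 0) = nrm e"
    unfolding nrm_def by (subst det_diagonal) auto
  ultimately show ?thesis by (simp add: det_mul)
qed

lemma disc_in_Ints:
  assumes "\<And>i. algebraic_int (w i)"
  shows "det (emat w) ^ 2 \<in> \<int>"
proof -
  define z where "z i j = \<lfloor>tr (w i * w j)\<rfloor>" for i j
  have z: "tr (w i * w j) = of_int (z i j)" for i j
    using tr_in_Ints[OF algebraic_int_mult[OF assms[of i] assms[of j]]]
    by (auto simp: z_def elim!: Ints_cases)
  have "det (emat w) ^ 2 = det (\<chi> i j. of_int (z i j))"
    unfolding z[symmetric] det_gram by (simp add: power2_eq_square)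
  also have "\<dots> = of_int (det (\<chi> i j. z i j))" by (simp add: of_int_det)
  finally show ?thesis by simp
qed

text \<open>Among the linearly independent families of \<open>\<Lambda>\<close>, one of minimal discriminant is a
  \<open>\<int>\<close>-basis: a non-integral coordinate could be replaced by its fractional part.\<close>

lemma lattice_basis_exists:
  fixes \<Lambda> :: "'a set"
  assumes zero: "0 \<in> \<Lambda>" and diff: "\<And>x y. x \<in> \<Lambda> \<Longrightarrow> y \<in> \<Lambda> \<Longrightarrow> x - y \<in> \<Lambda>"
    and e: "e \<noteq> 0" "\<And>x. x \<in> \<Lambda> \<Longrightarrow> algebraic_int (e * x)"
    and b0: "indep b0" "\<And>i. b0 i \<in> \<Lambda>"
  obtains w where "indep w" "\<And>i. w i \<in> \<Lambda>"
    "\<And>x. x \<in> \<Lambda> \<Longrightarrow> \<exists>c :: 'n \<Rightarrow> int. x = (\<Sum>i\<in>UNIV. of_int (c i) * w i)"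
proof -
  have scale: "of_int m * x \<in> \<Lambda>" if "x \<in> \<Lambda>" for m x
  proof -
    have minus: "- x \<in> \<Lambda>" if "x \<in> \<Lambda>" for x using diff[OF zero that] by simp
    have add: "x + y \<in> \<Lambda>" if "x \<in> \<Lambda>" "y \<in> \<Lambda>" for x y using diff[OF that(1) minus[OF that(2)]] by simp
    have "of_nat k * x \<in> \<Lambda>" for k by (induction k) (auto simp: distrib_right zero that intro: add)
    then show ?thesis using minus by (cases m rule: int_cases2) (metis of_int_of_nat_eq, metis mult_minus_left of_int_minus of_int_of_nat_eq)
  qed
  have sum: "sum f A \<in> \<Lambda>" if "finite A" "\<And>i. i \<in> A \<Longrightarrow> f i \<in> \<Lambda>" for f and A :: "'n set"
    using that
  proof (induction A rule: finite_induct)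
    case (insert i A)
    have "f i - (0 - sum f A) \<in> \<Lambda>" using insert by (intro diff zero) auto
    with insert show ?case by simp
  qed (simp add: zero)
  \<comment> \<open>The factor \<open>nrm e\<close> replaces \<open>w\<close> by the family
    \<open>e * w i\<close> of algebraic integers, so \<open>D w\<close> is an integer and a minimum
    exists.\<close>
  define D where "D w = (nrm e * det (emat w))\<^sup>2" for w
  have D_Ints: "D w \<in> \<int>" if "\<And>i. w i \<in> \<Lambda>" for w
    using disc_in_Ints[of "\<lambda>i. e * w i"] e(2) that by (simp add: D_def emat_scale)
  define P where "P w \<longleftrightarrow> indep w \<and> (\<forall>i. w i \<in> \<Lambda>)" for w
  obtain w where w: "P w" and min: "\<And>v. P v \<Longrightarrow> nat \<lfloor>D w\<rfloor> \<le> nat \<lfloor>D v\<rfloor>"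
    using ex_has_least_nat[of P b0 "\<lambda>w. nat \<lfloor>D w\<rfloor>"] b0 by (auto simp: P_def)
  have min': "D w \<le> D v" if "P v" for v
  proof -
    have "0 \<le> D w" "0 \<le> D v" by (simp_all add: D_def)
    moreover have "\<lfloor>D w\<rfloor> = D w" "\<lfloor>D v\<rfloor> = D v"
      using D_Ints w that by (auto simp: P_def elim!: Ints_cases)
    ultimately show ?thesis using min[OF that] by linarith
  qed
  have "\<exists>c :: 'n \<Rightarrow> int. x = (\<Sum>i\<in>UNIV. of_int (c i) * w i)" if x: "x \<in> \<Lambda>" for x
  proof -
    define q where "q i = field_trace TYPE('n) (dual w i * x)" for i
    have xq: "x = (\<Sum>i\<in>UNIV. of_rat (q i) * w i)"
      unfolding q_def using expand w by (auto simp: P_def)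
    have "frac (q i) = 0" for i
    proof (rule ccontr)
      assume nz: "frac (q i) \<noteq> 0"
      define v where "v = x - (\<Sum>i\<in>UNIV. of_int \<lfloor>q i\<rfloor> * w i)"
      have v: "v = (\<Sum>k\<in>UNIV. of_rat (frac (q k)) * w k)"
        by (simp add: v_def xq frac_def of_rat_diff algebra_simps sum_subtractf)
      have det: "det (emat (w(i := v))) = of_rat (frac (q i)) * det (emat w)"
        by (rule emat_upd_lincomb[OF v])
      have "v \<in> \<Lambda>" unfolding v_def using w by (intro diff x sum scale) (auto simp: P_def)
      then have "P (w(i := v))" using det w nz by (auto simp: P_def indep_def)
      from min'[OF this] have "D w \<le> of_rat (frac (q i)) ^ 2 * D w"
        by (simp add: D_def det power_mult_distrib mult_ac)
      moreover have "D w > 0" using w e(1) by (simp add: D_def P_def indep_def)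
      moreover have "of_rat (frac (q i)) ^ 2 < (1 :: real)"
      proof -
        have "of_rat (frac (q i)) < (1 :: real)" "0 \<le> (of_rat (frac (q i)) :: real)"
          using frac_lt_1[of "q i"] frac_ge_0[of "q i"] by simp_all
        then show ?thesis by (simp add: power_less_one_iff)
      qed
      ultimately show False by (simp add: mult_less_cancel_right2 not_le[symmetric])
    qed
    then have "q i = of_int \<lfloor>q i\<rfloor>" for i by (metis add.right_neutral frac_def diff_eq_eq add.commute)
    then have "of_rat (q i) = (of_int \<lfloor>q i\<rfloor> :: 'a)" for i by (metis of_rat_of_int_eq)
    with xq show ?thesis by (intro exI[of _ "\<lambda>i. \<lfloor>q i\<rfloor>"]) simp
  qed
  with w show ?thesis by (intro that[of w]) (auto simp: P_def)
qed

lemma int_multiple_exists: "\<exists>m::int. m > 0 \<and> algebraic_int (of_int m * (x :: 'a))"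
proof -
  obtain b :: "'n \<Rightarrow> 'a" where b: "rat_basis b" using rat_basis_exists by blast
  have "b undefined \<noteq> 0"
  proof
    assume 0: "b undefined = 0"
    have "row undefined (emat b) = 0" by (simp add: row_def vec_eq_iff 0)
    then show False using det_emat_rat_basis[OF b] Determinants.det_zero_row by blast
  qed
  show ?thesis
  proof (rule exists_algebraic_int_multiple)
    show "finite (UNIV :: 'n set)" "undefined \<in> (UNIV :: 'n set)" "b undefined \<noteq> 0"
      by (simp_all add: \<open>b undefined \<noteq> 0\<close>)
    show "\<exists>c :: 'n \<Rightarrow> rat. x * b i = (\<Sum>j\<in>UNIV. of_rat (c j) * b j)" for i
      by (rule exI) (rule rat_basis_expand[OF b])
  qed
qed

lemma indep_integral_exists: "\<exists>w. indep w \<and> (\<forall>i. algebraic_int (w i))"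
proof -
  obtain b :: "'n \<Rightarrow> 'a" where b: "rat_basis b" using rat_basis_exists by blast
  obtain m :: "'n \<Rightarrow> int" where m: "\<And>i. m i > 0" "\<And>i. algebraic_int (of_int (m i) * b i)"
  proof -
    have "\<forall>i. \<exists>m::int. m > 0 \<and> algebraic_int (of_int m * b i)" using int_multiple_exists by blast
    from choice[OF this] show ?thesis using that by blast
  qed
  define w where "w i = of_int (m i) * b i" for i
  have "det (emat w) = (\<Prod>i\<in>UNIV. of_int (m i)) * det (emat b)"
  proof -
    have "emat w = (\<chi> i. of_int (m i) *s emb (b i))"
      by (simp add: vec_eq_iff w_def \<tau>_mult)
    then have "det (emat w) = (\<Prod>i\<in>UNIV. of_int (m i)) * det (\<chi> i. emb (b i))"
      by (simp only: Determinants.det_rows_mul)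
    then show ?thesis by (simp add: emat_def)
  qed
  moreover have "(\<Prod>i\<in>UNIV. of_int (m i)) \<noteq> (0 :: real)" using m(1) by (simp add: less_imp_neq[symmetric])
  ultimately have "indep w" using det_emat_rat_basis[OF b] by (simp add: indep_def)
  with m(2) show ?thesis by (auto simp: w_def)
qed

lemma indep_unique:
  assumes "indep w" "(\<Sum>i\<in>UNIV. of_int (c i) * w i) = (\<Sum>i\<in>UNIV. of_int (d i) * w i)"
  shows "c = d"
proof
  fix i
  have "tr (dual w i * (\<Sum>i\<in>UNIV. of_int (c i) * w i)) = of_int (c i)" for c
    by (simp add: sum_distrib_left tr_sum mult.left_commute[of "dual w i"] tr_of_int_mult tr_dual'[OF assms(1)] sum_of_bool_mult)
  from this[of c] this[of d] show "c i = d i" using assms(2) by simp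
qed

lemma integral_basis_exists: "\<exists>w :: 'n \<Rightarrow> 'a. integral_basis w"
proof -
  obtain b0 where "indep b0" "\<And>i. algebraic_int (b0 i)" using indep_integral_exists by blast
  then obtain w where w: "indep w" "\<And>i. algebraic_int (w i)"
    "\<And>x. algebraic_int x \<Longrightarrow> \<exists>c :: 'n \<Rightarrow> int. x = (\<Sum>i\<in>UNIV. of_int (c i) * w i)"
    using lattice_basis_exists[of ring_of_integers 1 b0]
    by (auto simp: ring_of_integers_def algebraic_int_diff)
  then have "integral_basis w"
    unfolding integral_basis_def ring_of_integers_def using w indep_unique[OF w(1)] by (auto intro: ex_ex1I)
  then show ?thesis by blast
qed

text \<open>An independent family of integers is an integer combination of \<open>w\<close>, so its
  nonzero determinant is a multiple of that of \<open>w\<close>.\<close>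

lemma indep_integral_basis:
  assumes "integral_basis (w :: 'n \<Rightarrow> 'a)"
  shows "indep w"
proof -
  obtain b where b: "indep b" "\<And>i. algebraic_int (b i)" using indep_integral_exists by blast
  have "\<exists>c :: 'n \<Rightarrow> int. b i = (\<Sum>k\<in>UNIV. of_int (c k) * w k)" for i
    using assms b(2)[of i] unfolding integral_basis_def ring_of_integers_def by (blast dest: ex1_implies_ex)
  then obtain c where "\<And>i. b i = (\<Sum>k\<in>UNIV. of_int (c i k) * w k)" by metis
  then have "b i = (\<Sum>k\<in>UNIV. of_rat (of_int (c i k)) * w k)" for i by simp
  from det_emat_lincomb[OF this] b(1) show ?thesis by (auto simp: indep_def)
qed

lemma sqrt_discriminant:
  obtains w :: "'n \<Rightarrow> 'a" where "indep w"
    "sqrt (of_rat (field_discriminant TYPE('n) TYPE('a))) = \<bar>det (emat w)\<bar>"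
proof -
  define w :: "'n \<Rightarrow> 'a" where "w = (SOME w. integral_basis w)"
  have "integral_basis w" unfolding w_def using integral_basis_exists by (rule someI_ex)
  then have "indep w" by (rule indep_integral_basis)
  moreover have "of_rat (field_discriminant TYPE('n) TYPE('a)) = det (emat w) ^ 2"
    by (simp add: field_discriminant_def flip: w_def)
       (simp add: of_rat_det field_trace_eq det_gram power2_eq_square)
  ultimately show ?thesis using that[of w] by simp
qed

text \<open>The origin of the factor \<open>1 / sqrt d\<close>: expansion in an integral basis makes
  the determinant a rational multiple of \<open>sqrt d\<close>, and
  \<open>sqrt d = d / sqrt d\<close> with \<open>d\<close> rational.\<close>

lemma abs_det_emat_rational_multiple:
  "\<exists>q::rat. \<bar>det (emat v)\<bar> = of_rat q / sqrt (of_rat (field_discriminant TYPE('n) TYPE('a)))"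
proof -
  obtain w :: "'n \<Rightarrow> 'a" where w: "indep w"
    "sqrt (of_rat (field_discriminant TYPE('n) TYPE('a))) = \<bar>det (emat w)\<bar>" (is "?s = _")
    using sqrt_discriminant .
  define A where "A = (\<lambda>i k. field_trace TYPE('n) (dual w k * v i))"
  have "v i = (\<Sum>k\<in>UNIV. of_rat (A i k) * w k)" for i
    unfolding A_def using expand[OF w(1), of "v i"] by simp
  from det_emat_lincomb[OF this] have "det (emat v) = of_rat (det (\<chi> i j. A i j)) * det (emat w)"
    by (simp add: of_rat_det)
  then have "\<bar>det (emat v)\<bar> = of_rat \<bar>det (\<chi> i j. A i j)\<bar> * ?s"
    by (simp add: abs_mult w(2))
  also have "?s > 0" using w by (simp add: indep_def)
  then have "?s * ?s = of_rat (field_discriminant TYPE('n) TYPE('a))" by simp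
  then have "of_rat \<bar>det (\<chi> i j. A i j)\<bar> * ?s =
      of_rat (\<bar>det (\<chi> i j. A i j)\<bar> * field_discriminant TYPE('n) TYPE('a)) / ?s"
    using \<open>?s > 0\<close> by (simp add: of_rat_mult nonzero_eq_divide_eq mult.assoc)
  finally show ?thesis by blast
qed

text \<open>Full rank comes from multiplying an independent family of integers by a nonzero
  \<open>e\<close> of the ideal, discreteness from the common denominator \<open>d\<close>.\<close>

lemma fractional_ideal_basis_exists:
  assumes "fractional_ideal (\<aa> :: 'a set)"
  obtains w where "indep w" "\<And>x. x \<in> \<aa> \<longleftrightarrow> (\<exists>c :: 'n \<Rightarrow> int. x = (\<Sum>i\<in>UNIV. of_int (c i) * w i))"
proof -
  have I: "0 \<in> \<aa>" "\<aa> \<noteq> {0}" and add: "\<And>x y. x \<in> \<aa> \<Longrightarrow> y \<in> \<aa> \<Longrightarrow> x + y \<in> \<aa>"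
    and mult: "\<And>r x. algebraic_int r \<Longrightarrow> x \<in> \<aa> \<Longrightarrow> r * x \<in> \<aa>"
    using assms by (auto simp: fractional_ideal_def ring_of_integers_def)
  obtain d where d: "d \<noteq> 0" "\<And>x. x \<in> \<aa> \<Longrightarrow> algebraic_int (d * x)"
    using assms unfolding fractional_ideal_def ring_of_integers_def by blast
  obtain e where e: "e \<in> \<aa>" "e \<noteq> 0" using I by blast
  obtain b where b: "indep b" "\<And>i. algebraic_int (b i)" using indep_integral_exists by blast
  have diff: "x - y \<in> \<aa>" if "x \<in> \<aa>" "y \<in> \<aa>" for x y
    using add[OF that(1) mult[OF _ that(2), of "-1"]] by simp
  have "indep (\<lambda>i. e * b i)" using b(1) e(2) by (simp add: indep_def emat_scale)
  moreover have "e * b i \<in> \<aa>" for i using mult[OF b(2) e(1)] by (simp add: mult.commute)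
  ultimately obtain w where w: "indep w" "\<And>i. w i \<in> \<aa>"
    "\<And>x. x \<in> \<aa> \<Longrightarrow> \<exists>c :: 'n \<Rightarrow> int. x = (\<Sum>i\<in>UNIV. of_int (c i) * w i)"
    using lattice_basis_exists[of \<aa> d "\<lambda>i. e * b i"] I(1) diff d by metis
  have "(\<Sum>i\<in>A. of_int (c i) * w i) \<in> \<aa>" if "finite A" for A and c :: "'n \<Rightarrow> int"
    using that by (induction A rule: finite_induct) (auto intro: I add mult w algebraic_int_of_int)
  then have "(\<Sum>i\<in>UNIV. of_int (c i) * w i) \<in> \<aa>" for c :: "'n \<Rightarrow> int" by simp
  with w show ?thesis by (intro that[of w]) blast+
qed

section \<open>Totally positive units\<close>

abbreviation pos_units :: "'a set" where
  "pos_units \<equiv> totally_positive_part \<tau> integer_units"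

lemma pos_units_iff:
  "u \<in> pos_units \<longleftrightarrow> algebraic_int u \<and> algebraic_int (inverse u) \<and> (\<forall>j. \<tau> j u > 0)"
proof
  assume "u \<in> pos_units"
  then obtain v where *: "algebraic_int u" "algebraic_int v" "u * v = 1" "\<forall>j. \<tau> j u > 0"
    by (auto simp: totally_positive_part_def integer_units_def ring_of_integers_def totally_positive_def)
  then have "inverse u = v" by (metis inverse_unique)
  with * show "algebraic_int u \<and> algebraic_int (inverse u) \<and> (\<forall>j. \<tau> j u > 0)" by simp
next
  assume *: "algebraic_int u \<and> algebraic_int (inverse u) \<and> (\<forall>j. \<tau> j u > 0)"
  then have "u \<noteq> 0" by (metis \<tau>_0 less_irrefl)
  then show "u \<in> pos_units" using *
    by (auto simp: totally_positive_part_def integer_units_def ring_of_integers_def totally_positive_def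
        intro!: bexI[of _ "inverse u"])
qed

lemma pos_units_1: "1 \<in> pos_units"
  and pos_units_mult: "u \<in> pos_units \<Longrightarrow> v \<in> pos_units \<Longrightarrow> u * v \<in> pos_units"
  and pos_units_inverse: "u \<in> pos_units \<Longrightarrow> inverse u \<in> pos_units"
  and pos_units_pos: "u \<in> pos_units \<Longrightarrow> \<tau> j u > 0"
  and pos_units_nz: "u \<in> pos_units \<Longrightarrow> u \<noteq> 0"
  by (auto simp: pos_units_iff \<tau>_mult \<tau>_inverse intro: algebraic_int_mult int_imp_algebraic_int)

lemma nrm_pos_unit: assumes "u \<in> pos_units" shows "nrm u = 1"
proof -
  have "nrm u \<in> \<int>" "nrm (inverse u) \<in> \<int>" using assms by (auto simp: pos_units_iff intro: nrm_in_Ints)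
  then obtain a b where ab: "nrm u = of_int a" "nrm (inverse u) = of_int b" by (auto elim!: Ints_cases)
  have "nrm u > 0" using assms by (auto simp: nrm_def pos_units_iff intro: prod_pos)
  then have "a > 0" using ab by simp
  have "nrm (u * inverse u) = 1" using pos_units_nz[OF assms] by simp
  then have "of_int (a * b) = (1 :: real)" by (simp add: nrm_mult ab)
  then have "a * b = 1" by (simp only: of_int_eq_1_iff)
  with \<open>a > 0\<close> have "a = 1" by (simp add: zmult_eq_1_iff)
  with ab show ?thesis by simp
qed

lemma algebraic_int_\<tau>_iff: "algebraic_int (\<tau> i x) \<longleftrightarrow> algebraic_int x"
proof
  assume "algebraic_int (\<tau> i x)"
  then obtain p :: "int poly" where p: "poly (map_poly of_int p) (\<tau> i x) = 0" "lead_coeff p = 1"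
    unfolding algebraic_int_altdef_ipoly by auto
  have "poly (map_poly of_int p) (\<tau> i x) = \<tau> i (poly (map_poly of_int p) x)"
    by (simp add: poly_altdef degree_map_poly coeff_map_poly \<tau>_sum \<tau>_mult \<tau>_power)
  then show "algebraic_int x" using p unfolding algebraic_int_altdef_ipoly by auto
qed (rule \<tau>_algebraic_int)

text \<open>Under \<open>\<tau> i\<close> the quotient is the product of the other conjugates, an
  algebraic integer among the reals; since it lies in the image of \<open>\<tau> i\<close>,
  integrality descends to the field.\<close>

lemma norm_over_self_integral:
  assumes "algebraic_int x" "x \<noteq> 0" "nrm x = of_int m"
  shows "algebraic_int (of_int m / x)"
proof -
  define i :: 'n where "i = undefined"
  have "nrm x = \<tau> i x * (\<Prod>k\<in>UNIV - {i}. \<tau> k x)"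
    unfolding nrm_def by (rule prod.remove) auto
  then have "\<tau> i (of_int m / x) = (\<Prod>k\<in>UNIV - {i}. \<tau> k x)"
    using assms(2,3) by (simp add: \<tau>_divide)
  then have "algebraic_int (\<tau> i (of_int m / x))"
    using assms(1) by (auto intro: algebraic_int_prod \<tau>_algebraic_int)
  then show ?thesis by (simp add: algebraic_int_\<tau>_iff)
qed

text \<open>Dirichlet's pigeonhole argument: \<open>(3p)\<^sup>n\<close> integers, fewer than \<open>(2p)\<^sup>n\<close> boxes whose shape
  is adapted to \<open>y\<close>.\<close>

lemma small_integer_exists:
  obtains B :: real where "B > 0"
    "\<And>y :: 'n \<Rightarrow> real. (\<And>j. y j > 0) \<Longrightarrow> (\<Prod>j\<in>UNIV. y j) = 1 \<Longrightarrow>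
      \<exists>a. algebraic_int a \<and> a \<noteq> 0 \<and> (\<forall>j. \<bar>\<tau> j a\<bar> * y j < B)"
proof -
  obtain w where w: "indep w" "\<And>i. algebraic_int (w i)" using indep_integral_exists by blast
  define B where "B = (\<Sum>i\<in>UNIV. \<Sum>j\<in>UNIV. \<bar>\<tau> j (w i)\<bar>) + 1"
  have "B \<ge> 1" unfolding B_def by (simp add: sum_nonneg)
  have Bj: "(\<Sum>i\<in>UNIV. \<bar>\<tau> j (w i)\<bar>) < B" for j
  proof -
    have "(\<Sum>i\<in>UNIV. \<bar>\<tau> j (w i)\<bar>) \<le> (\<Sum>i\<in>UNIV. \<Sum>j\<in>UNIV. \<bar>\<tau> j (w i)\<bar>)"
      by (intro sum_mono member_le_sum) auto
    then show ?thesis by (simp add: B_def)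
  qed
  have "\<exists>a. algebraic_int a \<and> a \<noteq> 0 \<and> (\<forall>j. \<bar>\<tau> j a\<bar> * y j < 6 * B)"
    if y: "\<And>j. y j > 0" and y1: "(\<Prod>j\<in>UNIV. y j) = 1" for y :: "'n \<Rightarrow> real"
  proof -
    define Y where "Y = (\<Sum>j\<in>UNIV. inverse (y j))"
    \<comment> \<open>So large that every \<open>y j * p\<close> is at least \<open>1\<close>:
      rounding it up to \<open>m j\<close> then at most doubles it, which bounds the number of boxes
      by \<open>(2 * p) ^ n\<close>.\<close>
    obtain p :: nat where p: "real p > max 1 Y" using reals_Archimedean2 by blast
    have yp: "y j * p \<ge> 1" for j
    proof -
      have "inverse (y j) \<le> Y" unfolding Y_def using y by (intro member_le_sum) (auto simp: less_imp_le)
      then have "1 \<le> y j * Y" using y[of j] by (simp add: field_simps)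
      also have "\<dots> \<le> y j * p" using p y[of j] by (intro mult_left_mono) auto
      finally show ?thesis .
    qed
    define m where "m j = nat \<lceil>y j * p\<rceil>" for j
    have m: "real (m j) \<ge> y j * p" "real (m j) \<le> 2 * (y j * p)" for j
      using yp[of j] unfolding m_def by linarith+
    have mpos: "m j > 0" for j using m(1)[of j] yp[of j] by (cases "m j") auto
    define S :: "('n \<Rightarrow> nat) set" where "S = (\<Pi>\<^sub>E i\<in>UNIV. {..<3 * p})"
    define T :: "('n \<Rightarrow> nat) set" where "T = (\<Pi>\<^sub>E j\<in>UNIV. {..<m j})"
    define el where "el s = (\<Sum>i\<in>UNIV. of_nat (s i) * w i)" for s :: "'n \<Rightarrow> nat"
    define H where "H = 3 * real p * B"
    have H: "H > 0" using p \<open>B \<ge> 1\<close> by (simp add: H_def)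
    \<comment> \<open>\<open>H\<close> bounds all conjugates of \<open>el s\<close>, so
      \<open>F\<close> normalizes them to the unit interval, which \<open>box\<close> cuts into
      \<open>m j\<close> equal pieces in direction \<open>j\<close>.\<close>
    define F where "F s j = (\<tau> j (el s) + H) / (2 * H)" for s j
    define box where "box s = (\<lambda>j. nat \<lfloor>F s j * m j\<rfloor>)" for s :: "'n \<Rightarrow> nat"
    have el_bound: "\<bar>\<tau> j (el s)\<bar> < H" if "s \<in> S" for s j
    proof -
      have "\<bar>\<tau> j (el s)\<bar> \<le> (\<Sum>i\<in>UNIV. \<bar>real (s i) * \<tau> j (w i)\<bar>)"
        unfolding el_def by (simp add: \<tau>_sum \<tau>_mult sum_abs)
      also have "\<dots> \<le> (\<Sum>i\<in>UNIV. real (3 * p) * \<bar>\<tau> j (w i)\<bar>)"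
      proof (intro sum_mono)
        fix i
        have "s i < 3 * p" using that by (auto simp: S_def PiE_iff)
        then have "real (s i) \<le> real (3 * p)" by linarith
        then show "\<bar>real (s i) * \<tau> j (w i)\<bar> \<le> real (3 * p) * \<bar>\<tau> j (w i)\<bar>"
          unfolding abs_mult by (intro mult_mono) auto
      qed
      also have "\<dots> = 3 * p * (\<Sum>i\<in>UNIV. \<bar>\<tau> j (w i)\<bar>)" by (simp add: sum_distrib_left)
      also have "\<dots> < H" using Bj p by (simp add: H_def)
      finally show ?thesis .
    qed
    have frac_bound: "0 \<le> F s j" "F s j < 1" if "s \<in> S" for s j
      using el_bound[OF that, of j] H by (auto simp: F_def field_simps abs_less_iff)
    have "box ` S \<subseteq> T"
    proof (intro image_subsetI, unfold T_def, intro PiE_I)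
      fix s j assume "s \<in> S"
      note b = frac_bound[OF this, of j]
      have "F s j * m j < 1 * real (m j)"
        using b(2) mpos[of j] by (intro mult_strict_right_mono) auto
      moreover have "F s j * m j \<ge> 0" using b(1) by simp
      ultimately have "box s j < m j" unfolding box_def by linarith
      then show "box s j \<in> {..<m j}" by simp
    qed auto
    have finT: "finite T" unfolding T_def by (intro finite_PiE) auto
    have "real (card T) = (\<Prod>j\<in>UNIV. real (m j))"
      by (simp add: T_def card_PiE)
    also have "\<dots> \<le> (\<Prod>j\<in>UNIV. 2 * (y j * p))" using m by (intro prod_mono) auto
    also have "\<dots> = (2 * real p) ^ CARD('n)" using y1 by (simp add: prod.distrib power_mult_distrib)
    also have "\<dots> < (3 * real p) ^ CARD('n)" using p by (intro power_strict_mono) auto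
    also have "\<dots> = real (card S)" by (simp add: S_def card_PiE)
    finally have "card T < card S" by simp
    then have "\<not> inj_on box S" using \<open>box ` S \<subseteq> T\<close> finT card_inj_on_le by (metis not_le)
    then obtain s t where st: "s \<in> S" "t \<in> S" "s \<noteq> t" "box s = box t" by (auto simp: inj_on_def)
    define a where "a = el s - el t"
    have "algebraic_int a" unfolding a_def el_def
      by (intro algebraic_int_diff algebraic_int_sum algebraic_int_mult w int_imp_algebraic_int) auto
    moreover have "a \<noteq> 0"
    proof
      assume "a = 0"
      then have "(\<lambda>i. int (s i)) = (\<lambda>i. int (t i))"
        by (intro indep_unique[OF w(1)]) (simp add: a_def el_def)
      then show False using st(3) by (auto simp: fun_eq_iff)
    qed
    \<comment> \<open>Equal boxes give \<open>\<bar>\<tau> j a\<bar> * m j < 2 * H\<close>, where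
      \<open>2 * H = 6 * p * B\<close>, and \<open>m j\<close> is at least
      \<open>y j * p\<close>.\<close>
    moreover have "\<bar>\<tau> j a\<bar> * y j < 6 * B" for j
    proof -
      have "F s j * m j \<ge> 0" "F t j * m j \<ge> 0" using frac_bound(1) st by simp_all
      moreover have "nat \<lfloor>F s j * m j\<rfloor> = nat \<lfloor>F t j * m j\<rfloor>"
        using st(4) by (simp add: box_def fun_eq_iff)
      ultimately have "\<bar>F s j * m j - F t j * m j\<bar> < 1" by linarith
      moreover have "F s j * m j - F t j * m j = \<tau> j a * m j / (2 * H)"
        using H by (simp add: F_def a_def \<tau>_diff field_simps)
      moreover have "\<bar>\<tau> j a * m j / (2 * H)\<bar> = \<bar>\<tau> j a\<bar> * m j / (2 * H)"
        using H by (simp add: abs_mult)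
      ultimately have "\<bar>\<tau> j a\<bar> * m j < 6 * p * B"
        using H by (simp add: pos_divide_less_eq H_def)
      then have "\<bar>\<tau> j a\<bar> * (y j * p) < 6 * p * B"
        using mult_left_mono[OF m(1)[of j], of "\<bar>\<tau> j a\<bar>"] by linarith
      then show ?thesis using p by (simp add: algebra_simps)
    qed
    ultimately show ?thesis by blast
  qed
  then show ?thesis using that[of "6 * B"] \<open>B \<ge> 1\<close> by auto
qed

text \<open>Two integers with equal norm \<open>N\<close> and signs that are congruent modulo \<open>N\<close> differ by a totally
  positive unit.\<close>

lemma finitely_many_classes:
  obtains R where "finite R" "0 \<notin> R"
    "\<And>a. algebraic_int a \<Longrightarrow> a \<noteq> 0 \<Longrightarrow> \<bar>nrm a\<bar> \<le> K \<Longrightarrow> \<exists>r\<in>R. a / r \<in> pos_units"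
proof -
  obtain w :: "'n \<Rightarrow> 'a" where "integral_basis w" using integral_basis_exists by blast
  then have w: "\<And>i. algebraic_int (w i)"
    and "\<forall>x. algebraic_int x \<longrightarrow> (\<exists>c :: 'n \<Rightarrow> int. x = (\<Sum>i\<in>UNIV. of_int (c i) * w i))"
    by (auto simp: integral_basis_def ring_of_integers_def)
  then obtain co where co: "\<And>x. algebraic_int x \<Longrightarrow> x = (\<Sum>i\<in>UNIV. of_int (co x i :: int) * w i)"
    using choice[of "\<lambda>x c. algebraic_int x \<longrightarrow> x = (\<Sum>i\<in>UNIV. of_int (c i) * w i)"] by blast
  define A where "A = {a. algebraic_int a \<and> a \<noteq> 0 \<and> \<bar>nrm a\<bar> \<le> K}"
  define f where "f a = (\<lfloor>nrm a\<rfloor>, (\<lambda>j. \<tau> j a > 0), (\<lambda>i. co a i mod \<lfloor>nrm a\<rfloor>))" for a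
  have nrmA: "nrm a = of_int \<lfloor>nrm a\<rfloor>" "\<lfloor>nrm a\<rfloor> \<noteq> 0" "\<bar>\<lfloor>nrm a\<rfloor>\<bar> \<le> \<lfloor>K\<rfloor>" if a: "a \<in> A" for a
  proof -
    obtain m where m: "nrm a = of_int m" using nrm_in_Ints a by (auto simp: A_def elim: Ints_cases)
    moreover have "nrm a \<noteq> 0" "\<bar>nrm a\<bar> \<le> K" using a by (auto simp: A_def)
    ultimately show "nrm a = of_int \<lfloor>nrm a\<rfloor>" "\<lfloor>nrm a\<rfloor> \<noteq> 0" "\<bar>\<lfloor>nrm a\<rfloor>\<bar> \<le> \<lfloor>K\<rfloor>"
      by (simp_all add: le_floor_iff)
  qed
  have "f ` A \<subseteq> {-\<lfloor>K\<rfloor>..\<lfloor>K\<rfloor>} \<times> UNIV \<times> (\<Pi>\<^sub>E i\<in>UNIV. {-\<lfloor>K\<rfloor>..\<lfloor>K\<rfloor>})"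
  proof
    fix z assume "z \<in> f ` A"
    then obtain a where a: "a \<in> A" "z = f a" by auto
    have "\<bar>co a i mod \<lfloor>nrm a\<rfloor>\<bar> \<le> \<lfloor>K\<rfloor>" for i
      using nrmA[OF a(1)] abs_mod_less[of "\<lfloor>nrm a\<rfloor>" "co a i"] by linarith
    then have "- \<lfloor>K\<rfloor> \<le> co a i mod \<lfloor>nrm a\<rfloor>" "co a i mod \<lfloor>nrm a\<rfloor> \<le> \<lfloor>K\<rfloor>" for i
      by (metis abs_le_iff minus_le_iff, metis abs_le_iff)
    then show "z \<in> {-\<lfloor>K\<rfloor>..\<lfloor>K\<rfloor>} \<times> UNIV \<times> (\<Pi>\<^sub>E i\<in>UNIV. {-\<lfloor>K\<rfloor>..\<lfloor>K\<rfloor>})"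
      using a nrmA(3)[OF a(1)] by (auto simp: f_def abs_le_iff)
  qed
  then have "finite (f ` A)" by (rule finite_subset) (auto intro!: finite_PiE finite_cartesian_product)
  define R where "R = inv_into A f ` (f ` A)"
  have unit: "a / b \<in> pos_units" if ab: "a \<in> A" "b \<in> A" "f a = f b" for a b
  proof -
    have int: "algebraic_int (x / y)" if "x \<in> A" "y \<in> A" "f x = f y" for x y
    proof -
      define N where "N = \<lfloor>nrm y\<rfloor>"
      have xy: "algebraic_int x" "algebraic_int y" "y \<noteq> 0" using that by (auto simp: A_def)
      have "\<lfloor>nrm x\<rfloor> = N" "\<And>i. co x i mod N = co y i mod N"
        using that(3) by (auto simp: f_def N_def fun_eq_iff)
      then have "N dvd co x i - co y i" for i by (simp add: mod_eq_dvd_iff)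
      define e where "e i = (co x i - co y i) div N" for i
      have e: "co x i - co y i = N * e i" for i
        using \<open>N dvd co x i - co y i\<close> by (simp add: e_def)
      have "x - y = (\<Sum>i\<in>UNIV. of_int (co x i - co y i) * w i)"
        using co[OF xy(1)] co[OF xy(2)] by (simp add: algebra_simps sum_subtractf)
      also have "\<dots> = of_int N * (\<Sum>i\<in>UNIV. of_int (e i) * w i)"
        by (simp add: e sum_distrib_left mult.assoc)
      \<comment> \<open>The sum is integral by the congruence modulo \<open>N\<close>, and
        \<open>N / y\<close> is integral because \<open>N\<close> is the norm of
        \<open>y\<close>.\<close>
      finally have eq: "x / y = 1 + (of_int N / y) * (\<Sum>i\<in>UNIV. of_int (e i) * w i)"
        using xy(3) by (simp add: field_simps)
      have N: "algebraic_int (of_int N / y)"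
        using nrmA[OF that(2)] by (intro norm_over_self_integral xy) (simp add: N_def)
      show ?thesis unfolding eq
        by (intro algebraic_int_add algebraic_int_mult algebraic_int_sum w algebraic_int_of_int N) simp
    qed
    have "\<tau> j (a / b) > 0" for j
    proof -
      have "a \<noteq> 0" "b \<noteq> 0" using ab by (auto simp: A_def)
      then have "\<tau> j a \<noteq> 0" "\<tau> j b \<noteq> 0" by simp_all
      moreover have "\<tau> j a > 0 \<longleftrightarrow> \<tau> j b > 0" using ab(3) by (auto simp: f_def fun_eq_iff)
      ultimately have "\<tau> j a / \<tau> j b > 0" unfolding zero_less_divide_iff by linarith
      then show ?thesis by (simp add: \<tau>_divide)
    qed
    then show ?thesis using int[OF ab] int[of b a] ab by (simp add: pos_units_iff)
  qed
  have RA: "r \<in> A" if "r \<in> R" for r using that by (auto simp: R_def inv_into_into)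
  show ?thesis
  proof (rule that[of R])
    show "finite R" using \<open>finite (f ` A)\<close> by (simp add: R_def)
    show "0 \<notin> R" using RA by (auto simp: A_def)
    fix a assume "algebraic_int a" "a \<noteq> 0" "\<bar>nrm a\<bar> \<le> K"
    then have a: "a \<in> A" by (simp add: A_def)
    have "f (inv_into A f (f a)) = f a" by (rule f_inv_into_f) (use a in auto)
    then have "a / inv_into A f (f a) \<in> pos_units" using a by (intro unit) (auto simp: inv_into_into)
    then show "\<exists>r\<in>R. a / r \<in> pos_units" using a by (auto simp: R_def)
  qed
qed

text \<open>An integer \<open>a\<close> adapted to \<open>y\<close> has norm at most
  \<open>B ^ n\<close>, so it is a unit times one of finitely many \<open>r\<close>, and dividing by
  \<open>r\<close> costs a bounded factor. The upper bounds on all coordinates imply the lower ones,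
  since the product of the coordinates is \<open>1\<close>.\<close>

lemma pos_units_cocompact:
  obtains c C :: real where "0 < c" "c \<le> C"
    "\<And>y :: 'n \<Rightarrow> real. (\<And>j. y j > 0) \<Longrightarrow> (\<Prod>j\<in>UNIV. y j) = 1 \<Longrightarrow>
      \<exists>u\<in>pos_units. \<forall>j. c \<le> \<tau> j u * y j \<and> \<tau> j u * y j \<le> C"
proof -
  obtain B :: real where B: "B > 0"
    "\<And>y :: 'n \<Rightarrow> real. (\<And>j. y j > 0) \<Longrightarrow> (\<Prod>j\<in>UNIV. y j) = 1 \<Longrightarrow>
      \<exists>a. algebraic_int a \<and> a \<noteq> 0 \<and> (\<forall>j. \<bar>\<tau> j a\<bar> * y j < B)"
    by (rule small_integer_exists) blast
  obtain R where R: "finite R" "0 \<notin> R"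
    "\<And>a. algebraic_int a \<Longrightarrow> a \<noteq> 0 \<Longrightarrow> \<bar>nrm a\<bar> \<le> B ^ CARD('n) \<Longrightarrow> \<exists>r\<in>R. a / r \<in> pos_units"
    using finitely_many_classes[of "B ^ CARD('n)"] by blast
  define C where "C = B * (\<Sum>r\<in>R. \<Sum>j\<in>UNIV. 1 / \<bar>\<tau> j r\<bar>) + 1"
  have "C \<ge> 1" unfolding C_def using B(1) by (simp add: sum_nonneg)
  have CR: "B / \<bar>\<tau> j r\<bar> \<le> C" if "r \<in> R" for j r
  proof -
    have "1 / \<bar>\<tau> j r\<bar> \<le> (\<Sum>j\<in>UNIV. 1 / \<bar>\<tau> j r\<bar>)" by (intro member_le_sum) auto
    also have "\<dots> \<le> (\<Sum>r\<in>R. \<Sum>j\<in>UNIV. 1 / \<bar>\<tau> j r\<bar>)"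
      using that R(1) by (intro member_le_sum[of r R "\<lambda>r. \<Sum>j\<in>UNIV. 1 / \<bar>\<tau> j r\<bar>"]) (auto intro: sum_nonneg)
    finally have "B * (1 / \<bar>\<tau> j r\<bar>) \<le> B * (\<Sum>r\<in>R. \<Sum>j\<in>UNIV. 1 / \<bar>\<tau> j r\<bar>)"
      using B(1) by (intro mult_left_mono) auto
    then show ?thesis by (simp add: C_def)
  qed
  define c where "c = 1 / C ^ CARD('n)"
  have "\<exists>u\<in>pos_units. \<forall>j. c \<le> \<tau> j u * y j \<and> \<tau> j u * y j \<le> C"
    if y: "\<And>j. y j > 0" and y1: "(\<Prod>j\<in>UNIV. y j) = 1" for y :: "'n \<Rightarrow> real"
  proof -
    obtain a where a: "algebraic_int a" "a \<noteq> 0" "\<And>j. \<bar>\<tau> j a\<bar> * y j < B" using B(2)[OF y y1] by blast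
    have "\<bar>nrm a\<bar> = (\<Prod>j\<in>UNIV. \<bar>\<tau> j a\<bar> * y j)"
      by (simp add: nrm_def prod.distrib y1 abs_prod)
    also have "\<dots> \<le> (\<Prod>j\<in>(UNIV::'n set). B)" using a(3) y by (intro prod_mono) (auto simp: less_imp_le)
    finally obtain r where r: "r \<in> R" "a / r \<in> pos_units" using R(3)[OF a(1,2)] by auto
    define u where "u = a / r"
    define z where "z j = \<tau> j u * y j" for j
    have u: "u \<in> pos_units" using r by (simp add: u_def)
    have z0: "z j > 0" for j using pos_units_pos[OF u] y by (simp add: z_def)
    have zC: "z j \<le> C" for j
    proof -
      have "z j = \<bar>\<tau> j u\<bar> * y j" using pos_units_pos[OF u, of j] by (simp add: z_def)
      also have "\<dots> = \<bar>\<tau> j a\<bar> * y j / \<bar>\<tau> j r\<bar>" by (simp add: u_def \<tau>_divide)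
      also have "\<dots> \<le> B / \<bar>\<tau> j r\<bar>" using a(3)[of j] by (intro divide_right_mono) auto
      also have "\<dots> \<le> C" by (rule CR[OF r(1)])
      finally show ?thesis .
    qed
    have "c \<le> z j" for j
    proof -
      have "1 = (\<Prod>j\<in>UNIV. z j)"
        using nrm_pos_unit[OF u] y1 by (simp add: z_def prod.distrib nrm_def)
      also have "\<dots> = z j * (\<Prod>k\<in>UNIV - {j}. z k)" by (rule prod.remove) auto
      also have "\<dots> \<le> z j * (\<Prod>k\<in>UNIV - {j}. C)"
        using z0 zC by (intro mult_left_mono prod_mono) (auto simp: less_imp_le)
      also have "\<dots> \<le> z j * C ^ CARD('n)"
        using z0[of j] \<open>C \<ge> 1\<close> by (auto intro!: power_increasing simp: card_Diff_singleton)
      finally show ?thesis using \<open>C \<ge> 1\<close> by (simp add: c_def field_simps)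
    qed
    with zC u show ?thesis unfolding z_def by blast
  qed
  moreover have "0 < c" "c \<le> C"
  proof -
    show "0 < c" using \<open>C \<ge> 1\<close> by (simp add: c_def)
    have "c \<le> 1" using \<open>C \<ge> 1\<close> by (simp add: c_def)
    with \<open>C \<ge> 1\<close> show "c \<le> C" by simp
  qed
  ultimately show ?thesis using that by blast
qed

text \<open>The coordinates in an integral basis are traces against the dual basis, hence bounded
  along with the conjugates.\<close>

lemma finite_bounded_integers:
  "finite {a. algebraic_int a \<and> (\<forall>j. \<bar>\<tau> j a\<bar> \<le> K)}"
proof -
  obtain w :: "'n \<Rightarrow> 'a" where wb: "integral_basis w" using integral_basis_exists by blast
  then have w: "indep w" by (rule indep_integral_basis)
  define D where "D = (\<Sum>i\<in>UNIV. \<Sum>j\<in>UNIV. \<bar>\<tau> j (dual w i)\<bar> * K)"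
  have "{a. algebraic_int a \<and> (\<forall>j. \<bar>\<tau> j a\<bar> \<le> K)} \<subseteq>
    (\<lambda>c. \<Sum>i\<in>UNIV. of_int (c i) * w i) ` (\<Pi>\<^sub>E i\<in>UNIV. {-\<lceil>D\<rceil>..\<lceil>D\<rceil>})"
  proof clarify
    fix a assume a: "algebraic_int a" "\<forall>j. \<bar>\<tau> j a\<bar> \<le> K"
    then obtain c :: "'n \<Rightarrow> int" where c: "a = (\<Sum>i\<in>UNIV. of_int (c i) * w i)"
      using wb by (auto simp: integral_basis_def ring_of_integers_def)
    have K: "K \<ge> 0" using a(2) by (meson abs_ge_zero order_trans)
    have "\<bar>of_int (c i)\<bar> \<le> D" for i
    proof -
      have "of_int (c i) = tr (dual w i * a)"
        unfolding c by (simp add: sum_distrib_left tr_sum mult.left_commute[of "dual w i"] tr_of_int_mult tr_dual'[OF w] sum_of_bool_mult)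
      also have "\<bar>\<dots>\<bar> \<le> (\<Sum>j\<in>UNIV. \<bar>\<tau> j (dual w i)\<bar> * \<bar>\<tau> j a\<bar>)"
        unfolding tr_def \<tau>_mult abs_mult[symmetric] by (rule sum_abs)
      also have "\<dots> \<le> (\<Sum>j\<in>UNIV. \<bar>\<tau> j (dual w i)\<bar> * K)" using a(2) by (intro sum_mono mult_left_mono) auto
      also have "\<dots> \<le> D" unfolding D_def
        using K by (intro member_le_sum[of i UNIV "\<lambda>i. \<Sum>j\<in>UNIV. \<bar>\<tau> j (dual w i)\<bar> * K"]) (auto intro: sum_nonneg)
      finally show ?thesis .
    qed
    then have "c i \<in> {-\<lceil>D\<rceil>..\<lceil>D\<rceil>}" for i
    proof -
      have "real_of_int \<bar>c i\<bar> \<le> D" using \<open>\<bar>of_int (c i)\<bar> \<le> D\<close> by simp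
      then have "\<bar>c i\<bar> \<le> \<lceil>D\<rceil>" by linarith
      then show ?thesis by auto
    qed
    then have "c \<in> (\<Pi>\<^sub>E i\<in>UNIV. {-\<lceil>D\<rceil>..\<lceil>D\<rceil>})" by (auto simp del: atLeastAtMost_iff)
    then show "a \<in> (\<lambda>c. \<Sum>i\<in>UNIV. of_int (c i) * w i) ` (\<Pi>\<^sub>E i\<in>UNIV. {-\<lceil>D\<rceil>..\<lceil>D\<rceil>})"
      unfolding c by (rule imageI)
  qed
  then show ?thesis by (rule finite_subset) (intro finite_imageI finite_PiE, auto)
qed

end

section \<open>Rational cones and their subdivisions\<close>

lemma common_denominator:
  assumes "finite A" "\<And>a. a \<in> A \<Longrightarrow> a \<in> (\<rat> :: real set)"
  shows "\<exists>N::int. N > 0 \<and> (\<forall>a\<in>A. of_int N * a \<in> \<int>)"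
  using assms
proof (induction A rule: finite_induct)
  case empty
  then show ?case by (intro exI[of _ 1]) auto
next
  case (insert a A)
  then obtain N :: int where N: "N > 0" "\<forall>a\<in>A. of_int N * a \<in> \<int>" by auto
  obtain p q where q: "a = of_int p / of_int q" "q > 0"
    using insert.prems[of a] by (auto elim!: Rats_cases')
  have "of_int (N * q) * a = of_int (N * p)" using q by simp
  moreover have "of_int (N * q) * b = of_int q * (of_int N * b)" for b :: real by simp
  ultimately show ?case using N q(2)
    by (intro exI[of _ "N * q"]) (metis Ints_mult Ints_of_int insert_iff mult_pos_pos)
qed

context real_embeddings
begin

definition act :: "'a \<Rightarrow> real ^ 'n \<Rightarrow> real ^ 'n" where
  "act u y = (\<chi> j. \<tau> j u * y $ j)"

lemma inner_act: "emb x \<bullet> act u y = emb (u * x) \<bullet> y"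
  by (simp add: act_def inner_vec_def \<tau>_mult mult_ac)

text \<open>For independent \<open>w\<close>, the open simplicial cone spanned by the
  \<open>emb (w i)\<close>, given by its facet inequalities: by \<open>expand_vec\<close> the inner
  products are the coordinates of \<open>y\<close>.\<close>

definition in_cone :: "('n \<Rightarrow> 'a) \<Rightarrow> real ^ 'n \<Rightarrow> bool" where
  "in_cone w y \<longleftrightarrow> (\<forall>i. emb (dual w i) \<bullet> y > 0)"

text \<open>Generic points avoid all rational hyperplanes, hence the boundaries of all the cones, so
  that subdivisions hold exactly on them.\<close>

definition generic :: "real ^ 'n \<Rightarrow> bool" where
  "generic y \<longleftrightarrow> (\<forall>x. x \<noteq> 0 \<longrightarrow> emb x \<bullet> y \<noteq> 0)"

lemma generic_act: "generic y \<Longrightarrow> u \<noteq> 0 \<Longrightarrow> generic (act u y)"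
  by (simp add: generic_def inner_act)

lemma coordinates:
  assumes "indep w"
  shows "emb (dual w i) \<bullet> (\<Sum>k\<in>UNIV. s k *\<^sub>R emb (w k)) = s i"
  by (simp add: inner_sum_right inner_emb tr_dual'[OF assms] sum_of_bool_mult)

lemma expand_component:
  assumes "indep v"
  shows "y $ j = (\<Sum>i\<in>UNIV. (emb (dual v i) \<bullet> y) * \<tau> j (v i))"
  using arg_cong[OF expand_vec[OF assms, of y], of "\<lambda>y. y $ j"] by simp

text \<open>Weak approximation at the real places: the real coordinates of \<open>z\<close> in a
  field basis are replaced by nearby rational ones.\<close>

lemma embeddings_dense:
  assumes "\<epsilon> > 0"
  shows "\<exists>x. \<forall>j. \<bar>\<tau> j x - z j\<bar> < \<epsilon>"
proof -
  obtain w where w: "indep w" using indep_integral_exists by blast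
  define s where "s i = emb (dual w i) \<bullet> (\<chi> j. z j)" for i
  have "(\<chi> j. z j) = (\<Sum>i\<in>UNIV. s i *\<^sub>R emb (w i))"
    unfolding s_def by (rule expand_vec[OF w])
  then have z: "z j = (\<Sum>i\<in>UNIV. s i * \<tau> j (w i))" for j by (simp add: vec_eq_iff)
  define B where "B = (\<Sum>i\<in>UNIV. \<Sum>j\<in>UNIV. \<bar>\<tau> j (w i)\<bar>) + 1"
  have B: "B > 0" "(\<Sum>i\<in>UNIV. \<bar>\<tau> j (w i)\<bar>) < B" for j
  proof -
    have "(\<Sum>i\<in>UNIV. \<bar>\<tau> j (w i)\<bar>) \<le> (\<Sum>i\<in>UNIV. \<Sum>j\<in>UNIV. \<bar>\<tau> j (w i)\<bar>)"
      by (intro sum_mono member_le_sum) auto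
    then show "(\<Sum>i\<in>UNIV. \<bar>\<tau> j (w i)\<bar>) < B" by (simp add: B_def)
    show "B > 0" unfolding B_def by (smt (verit) sum_nonneg abs_ge_zero)
  qed
  have "\<exists>q. s i < of_rat q \<and> of_rat q < s i + \<epsilon> / B" for i
    using B(1) assms by (intro of_rat_dense) simp
  then obtain q where q: "\<And>i. s i < of_rat (q i)" "\<And>i. of_rat (q i) < s i + \<epsilon> / B" by metis
  have "\<bar>\<tau> j (\<Sum>i\<in>UNIV. of_rat (q i) * w i) - z j\<bar> < \<epsilon>" for j
  proof -
    have "\<bar>\<tau> j (\<Sum>i\<in>UNIV. of_rat (q i) * w i) - z j\<bar> = \<bar>\<Sum>i\<in>UNIV. (of_rat (q i) - s i) * \<tau> j (w i)\<bar>"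
      by (simp add: z \<tau>_sum \<tau>_mult left_diff_distrib sum_subtractf)
    also have "\<dots> \<le> (\<Sum>i\<in>UNIV. \<bar>(of_rat (q i) - s i) * \<tau> j (w i)\<bar>)" by (rule sum_abs)
    also have "\<dots> \<le> (\<Sum>i\<in>UNIV. \<epsilon> / B * \<bar>\<tau> j (w i)\<bar>)"
      unfolding abs_mult
    proof (intro sum_mono mult_right_mono)
      fix i show "\<bar>of_rat (q i) - s i\<bar> \<le> \<epsilon> / B" using q[of i] by simp
    qed simp
    also have "\<dots> = \<epsilon> / B * (\<Sum>i\<in>UNIV. \<bar>\<tau> j (w i)\<bar>)" by (simp add: sum_distrib_left)
    also have "\<dots> < \<epsilon> / B * B" using B assms by (intro mult_strict_left_mono) auto
    finally show ?thesis using B(1) by simp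
  qed
  then show ?thesis by blast
qed

text \<open>Witness: positive vectors sufficiently close to the standard basis.\<close>

lemma cone_containing_box:
  assumes "0 < c" "c \<le> C"
  obtains v where "indep v" "\<And>i j. \<tau> j (v i) > 0"
    "\<And>y. (\<And>j. c \<le> y $ j \<and> y $ j \<le> C) \<Longrightarrow> in_cone v y"
proof -
  define n where "n = real CARD('n)"
  have n: "n \<ge> 1" by (simp add: n_def Suc_leI)
  \<comment> \<open>So small that entries perturbed by less than \<open>2 * \<delta>\<close> move a
    vector by at most a quarter of its maximum norm, and by at most \<open>c / 2\<close> if that
    norm is at most \<open>2 * C\<close>.\<close>
  define \<delta> where "\<delta> = c / (8 * n * C)"
  have C: "C > 0" using assms by simp
  have \<delta>: "\<delta> > 0" "n * (2 * \<delta>) \<le> 1 / 4" "n * (2 * \<delta>) * (2 * C) = c / 2"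
    using assms n C by (auto simp: \<delta>_def field_simps)
  \<comment> \<open>The target is shifted by \<open>\<delta>\<close> and met up to
    \<open>\<delta>\<close>, so that all entries come out positive, also those close to
    \<open>0\<close>.\<close>
  have "\<exists>x. \<forall>j. \<bar>\<tau> j x - (of_bool (i = j) + \<delta>)\<bar> < \<delta>" for i
    using \<delta> by (intro embeddings_dense) simp
  then obtain v where v: "\<And>i j. \<bar>\<tau> j (v i) - (of_bool (i = j) + \<delta>)\<bar> < \<delta>" by metis
  define E where "E i j = \<tau> j (v i) - of_bool (i = j)" for i j
  have E: "0 < E i j" "E i j < 2 * \<delta>" for i j
    using v[of j i] by (auto simp: E_def abs_less_iff)
  have pos: "\<tau> j (v i) > 0" for i j using E[of i j] by (simp add: E_def of_bool_def split: if_splits)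
  have bound: "\<exists>T\<ge>0. (\<forall>i. \<bar>t i\<bar> \<le> T) \<and> (\<forall>j. \<bar>(\<Sum>i\<in>UNIV. t i * E i j)\<bar> \<le> n * (2 * \<delta>) * T) \<and> (\<exists>i. T = \<bar>t i\<bar>)"
    for t :: "'n \<Rightarrow> real"
  proof -
    define T where "T = Max (range (\<lambda>i. \<bar>t i\<bar>))"
    have T: "\<bar>t i\<bar> \<le> T" for i unfolding T_def by (rule Max_ge) auto
    have "T \<in> range (\<lambda>i. \<bar>t i\<bar>)" unfolding T_def by (rule Max_in) auto
    moreover from this have "T \<ge> 0" by auto
    moreover have "\<bar>(\<Sum>i\<in>UNIV. t i * E i j)\<bar> \<le> n * (2 * \<delta>) * T" for j
    proof -
      have "\<bar>(\<Sum>i\<in>UNIV. t i * E i j)\<bar> \<le> (\<Sum>i\<in>UNIV. \<bar>t i * E i j\<bar>)" by (rule sum_abs)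
      also have "\<dots> \<le> (\<Sum>i\<in>(UNIV :: 'n set). T * (2 * \<delta>))"
        unfolding abs_mult
      proof (intro sum_mono mult_mono T)
        show "\<bar>E i j\<bar> \<le> 2 * \<delta>" for i using E[of i j] by simp
      qed (use \<open>T \<ge> 0\<close> in auto)
      also have "\<dots> = n * (2 * \<delta>) * T" by (simp add: n_def)
      finally show ?thesis .
    qed
    ultimately show ?thesis using T by blast
  qed
  have coord: "(\<Sum>i\<in>UNIV. t i * \<tau> j (v i)) = t j + (\<Sum>i\<in>UNIV. t i * E i j)" for t j
  proof -
    have "(\<Sum>i\<in>UNIV. t i * \<tau> j (v i)) = (\<Sum>i\<in>UNIV. t i * of_bool (i = j) + t i * E i j)"
      by (simp add: E_def algebra_simps)
    then show ?thesis by (simp only: sum.distrib sum_of_bool_mult)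
  qed
  have "indep v"
  proof (rule ccontr)
    assume "\<not> indep v"
    then have "\<not> invertible (transpose (emat v))" by (simp add: indep_def invertible_det_nz det_transpose)
    then obtain t where t: "t \<noteq> 0" "transpose (emat v) *v t = 0"
      unfolding invertible_left_inverse matrix_left_invertible_ker by auto
    have 0: "(\<Sum>i\<in>UNIV. t $ i * \<tau> j (v i)) = 0" for j
      using t(2) by (simp add: vec_eq_iff matrix_vector_mult_def transpose_def mult.commute)
    obtain T i where T: "T \<ge> 0" "\<forall>i. \<bar>t $ i\<bar> \<le> T" "\<forall>j. \<bar>(\<Sum>i\<in>UNIV. t $ i * E i j)\<bar> \<le> n * (2 * \<delta>) * T" "T = \<bar>t $ i\<bar>"
      using bound[of "\<lambda>i. t $ i"] by blast
    have "\<bar>t $ i\<bar> \<le> n * (2 * \<delta>) * T" using 0[of i] T(3) unfolding coord by (metis abs_minus_cancel add_eq_0_iff)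
    also have "\<dots> \<le> 1 / 4 * T" using \<delta>(2) T(1) by (intro mult_right_mono)
    finally have "T = 0" using T by linarith
    then have "t = 0" using T(2) by (simp add: vec_eq_iff)
    with t(1) show False by simp
  qed
  moreover have "in_cone v y" if y: "\<And>j. c \<le> y $ j \<and> y $ j \<le> C" for y
  proof -
    define t where "t i = emb (dual v i) \<bullet> y" for i
    have yj: "y $ j = t j + (\<Sum>i\<in>UNIV. t i * E i j)" for j
      unfolding coord[symmetric] unfolding t_def by (rule expand_component[OF \<open>indep v\<close>])
    obtain T i where T: "T \<ge> 0" "\<forall>i. \<bar>t i\<bar> \<le> T" "\<forall>j. \<bar>(\<Sum>i\<in>UNIV. t i * E i j)\<bar> \<le> n * (2 * \<delta>) * T" "T = \<bar>t i\<bar>"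
      using bound[of t] by blast
    have "n * (2 * \<delta>) * T \<le> 1 / 4 * T" using \<delta>(2) T(1) by (intro mult_right_mono)
    moreover have "\<bar>t i\<bar> \<le> C + n * (2 * \<delta>) * T" using yj[of i] y[of i] assms T(3)[rule_format, of i] by linarith
    ultimately have "T \<le> 2 * C" using T(4) C by linarith
    then have "n * (2 * \<delta>) * T \<le> c / 2" unfolding \<delta>(3)[symmetric] using n \<delta> by (intro mult_left_mono) auto
    then have "t j > 0" for j using yj[of j] y[of j] T(3)[rule_format, of j] assms(1) by linarith
    then show ?thesis by (simp add: in_cone_def t_def)
  qed
  ultimately show ?thesis using pos that by blast
qed

text \<open>Cones are invariant under positive scaling, so \<open>y\<close> may be normalized to
  product \<open>1\<close>; cocompactness then moves it into a fixed box, and one cone contains this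
  box.\<close>

lemma shintani_cone:
  obtains v where "indep v" "\<And>i j. \<tau> j (v i) > 0"
    "\<And>y. (\<And>j. y $ j > 0) \<Longrightarrow> \<exists>u\<in>pos_units. in_cone v (act u y)"
proof -
  obtain c C :: real where cC: "0 < c" "c \<le> C"
    "\<And>y :: 'n \<Rightarrow> real. (\<And>j. y j > 0) \<Longrightarrow> (\<Prod>j\<in>UNIV. y j) = 1 \<Longrightarrow>
      \<exists>u\<in>pos_units. \<forall>j. c \<le> \<tau> j u * y j \<and> \<tau> j u * y j \<le> C"
    by (rule pos_units_cocompact) blast
  obtain v where v: "indep v" "\<And>i j. \<tau> j (v i) > 0"
    "\<And>y. (\<And>j. c \<le> y $ j \<and> y $ j \<le> C) \<Longrightarrow> in_cone v y"
    by (rule cone_containing_box[OF cC(1,2)]) blast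
  have "\<exists>u\<in>pos_units. in_cone v (act u y)" if y: "\<And>j. y $ j > 0" for y
  proof -
    define s where "s = root CARD('n) (\<Prod>j\<in>UNIV. y $ j)"
    have P: "(\<Prod>j\<in>UNIV. y $ j) > 0" using y by (intro prod_pos) auto
    then have s: "s > 0" "s ^ CARD('n) = (\<Prod>j\<in>UNIV. y $ j)" by (simp_all add: s_def)
    have "(\<Prod>j\<in>UNIV. y $ j / s) = 1" using s P by (simp add: prod_dividef less_imp_neq[OF y, symmetric])
    then obtain u where u: "u \<in> pos_units" "\<forall>j. c \<le> \<tau> j u * (y $ j / s) \<and> \<tau> j u * (y $ j / s) \<le> C"
      using cC(3)[of "\<lambda>j. y $ j / s"] y s by auto
    have "in_cone v ((1 / s) *\<^sub>R act u y)" using u(2) by (intro v(3)) (simp add: act_def)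
    then have "in_cone v (act u y)" using s(1) by (simp add: in_cone_def zero_less_divide_iff)
    with u(1) show ?thesis by blast
  qed
  with v(1,2) show ?thesis by (rule that)
qed

lemma entries_comparable:
  fixes v :: "'n \<Rightarrow> 'a"
  assumes "\<And>i j. \<tau> j (v i) > 0"
  obtains R where "R \<ge> 1" "\<And>i j i' j'. \<tau> j (v i) \<le> R * \<tau> j' (v i')"
proof -
  define m where "m = Min (range (\<lambda>(i, j). \<tau> j (v i)))"
  define M where "M = Max (range (\<lambda>(i, j). \<tau> j (v i)))"
  have "m \<in> range (\<lambda>(i, j). \<tau> j (v i))" unfolding m_def by (rule Min_in) auto
  then have m0: "m > 0" using assms by auto
  have m: "m \<le> \<tau> j (v i)" for i j unfolding m_def by (rule Min_le) (auto intro: image_eqI[of _ _ "(i, j)"])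
  have M: "\<tau> j (v i) \<le> M" for i j unfolding M_def by (rule Max_ge) (auto intro: image_eqI[of _ _ "(i, j)"])
  define R where "R = M / m"
  have "m \<le> M" using m M order_trans by blast
  then have R: "R \<ge> 1" using m0 by (simp add: R_def)
  have "\<tau> j (v i) \<le> R * \<tau> j' (v i')" for i j i' j'
  proof -
    have "\<tau> j (v i) \<le> R * m" using M[of j i] m0 by (simp add: R_def)
    also have "\<dots> \<le> R * \<tau> j' (v i')" using R m by (intro mult_left_mono) auto
    finally show ?thesis .
  qed
  with R show ?thesis by (rule that)
qed

text \<open>Any two coordinates of a point in a cone with totally positive generators differ by a
  factor of at most \<open>R\<close>. If \<open>y\<close> and its translate by \<open>u\<close> both
  lie there, the conjugates of \<open>u\<close> are comparable up to \<open>R\<^sup>2\<close> and,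
  their product being \<open>1\<close>, bounded by it.\<close>

lemma finite_cone_overlaps:
  assumes v: "indep v" "\<And>i j. \<tau> j (v i) > 0"
  shows "finite {u \<in> pos_units. \<exists>y. in_cone v y \<and> in_cone v (act u y)}"
proof -
  obtain R where R: "R \<ge> 1" and entries: "\<And>i j i' j'. \<tau> j (v i) \<le> R * \<tau> j' (v i')"
    by (rule entries_comparable[of v, OF v(2)]) blast
  have ratio: "y $ j > 0 \<and> y $ j \<le> R * y $ k" if "in_cone v y" for y j k
  proof -
    define t where "t i = emb (dual v i) \<bullet> y" for i
    have t: "t i > 0" for i using that by (simp add: in_cone_def t_def)
    have yj: "y $ j = (\<Sum>i\<in>UNIV. t i * \<tau> j (v i))" for j
      unfolding t_def by (rule expand_component[OF v(1)])
    have "y $ j \<le> (\<Sum>i\<in>UNIV. t i * (R * \<tau> k (v i)))"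
      unfolding yj using t entries by (intro sum_mono mult_left_mono) (auto simp: less_imp_le)
    also have "\<dots> = R * y $ k" unfolding yj by (simp add: sum_distrib_left mult.left_commute)
    finally show ?thesis unfolding yj[of j] using t v(2) by (auto intro!: sum_pos)
  qed
  have "{u \<in> pos_units. \<exists>y. in_cone v y \<and> in_cone v (act u y)} \<subseteq> {a. algebraic_int a \<and> (\<forall>j. \<bar>\<tau> j a\<bar> \<le> R\<^sup>2)}"
  proof safe
    fix u y assume u: "u \<in> pos_units" and y: "in_cone v y" "in_cone v (act u y)"
    show "algebraic_int u" using u by (simp add: pos_units_iff)
    fix j
    have "\<tau> j u \<le> R\<^sup>2 * \<tau> k u" for k
    proof -
      have "\<tau> j u * y $ j \<le> R * (\<tau> k u * y $ k)" using ratio[OF y(2), of j k] by (simp add: act_def)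
      also have "\<dots> \<le> R * (\<tau> k u * (R * y $ j))"
        using ratio[OF y(1), of k j] R pos_units_pos[OF u, of k] by (intro mult_left_mono) (auto simp: less_imp_le)
      finally have "\<tau> j u * y $ j \<le> (R\<^sup>2 * \<tau> k u) * y $ j" by (simp add: power2_eq_square mult_ac)
      then show ?thesis using ratio[OF y(1), of j j] by simp
    qed
    then have "(\<Prod>k\<in>(UNIV :: 'n set). \<tau> j u) \<le> (\<Prod>k\<in>UNIV. R\<^sup>2 * \<tau> k u)"
      using pos_units_pos[OF u] by (intro prod_mono) (auto simp: less_imp_le)
    also have "\<dots> = (R\<^sup>2) ^ CARD('n)" using nrm_pos_unit[OF u] by (simp add: prod.distrib nrm_def)
    finally have "\<tau> j u ^ CARD('n) \<le> (R\<^sup>2) ^ CARD('n)" by simp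
    then have "\<tau> j u \<le> R\<^sup>2" using pos_units_pos[OF u, of j] by (simp add: power_mono_iff)
    then show "\<bar>\<tau> j u\<bar> \<le> R\<^sup>2" using pos_units_pos[OF u, of j] by simp
  qed
  then show ?thesis using finite_bounded_integers finite_subset by blast
qed

section \<open>Star subdivisions\<close>

lemma star_coordinates:
  assumes w: "indep w" and v: "v = (\<Sum>k\<in>UNIV. of_rat (c k) * w k)" and "c i \<noteq> 0"
  shows "indep (w(i := v))"
    and "emb (dual w l) \<bullet> y = of_rat (c l) * (emb (dual (w(i := v)) i) \<bullet> y) +
      (if l = i then 0 else emb (dual (w(i := v)) l) \<bullet> y)"
proof -
  show ind: "indep (w(i := v))"
    using w assms(3) by (simp add: indep_def emat_upd_lincomb[OF v])
  define s where "s k = emb (dual (w(i := v)) k) \<bullet> y" for k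
  have "tr (dual w l * v) = of_rat (c l)"
    unfolding v by (simp add: sum_distrib_left tr_sum mult.left_commute[of "dual w l"] tr_of_rat_mult tr_dual'[OF w] sum_of_bool_mult)
  \<comment> \<open>Pairing with \<open>dual w l\<close> retains only the new generator
    \<open>v\<close> and the old \<open>w l\<close>; the latter is gone if
    \<open>l = i\<close>.\<close>
  then have tr: "tr (dual w l * (w(i := v)) k) = (if k = i then of_rat (c l) else of_bool (l = k))" for k
    by (auto simp: tr_dual'[OF w])
  have "y = (\<Sum>k\<in>UNIV. s k *\<^sub>R emb ((w(i := v)) k))"
    unfolding s_def by (rule expand_vec[OF ind])
  then have "emb (dual w l) \<bullet> y = emb (dual w l) \<bullet> (\<Sum>k\<in>UNIV. s k *\<^sub>R emb ((w(i := v)) k))" by simp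
  also have "\<dots> = (\<Sum>k\<in>UNIV. s k * tr (dual w l * (w(i := v)) k))"
    by (simp only: inner_sum_right inner_scaleR_right inner_emb)
  also have "\<dots> = (\<Sum>k\<in>UNIV. s k * (if k = i then of_rat (c l) else of_bool (l = k)))"
    by (simp only: tr)
  also have "\<dots> = s i * of_rat (c l) + (\<Sum>k\<in>UNIV - {i}. s k * of_bool (l = k))"
    by (subst sum.remove[of _ i]) auto
  also have "(\<Sum>k\<in>UNIV - {i}. s k * of_bool (l = k)) = (if l = i then 0 else s l)"
    by (auto simp: of_bool_def if_distrib sum.delta cong: if_cong)
  finally show "emb (dual w l) \<bullet> y = of_rat (c l) * (emb (dual (w(i := v)) i) \<bullet> y) +
      (if l = i then 0 else emb (dual (w(i := v)) l) \<bullet> y)"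
    by (simp add: s_def mult.commute)
qed

text \<open>The index of the part containing \<open>y\<close> is the one minimizing the ratio of the coordinates of
  \<open>y\<close> and \<open>v\<close>; genericity excludes ties.\<close>

lemma star_subdivision:
  assumes w: "indep w" and v: "v = (\<Sum>k\<in>UNIV. of_rat (c k) * w k)" and c: "\<And>k. c k \<ge> 0" "c i0 > 0"
    and y: "generic y" "in_cone w y"
  shows "\<exists>!i. c i > 0 \<and> in_cone (w(i := v)) y"
proof -
  define t where "t k = emb (dual w k) \<bullet> y" for k
  have t: "t k > 0" for k using y(2) by (simp add: t_def in_cone_def)
  \<comment> \<open>The condition reads \<open>t i / c i < t k / c k\<close>, cleared of
    denominators so that it also covers \<open>c k = 0\<close>.\<close>
  have cone_iff: "in_cone (w(i := v)) y \<longleftrightarrow> (\<forall>k. k \<noteq> i \<longrightarrow> of_rat (c k) * t i < t k * of_rat (c i))"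
    if ci: "c i > 0" for i
  proof -
    define s where "s k = emb (dual (w(i := v)) k) \<bullet> y" for k
    have ci': "of_rat (c i) > (0 :: real)" using ci by simp
    have st: "t l = of_rat (c l) * s i + (if l = i then 0 else s l)" for l
      unfolding t_def s_def by (rule star_coordinates(2)[OF w v]) (use ci in simp)
    have ti: "t i = of_rat (c i) * s i" using st[of i] by simp
    have si: "s i > 0" using t[of i] ci' by (simp add: ti zero_less_mult_iff)
    have "s k > 0 \<longleftrightarrow> of_rat (c k) * t i < t k * of_rat (c i)" if "k \<noteq> i" for k
    proof -
      have "t k * of_rat (c i) - of_rat (c k) * t i = s k * of_rat (c i)"
        using st[of k] that by (simp add: ti algebra_simps)
      then show ?thesis using ci' by (smt (verit) zero_less_mult_iff)
    qed
    then show ?thesis unfolding in_cone_def s_def[symmetric] using si by metis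
  qed
  define r where "r k = t k / of_rat (c k)" for k
  obtain i where i: "is_arg_min r (\<lambda>k. k \<in> {k. c k > 0}) i"
    using ex_is_arg_min_if_finite[of "{k. c k > 0}" r] c(2) by auto
  then have ci: "c i > 0" and min: "\<And>k. c k > 0 \<Longrightarrow> r i \<le> r k" by (auto simp: is_arg_min_linorder)
  have "in_cone (w(i := v)) y"
    unfolding cone_iff[OF ci]
  proof (intro allI impI)
    fix k assume "k \<noteq> i"
    show "of_rat (c k) * t i < t k * of_rat (c i)"
    proof (cases "c k = 0")
      case True
      then show ?thesis using t ci by simp
    next
      case False
      then have ck: "c k > 0" using c(1)[of k] by simp
      have "of_rat (c k) * t i \<le> t k * of_rat (c i)"
        using min[OF ck] ci ck by (simp add: r_def field_simps)
      moreover have "of_rat (c k) * t i \<noteq> t k * of_rat (c i)"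
      proof -
        \<comment> \<open>A tie would put \<open>y\<close> on the hyperplane orthogonal to this
          nonzero field element.\<close>
        define x where "x = of_rat (c i) * dual w k - of_rat (c k) * dual w i"
        have "tr (x * w k) = of_rat (c i)"
          using \<open>k \<noteq> i\<close> by (simp add: x_def left_diff_distrib tr_diff mult.assoc tr_of_rat_mult tr_dual'[OF w])
        then have "x \<noteq> 0" using ci by auto
        then have "emb x \<bullet> y \<noteq> 0" using y(1) by (simp add: generic_def)
        moreover have "emb x \<bullet> y = of_rat (c i) * t k - of_rat (c k) * t i"
          by (simp add: x_def emb_diff emb_of_rat_mult inner_diff_left t_def)
        ultimately show ?thesis by (simp add: mult.commute)
      qed
      ultimately show ?thesis by simp
    qed
  qed
  moreover have "j = i" if "c j > 0" "in_cone (w(j := v)) y" for j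
  proof (rule ccontr)
    assume "j \<noteq> i"
    then have "of_rat (c i) * t j < t i * of_rat (c j)" using that cone_iff by auto
    moreover have "of_rat (c j) * t i < t j * of_rat (c i)"
      using \<open>in_cone (w(i := v)) y\<close> cone_iff[OF ci] \<open>j \<noteq> i\<close> by auto
    ultimately show False by (simp add: mult.commute)
  qed
  ultimately show ?thesis using ci by blast
qed

text \<open>The clause on \<open>z\<close> is the dual form of saying that the generators of a part
  lie in the closed cone of \<open>w\<close>. With test vectors it is visibly transitive, and
  suitable \<open>z\<close> transport positivity of conjugates and signs of traces from
  \<open>w\<close> to its parts. The last clause is the partition property off the rational
  hyperplanes.\<close>

definition subdivision :: "('n \<Rightarrow> 'a) set \<Rightarrow> ('n \<Rightarrow> 'a) \<Rightarrow> bool" where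
  "subdivision W w \<longleftrightarrow> finite W \<and>
     (\<forall>w'\<in>W. indep w' \<and> (\<forall>z. (\<forall>i. emb (w i) \<bullet> z \<ge> 0) \<longrightarrow> (\<forall>i. emb (w' i) \<bullet> z \<ge> 0))) \<and>
     (\<forall>y. generic y \<longrightarrow> in_cone w y \<longrightarrow> (\<exists>!w'. w' \<in> W \<and> in_cone w' y))"

text \<open>The test vector \<open>emb (dual w i)\<close> yields the weak facet inequality, and
  genericity makes it strict.\<close>

lemma subdivision_cone_subset:
  assumes "indep w" "subdivision W w" "w' \<in> W" "generic y" "in_cone w' y"
  shows "in_cone w y"
  unfolding in_cone_def
proof
  fix i
  have w': "indep w'" and *: "\<And>z. (\<forall>i. emb (w i) \<bullet> z \<ge> 0) \<Longrightarrow> emb (w' k) \<bullet> z \<ge> 0" for k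
    using assms(2,3) by (auto simp: subdivision_def)
  have "tr (w' k * dual w i) \<ge> 0" for k
    using *[of "emb (dual w i)" k] by (simp add: inner_emb tr_dual[OF assms(1)])
  then have "0 \<le> (\<Sum>k\<in>UNIV. (emb (dual w' k) \<bullet> y) * tr (w' k * dual w i))"
    using assms(5) by (intro sum_nonneg mult_nonneg_nonneg) (auto simp: in_cone_def less_imp_le)
  also have "\<dots> = emb (dual w i) \<bullet> (\<Sum>k\<in>UNIV. (emb (dual w' k) \<bullet> y) *\<^sub>R emb (w' k))"
    by (simp add: inner_sum_right inner_emb mult.commute[of "w' _"])
  also have "\<dots> = emb (dual w i) \<bullet> y" by (simp flip: expand_vec[OF w'])
  finally have "emb (dual w i) \<bullet> y \<ge> 0" .
  moreover have "dual w i \<noteq> 0" using tr_dual[OF assms(1), of i i] by auto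
  then have "emb (dual w i) \<bullet> y \<noteq> 0" using assms(4) by (simp add: generic_def)
  ultimately show "emb (dual w i) \<bullet> y > 0" by simp
qed

lemma subdivision_refl: "indep w \<Longrightarrow> subdivision {w} w"
  by (auto simp: subdivision_def)

text \<open>Uniqueness across different parts rests on containment: a generic point of a subpart
  lies in the part it came from, and that part is unique.\<close>

lemma subdivision_bind:
  assumes "subdivision W w" "\<And>w'. w' \<in> W \<Longrightarrow> subdivision (f w') w'"
  shows "subdivision (\<Union>w'\<in>W. f w') w"
proof -
  have ind: "indep w'" if "w' \<in> W" for w' using assms(1) that by (auto simp: subdivision_def)
  have "\<exists>!w''. w'' \<in> (\<Union>w'\<in>W. f w') \<and> in_cone w'' y" if y: "generic y" "in_cone w y" for y
  proof -
    obtain w' where w': "w' \<in> W" "in_cone w' y" and uniq: "\<And>x. x \<in> W \<Longrightarrow> in_cone x y \<Longrightarrow> x = w'"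
      using assms(1) y unfolding subdivision_def by metis
    have "\<exists>!w''. w'' \<in> f w' \<and> in_cone w'' y"
      using assms(2)[OF w'(1)] y(1) w'(2) unfolding subdivision_def by blast
    moreover have "x \<in> f w'" if "x \<in> f x'" "x' \<in> W" "in_cone x y" for x x'
      using uniq[OF that(2)] subdivision_cone_subset[OF ind[OF that(2)] assms(2)[OF that(2)] that(1) y(1) that(3)] that(1)
      by simp
    ultimately show ?thesis using w'(1) by blast
  qed
  moreover have "finite (\<Union>w'\<in>W. f w')" using assms by (auto simp: subdivision_def)
  moreover have "indep w'' \<and> (\<forall>z. (\<forall>i. emb (w i) \<bullet> z \<ge> 0) \<longrightarrow> (\<forall>i. emb (w'' i) \<bullet> z \<ge> 0))"
    if w'': "w'' \<in> (\<Union>w'\<in>W. f w')" for w''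
  proof -
    obtain w' where "w' \<in> W" "w'' \<in> f w'" using w'' by blast
    then show ?thesis using assms(1) assms(2)[of w'] unfolding subdivision_def by blast
  qed
  ultimately show ?thesis unfolding subdivision_def by blast
qed

lemma subdivision_star:
  assumes w: "indep w" and v: "v = (\<Sum>k\<in>UNIV. of_rat (c k) * w k)" and c: "\<And>k. c k \<ge> 0" "c i0 > 0"
  shows "subdivision ((\<lambda>i. w(i := v)) ` {i. c i > 0}) w"
proof -
  have "\<exists>!w'. w' \<in> (\<lambda>i. w(i := v)) ` {i. c i > 0} \<and> in_cone w' y" if y: "generic y" "in_cone w y" for y
  proof -
    from star_subdivision[OF w v c y] obtain i where
      i: "c i > 0 \<and> in_cone (w(i := v)) y" "\<forall>j. c j > 0 \<and> in_cone (w(j := v)) y \<longrightarrow> j = i"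
      by (rule ex1E)
    show ?thesis
    proof (intro ex1I conjI)
      show "w(i := v) \<in> (\<lambda>i. w(i := v)) ` {i. c i > 0}" "in_cone (w(i := v)) y"
        using i(1) by (blast, blast)
      fix w' assume "w' \<in> (\<lambda>i. w(i := v)) ` {i. c i > 0} \<and> in_cone w' y"
      then obtain j where "c j > 0" "w' = w(j := v)" "in_cone w' y" by blast
      with i(2) show "w' = w(i := v)" by blast
    qed
  qed
  moreover have "indep (w(i := v))" if "c i > 0" for i
    using star_coordinates(1)[OF w v] that by simp
  moreover have "emb ((w(i := v)) j) \<bullet> z \<ge> 0" if "\<forall>i. emb (w i) \<bullet> z \<ge> 0" for i j z
  proof -
    have "emb v \<bullet> z = (\<Sum>k\<in>UNIV. of_rat (c k) * (emb (w k) \<bullet> z))"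
      unfolding v by (simp add: emb_sum emb_of_rat_mult inner_sum_left)
    also have "\<dots> \<ge> 0" using c(1) that by (intro sum_nonneg mult_nonneg_nonneg) auto
    finally show ?thesis using that by simp
  qed
  ultimately show ?thesis unfolding subdivision_def by auto
qed

text \<open>The descent common to cutting along a hyperplane and to unimodular refinement:
  \<open>P\<close> is an invariant, and cones are refined until they satisfy
  \<open>Q\<close>.\<close>

lemma subdivision_by_measure:
  fixes m :: "('n \<Rightarrow> 'a) \<Rightarrow> nat"
  assumes P: "\<And>w. P w \<Longrightarrow> indep w"
    and step: "\<And>w. P w \<Longrightarrow> \<not> Q w \<Longrightarrow> \<exists>W. subdivision W w \<and> (\<forall>w'\<in>W. P w' \<and> m w' < m w)"
    and "P w"
  shows "\<exists>W. subdivision W w \<and> (\<forall>w'\<in>W. P w' \<and> Q w')"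
  using \<open>P w\<close>
proof (induction "m w" arbitrary: w rule: less_induct)
  case less
  show ?case
  proof (cases "Q w")
    case True
    then show ?thesis using subdivision_refl[OF P[OF less.prems]] less.prems by blast
  next
    case False
    then obtain W where W: "subdivision W w" "\<forall>w'\<in>W. P w' \<and> m w' < m w" using step[OF less.prems] by blast
    then have "\<forall>w'\<in>W. \<exists>V. subdivision V w' \<and> (\<forall>w'\<in>V. P w' \<and> Q w')" using less.hyps by blast
    then obtain f where f: "\<forall>w'\<in>W. subdivision (f w') w' \<and> (\<forall>x\<in>f w'. P x \<and> Q x)" by metis
    then have "subdivision (\<Union>w'\<in>W. f w') w" by (intro subdivision_bind[OF W(1)]) auto
    then show ?thesis using f by blast
  qed
qed

text \<open>For independent \<open>w\<close> and nonzero \<open>\<beta>\<close>, the hyperplane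
  orthogonal to \<open>emb \<beta>\<close> then misses the open cone, so the pairing with
  \<open>\<beta>\<close> has constant sign on it.\<close>

definition unsplit :: "'a \<Rightarrow> ('n \<Rightarrow> 'a) \<Rightarrow> bool" where
  "unsplit \<beta> w \<longleftrightarrow> (\<forall>i. tr (\<beta> * w i) \<ge> 0) \<or> (\<forall>i. tr (\<beta> * w i) \<le> 0)"

lemma unsplit_subdivision:
  assumes "subdivision W w" "w' \<in> W" "unsplit \<beta> w"
  shows "unsplit \<beta> w'"
proof -
  have *: "emb (w' i) \<bullet> z \<ge> 0" if "\<forall>i. emb (w i) \<bullet> z \<ge> 0" for z i
    using assms(1,2) that unfolding subdivision_def by blast
  show ?thesis
    using assms(3) *[of "emb \<beta>"] *[of "- emb \<beta>"]
    by (auto simp: unsplit_def inner_emb mult.commute[of \<beta>])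
qed

text \<open>Cut along the hyperplane of \<open>\<beta>\<close>: a pair \<open>w\<^sub>i\<close>, \<open>w\<^sub>j\<close> on opposite sides is replaced by the
  point where their segment meets it.\<close>

lemma subdivision_unsplit_one:
  assumes "indep w"
  shows "\<exists>W. subdivision W w \<and> (\<forall>w'\<in>W. indep w' \<and> unsplit \<beta> w')"
proof (rule subdivision_by_measure[where m = "\<lambda>w. card {i. tr (\<beta> * w i) \<noteq> 0}"])
  fix w :: "'n \<Rightarrow> 'a" assume w: "indep w" and "\<not> unsplit \<beta> w"
  then obtain i j where ij: "tr (\<beta> * w i) > 0" "tr (\<beta> * w j) < 0"
    unfolding unsplit_def not_le[symmetric] by blast
  then have "i \<noteq> j" by auto
  define a where "a = field_trace TYPE('n) (\<beta> * w i)"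
  define b where "b = field_trace TYPE('n) (\<beta> * w j)"
  have a: "of_rat a = tr (\<beta> * w i)" and b: "of_rat b = tr (\<beta> * w j)"
    by (simp_all add: a_def b_def field_trace_eq)
  have ab: "a > 0" "b < 0" using ij by (simp_all flip: a b)
  \<comment> \<open>The weights \<open>- b\<close> and \<open>a\<close> are positive and make the
    traces cancel. Each part therefore has one generator fewer off the hyperplane, which is what the
    measure counts.\<close>
  define c where "c k = - b * of_bool (k = i) + a * of_bool (k = j)" for k
  define v where "v = (\<Sum>k\<in>UNIV. of_rat (c k) * w k)"
  have "tr (\<beta> * v) = (\<Sum>k\<in>UNIV. of_rat (c k) * tr (\<beta> * w k))"
    by (simp add: v_def sum_distrib_left tr_sum mult.left_commute[of \<beta>] tr_of_rat_mult)
  also have "\<dots> = (\<Sum>k\<in>UNIV. - of_rat b * (of_bool (k = i) * tr (\<beta> * w k)) + of_rat a * (of_bool (k = j) * tr (\<beta> * w k)))"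
    by (intro sum.cong refl) (simp add: c_def of_rat_add of_rat_diff of_rat_mult of_rat_minus of_bool_def left_diff_distrib)
  also have "\<dots> = 0"
    by (simp only: sum.distrib sum_distrib_left[symmetric] sum_of_bool_mult) (simp add: a b)
  finally have trv: "tr (\<beta> * v) = 0" .
  have c: "c k \<ge> 0" "c i > 0" for k using ab \<open>i \<noteq> j\<close> by (auto simp: c_def of_bool_def)
  have "subdivision ((\<lambda>i. w(i := v)) ` {i. c i > 0}) w"
    by (rule subdivision_star[OF w v_def c])
  moreover have "card {k. tr (\<beta> * (w(l := v)) k) \<noteq> 0} < card {k. tr (\<beta> * w k) \<noteq> 0}" if "c l > 0" for l
  proof (intro psubset_card_mono)
    have "l = i \<or> l = j" using that by (auto simp: c_def of_bool_def split: if_splits)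
    then have "tr (\<beta> * w l) \<noteq> 0" using ij by auto
    then show "{k. tr (\<beta> * (w(l := v)) k) \<noteq> 0} \<subset> {k. tr (\<beta> * w k) \<noteq> 0}"
      using trv by (auto split: if_splits)
  qed simp
  ultimately show "\<exists>W. subdivision W w \<and>
      (\<forall>w'\<in>W. indep w' \<and> card {i. tr (\<beta> * w' i) \<noteq> 0} < card {i. tr (\<beta> * w i) \<noteq> 0})"
    by (intro exI[of _ "(\<lambda>i. w(i := v)) ` {i. c i > 0}"]) (auto simp: subdivision_def)
qed (use assms in auto)

lemma subdivision_unsplit:
  assumes "indep w" "finite L"
  shows "\<exists>W. subdivision W w \<and> (\<forall>w'\<in>W. \<forall>\<beta>\<in>L. unsplit \<beta> w')"
  using assms(2)
proof (induction L rule: finite_induct)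
  case empty
  then show ?case using subdivision_refl[OF assms(1)] by blast
next
  case (insert \<beta> L)
  then obtain W where W: "subdivision W w" "\<forall>w'\<in>W. \<forall>\<beta>\<in>L. unsplit \<beta> w'" by blast
  have "\<forall>w'\<in>W. \<exists>V. subdivision V w' \<and> (\<forall>x\<in>V. indep x \<and> unsplit \<beta> x)"
    using subdivision_unsplit_one W(1) by (auto simp: subdivision_def)
  then obtain f where f: "\<forall>w'\<in>W. subdivision (f w') w' \<and> (\<forall>x\<in>f w'. indep x \<and> unsplit \<beta> x)" by metis
  then have "subdivision (\<Union>w'\<in>W. f w') w" by (intro subdivision_bind[OF W(1)]) auto
  moreover have "unsplit \<gamma> x" if "w' \<in> W" "x \<in> f w'" "\<gamma> \<in> insert \<beta> L" for w' x \<gamma>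
    using that f W(2) unsplit_subdivision by blast
  ultimately show ?case by blast
qed

text \<open>\<open>integral_on \<alpha> w\<close>: the \<open>w i\<close> lie in the trace dual of the lattice spanned by \<open>\<alpha>\<close>;
  \<open>unimodular \<alpha> w\<close>: every element of that dual has integral coordinates with respect to \<open>w\<close>.\<close>

definition integral_on :: "('n \<Rightarrow> 'a) \<Rightarrow> ('n \<Rightarrow> 'a) \<Rightarrow> bool" where
  "integral_on \<alpha> w \<longleftrightarrow> (\<forall>i j. tr (w i * \<alpha> j) \<in> \<int>)"

definition unimodular :: "('n \<Rightarrow> 'a) \<Rightarrow> ('n \<Rightarrow> 'a) \<Rightarrow> bool" where
  "unimodular \<alpha> w \<longleftrightarrow> (\<forall>x. (\<forall>j. tr (x * \<alpha> j) \<in> \<int>) \<longrightarrow> (\<forall>i. tr (dual w i * x) \<in> \<int>))"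

text \<open>Multiplying all generators by a common denominator rescales the coordinates by a
  positive factor and leaves the cone unchanged.\<close>

lemma subdivision_integral:
  assumes w: "indep w"
  shows "\<exists>W. subdivision W w \<and> (\<forall>w'\<in>W. indep w' \<and> integral_on \<alpha> w')"
proof -
  obtain N :: int where N: "N > 0" "\<forall>a\<in>range (\<lambda>(i, j). tr (w i * \<alpha> j)). of_int N * a \<in> \<int>"
  proof -
    have "\<exists>N::int. N > 0 \<and> (\<forall>a\<in>range (\<lambda>(i, j). tr (w i * \<alpha> j)). of_int N * a \<in> \<int>)"
      by (rule common_denominator) auto
    then show ?thesis using that by blast
  qed
  define w' where "w' i = of_int N * w i" for i
  have w': "indep w'"
    using w N(1) emat_scale[of "of_int N" w] by (simp add: indep_def w'_def[abs_def])
  have "emb (dual w l) \<bullet> y = of_int N * (emb (dual w' l) \<bullet> y)" for l y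
  proof -
    have "emb (dual w l) \<bullet> y = emb (dual w l) \<bullet> (\<Sum>k\<in>UNIV. (emb (dual w' k) \<bullet> y) *\<^sub>R emb (w' k))"
      using expand_vec[OF w', of y] by simp
    also have "\<dots> = emb (dual w l) \<bullet> (\<Sum>k\<in>UNIV. (of_int N * (emb (dual w' k) \<bullet> y)) *\<^sub>R emb (w k))"
      by (simp add: w'_def emb_of_int_mult mult.commute)
    finally show ?thesis by (simp only: coordinates[OF w])
  qed
  then have "in_cone w' y \<longleftrightarrow> in_cone w y" for y using N(1) by (simp add: in_cone_def zero_less_mult_iff)
  then have "subdivision {w'} w"
    using w' N(1) unfolding subdivision_def by (auto simp: w'_def emb_of_int_mult)
  moreover have "of_int N * tr (w i * \<alpha> j) \<in> \<int>" for i j using N(2) by auto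
  then have "integral_on \<alpha> w'" by (simp add: integral_on_def w'_def mult.assoc tr_of_int_mult)
  ultimately show ?thesis using w' by blast
qed

text \<open>Resolution as for toric varieties. The measure is the index of the lattice spanned by
  \<open>w\<close> in the trace dual of \<open>\<alpha>\<close>. If a point of that dual has a
  non-integral coordinate, its fractional part \<open>v\<close> is again in the dual and in the
  closed cone, and starring at \<open>v\<close> multiplies the index by some
  \<open>c i < 1\<close>.\<close>

lemma subdivision_unimodular:
  assumes \<alpha>: "indep \<alpha>" and "indep w" "integral_on \<alpha> w"
  shows "\<exists>W. subdivision W w \<and> (\<forall>w'\<in>W. (indep w' \<and> integral_on \<alpha> w') \<and> unimodular \<alpha> w')"
proof (rule subdivision_by_measure[where m = "\<lambda>w. nat \<lfloor>\<bar>det (emat w) * det (emat \<alpha>)\<bar>\<rfloor>"])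
  fix w :: "'n \<Rightarrow> 'a" assume "indep w \<and> integral_on \<alpha> w" and "\<not> unimodular \<alpha> w"
  then have w: "indep w" "integral_on \<alpha> w" by auto
  define D where "D w = \<bar>det (emat w) * det (emat \<alpha>)\<bar>" for w
  have D_Ints: "D w \<in> \<int>" if "integral_on \<alpha> w" for w
  proof -
    define z where "z i j = \<lfloor>tr (w i * \<alpha> j)\<rfloor>" for i j
    have z: "tr (w i * \<alpha> j) = of_int (z i j)" for i j
      using that by (auto simp: z_def integral_on_def elim!: Ints_cases)
    have "D w = \<bar>det (\<chi> i j. of_int (z i j))\<bar>"
      unfolding z[symmetric] det_gram D_def ..
    also have "\<dots> = of_int \<bar>det (\<chi> i j. z i j)\<bar>" by (simp add: of_int_det)
    finally show ?thesis by simp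
  qed
  obtain x i0 where x: "\<And>j. tr (x * \<alpha> j) \<in> \<int>" "tr (dual w i0 * x) \<notin> \<int>"
    using \<open>\<not> unimodular \<alpha> w\<close> by (auto simp: unimodular_def)
  define q where "q i = field_trace TYPE('n) (dual w i * x)" for i
  define c where "c i = frac (q i)" for i
  define v where "v = x - (\<Sum>i\<in>UNIV. of_int \<lfloor>q i\<rfloor> * w i)"
  have "x = (\<Sum>i\<in>UNIV. of_rat (q i) * w i)" unfolding q_def by (rule expand[OF w(1)])
  then have v: "v = (\<Sum>k\<in>UNIV. of_rat (c k) * w k)"
    by (simp add: v_def c_def frac_def of_rat_diff algebra_simps sum_subtractf)
  have "c i0 \<noteq> 0"
  proof
    assume "c i0 = 0"
    then have "q i0 = of_int \<lfloor>q i0\<rfloor>" by (simp add: c_def frac_def)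
    then have "of_rat (q i0) = (of_int \<lfloor>q i0\<rfloor> :: real)" by (metis of_rat_of_int_eq)
    then show False using x(2) by (simp add: q_def field_trace_eq)
  qed
  then have c: "c k \<ge> 0" "c i0 > 0" for k by (simp_all add: c_def less_le)
  have "subdivision ((\<lambda>i. w(i := v)) ` {i. c i > 0}) w"
    by (rule subdivision_star[OF w(1) v c])
  moreover have "integral_on \<alpha> (w(i := v))" for i
  proof -
    have "tr (v * \<alpha> j) = tr (x * \<alpha> j) - (\<Sum>i\<in>UNIV. of_int \<lfloor>q i\<rfloor> * tr (w i * \<alpha> j))" for j
      by (simp add: v_def left_diff_distrib tr_diff sum_distrib_right tr_sum mult.assoc tr_of_int_mult)
    then have "tr (v * \<alpha> j) \<in> \<int>" for j
      using x(1) w(2) by (auto intro!: Ints_diff Ints_sum Ints_mult simp: integral_on_def)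
    then show ?thesis using w(2) by (auto simp: integral_on_def)
  qed
  moreover have "nat \<lfloor>D (w(i := v))\<rfloor> < nat \<lfloor>D w\<rfloor>" if "c i > 0" for i
  proof -
    have "D (w(i := v)) = of_rat (c i) * D w"
      using that by (simp add: D_def emat_upd_lincomb[OF v] abs_mult)
    moreover have "of_rat (c i) < (1 :: real)" using frac_lt_1[of "q i"] by (simp add: c_def)
    moreover have "D w > 0" using w(1) \<alpha> by (simp add: D_def indep_def)
    ultimately have "D (w(i := v)) < D w" by simp
    moreover have "D (w(i := v)) \<ge> 0" by (simp add: D_def)
    moreover have "of_int \<lfloor>D w\<rfloor> = D w" "of_int \<lfloor>D (w(i := v))\<rfloor> = D (w(i := v))"
      using D_Ints[OF w(2)] D_Ints[OF \<open>integral_on \<alpha> (w(i := v))\<close>] by (auto elim!: Ints_cases)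
    ultimately show ?thesis by linarith
  qed
  ultimately show "\<exists>W. subdivision W w \<and> (\<forall>w'\<in>W. (indep w' \<and> integral_on \<alpha> w') \<and>
      nat \<lfloor>\<bar>det (emat w') * det (emat \<alpha>)\<bar>\<rfloor> < nat \<lfloor>\<bar>det (emat w) * det (emat \<alpha>)\<bar>\<rfloor>)"
    unfolding D_def by (intro exI[of _ "(\<lambda>i. w(i := v)) ` {i. c i > 0}"]) (auto simp: subdivision_def)
qed (use assms in auto)

text \<open>The order matters: \<open>unsplit\<close> is inherited by every refinement, so the cuts
  along \<open>L\<close> come first; then the generators are made integral, which is the starting
  point for unimodular refinement.\<close>

lemma good_subdivision:
  assumes \<alpha>: "indep \<alpha>" and w: "indep w" and "finite L"
  obtains W where "subdivision W w"
    "\<And>w' \<beta>. w' \<in> W \<Longrightarrow> \<beta> \<in> L \<Longrightarrow> unsplit \<beta> w'"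
    "\<And>w'. w' \<in> W \<Longrightarrow> integral_on \<alpha> w' \<and> unimodular \<alpha> w'"
proof -
  obtain W where W: "subdivision W w" "\<forall>w'\<in>W. \<forall>\<beta>\<in>L. unsplit \<beta> w'"
    using subdivision_unsplit[OF w \<open>finite L\<close>] by blast
  have "\<exists>V. subdivision V w' \<and> (\<forall>x\<in>V. integral_on \<alpha> x \<and> unimodular \<alpha> x)" if "w' \<in> W" for w'
  proof -
    have "indep w'" using W(1) that by (auto simp: subdivision_def)
    then obtain V where V: "subdivision V w'" "\<forall>x\<in>V. indep x \<and> integral_on \<alpha> x"
      using subdivision_integral[of w' \<alpha>] by blast
    then have "\<forall>x\<in>V. \<exists>U. subdivision U x \<and> (\<forall>x\<in>U. integral_on \<alpha> x \<and> unimodular \<alpha> x)"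
      using subdivision_unimodular[OF \<alpha>] by blast
    then obtain f where f: "\<forall>x\<in>V. subdivision (f x) x \<and> (\<forall>x\<in>f x. integral_on \<alpha> x \<and> unimodular \<alpha> x)" by metis
    then have "subdivision (\<Union>x\<in>V. f x) w'" by (intro subdivision_bind[OF V(1)]) auto
    then show ?thesis using f by blast
  qed
  then obtain f where f: "\<And>w'. w' \<in> W \<Longrightarrow> subdivision (f w') w'"
    "\<And>w' x. w' \<in> W \<Longrightarrow> x \<in> f w' \<Longrightarrow> integral_on \<alpha> x \<and> unimodular \<alpha> x" by metis
  have "subdivision (\<Union>w'\<in>W. f w') w" by (rule subdivision_bind[OF W(1) f(1)])
  moreover have "unsplit \<beta> x" if "w' \<in> W" "x \<in> f w'" "\<beta> \<in> L" for w' x \<beta>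
    using that f(1) W(2) unsplit_subdivision by blast
  ultimately show ?thesis using f(2) by (intro that[of "\<Union>w'\<in>W. f w'"]) auto
qed

end

section \<open>Linear change of variables, and rational forms\<close>

lemma Basis_vec_real: "(Basis :: (real ^ 'n) set) = range (\<lambda>i. axis i 1)"
  by (auto simp: Basis_vec_def)

lemma prod_Basis_vec: "(\<Prod>b\<in>(Basis :: (real ^ 'n) set). f b) = (\<Prod>i\<in>UNIV. f (axis i 1))"
  unfolding Basis_vec_real by (subst prod.reindex) (auto intro!: injI simp: axis_eq_axis)

lemma sum_Basis_vec_nth: "(\<Sum>b\<in>(Basis :: (real ^ 'n) set). z b *\<^sub>R b) $ i = z (axis i 1)"
proof -
  have "(\<Sum>b\<in>(Basis :: (real ^ 'n) set). z b *\<^sub>R b) = (\<Sum>k\<in>UNIV. z (axis k 1) *\<^sub>R axis k 1)"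
    unfolding Basis_vec_real by (subst sum.reindex) (auto intro!: injI simp: axis_eq_axis)
  then show ?thesis by (simp add: axis_def if_distrib cong: if_cong)
qed

lemma nn_integral_lborel_vec_prod:
  assumes [measurable]: "\<And>i. f i \<in> borel_measurable borel"
  shows "(\<integral>\<^sup>+x. (\<Prod>i\<in>UNIV. f i ((x :: real ^ 'n) $ i)) \<partial>lborel) = (\<Prod>i\<in>UNIV. (\<integral>\<^sup>+x. f i x \<partial>lborel))"
proof -
  define g where "g b = f (THE i. b = axis i 1)" for b :: "real ^ 'n"
  have g: "g (axis i 1) = f i" for i
    by (simp add: g_def axis_eq_axis)
  have "(\<integral>\<^sup>+x. (\<Prod>b\<in>Basis. g b ((x :: real ^ 'n) \<bullet> b)) \<partial>lborel) = (\<Prod>b\<in>Basis. (\<integral>\<^sup>+x. g b x \<partial>lborel))"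
    by (rule nn_integral_lborel_prod) (auto simp: g_def)
  then show ?thesis by (simp add: prod_Basis_vec g inner_axis)
qed

lemma measurable_matrix_vector_mult [measurable]:
  "(\<lambda>x. A *v x) \<in> borel_measurable borel" for A :: "real ^ 'n ^ 'm"
  by (intro borel_measurable_continuous_onI linear_continuous_on matrix_vector_mul_bounded_linear)

text \<open>The library's linear change of variables is restricted to well-ordered index types.\<close>

lemma nn_integral_matrix_vector_mult:
  fixes A :: "real ^ 'n ^ 'n"
  assumes "det A \<noteq> 0" "f \<in> borel_measurable borel"
  shows "(\<integral>\<^sup>+x. f x \<partial>lborel) = ennreal \<bar>det A\<bar> * (\<integral>\<^sup>+x. f (A *v x) \<partial>lborel)"
proof -
  \<comment> \<open>The quantifier over \<open>f\<close> belongs to the induction claim, as the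
    product case applies it to \<open>f\<close> composed with \<open>A\<close>; the determinant is a
    premise of the claim because elementary factors may be singular.\<close>
  have "det A \<noteq> 0 \<longrightarrow> (\<forall>f\<in>borel_measurable borel.
      (\<integral>\<^sup>+x. f x \<partial>lborel) = ennreal \<bar>det A\<bar> * (\<integral>\<^sup>+x. f (A *v x) \<partial>lborel))"
  proof (induction A rule: induct_matrix_elementary)
    case (1 A B)
    show ?case
    proof (intro impI ballI)
      fix f :: "real ^ 'n \<Rightarrow> ennreal"
      assume "det (A ** B) \<noteq> 0" and [measurable]: "f \<in> borel_measurable borel"
      then have nz: "det A \<noteq> 0" "det B \<noteq> 0" by (auto simp: det_mul)
      have "(\<integral>\<^sup>+x. f x \<partial>lborel) = ennreal \<bar>det A\<bar> * (\<integral>\<^sup>+x. f (A *v x) \<partial>lborel)"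
        by (rule 1(1)[rule_format, OF nz(1)]) simp
      also have "(\<integral>\<^sup>+x. f (A *v x) \<partial>lborel) = ennreal \<bar>det B\<bar> * (\<integral>\<^sup>+x. f (A *v (B *v x)) \<partial>lborel)"
        by (rule 1(2)[rule_format, OF nz(2), of "\<lambda>x. f (A *v x)"]) simp
      finally show "(\<integral>\<^sup>+x. f x \<partial>lborel) = ennreal \<bar>det (A ** B)\<bar> * (\<integral>\<^sup>+x. f (A ** B *v x) \<partial>lborel)"
        by (simp add: det_mul abs_mult ennreal_mult matrix_vector_mul_assoc mult.assoc)
    qed
  next
    case (2 A i)
    then have "det A = 0" by (rule Determinants.det_zero_row)
    then show ?case by simp
  next
    case (3 A)
    define c where "c b = (A *v b) \<bullet> b" for b
    have Av: "(A *v x) $ i = A $ i $ i * x $ i" for x i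
    proof -
      have "(A *v x) $ i = (\<Sum>j\<in>UNIV. if j = i then A $ i $ i * x $ i else 0)"
        unfolding matrix_vector_mult_def vec_lambda_beta by (intro sum.cong refl) (simp add: 3)
      then show ?thesis by simp
    qed
    have c: "c (axis i 1) = A $ i $ i" for i by (simp add: c_def inner_axis Av)
    have det: "det A = (\<Prod>i\<in>UNIV. A $ i $ i)" by (rule det_diagonal[OF 3])
    show ?case
    proof (intro impI ballI)
      fix f :: "real ^ 'n \<Rightarrow> ennreal"
      assume "det A \<noteq> 0" and [measurable]: "f \<in> borel_measurable borel"
      then have "c b \<noteq> 0" if "b \<in> Basis" for b
        using that by (auto simp: Basis_vec_real c det)
      from lborel_affine_euclidean[of c 0, OF this]
      have "lborel = density (distr lborel borel (\<lambda>x. 0 + (\<Sum>j\<in>Basis. (c j * (x \<bullet> j)) *\<^sub>R j)))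
          (\<lambda>_. ennreal (\<Prod>j\<in>(Basis :: (real ^ 'n) set). \<bar>c j\<bar>))" by simp
      moreover have "(\<lambda>x. 0 + (\<Sum>j\<in>Basis. (c j * (x \<bullet> j)) *\<^sub>R j)) = (\<lambda>x. A *v x)"
        by (auto simp: fun_eq_iff vec_eq_iff sum_Basis_vec_nth Av c inner_axis simp del: sum_component)
      moreover have "(\<Prod>j\<in>(Basis :: (real ^ 'n) set). \<bar>c j\<bar>) = \<bar>det A\<bar>"
        by (simp add: prod_Basis_vec c det abs_prod)
      ultimately have "lborel = density (distr lborel borel (\<lambda>x. A *v x)) (\<lambda>_. ennreal \<bar>det A\<bar>)" by simp
      then have "(\<integral>\<^sup>+x. f x \<partial>lborel) =
          (\<integral>\<^sup>+x. f x \<partial>density (distr lborel borel (\<lambda>x. A *v x)) (\<lambda>_. ennreal \<bar>det A\<bar>))" by simp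
      then show "(\<integral>\<^sup>+x. f x \<partial>lborel) = ennreal \<bar>det A\<bar> * (\<integral>\<^sup>+x. f (A *v x) \<partial>lborel)"
        by (simp add: nn_integral_density nn_integral_distr nn_integral_cmult)
    qed
  next
    case (4 m n)
    define A :: "real ^ 'n ^ 'n" where "A = (\<chi> i j. mat 1 $ i $ Transposition.transpose m n j)"
    let ?p = "Transposition.transpose m n"
    have perm: "?p permutes UNIV" by (rule permutes_swap_id) auto
    have "\<bar>det A\<bar> = 1"
      unfolding A_def by (subst det_permute_columns[OF perm]) (simp add: abs_mult sign_def)
    have Av: "(A *v x) $ i = x $ ?p i" for x i
    proof -
      have "(A *v x) $ i = (\<Sum>j\<in>UNIV. if j = ?p i then x $ j else 0)"
        unfolding matrix_vector_mult_def vec_lambda_beta A_def mat_def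
      proof (intro sum.cong refl)
        fix j
        have "i = ?p j \<longleftrightarrow> j = ?p i" by (metis transpose_involutory)
        then show "(if i = ?p j then 1 else 0) * x $ j = (if j = ?p i then x $ j else 0)" by simp
      qed
      then show ?thesis by simp
    qed
    \<comment> \<open>A swap of coordinates permutes the sides of a box, and the volumes of boxes
      determine Lebesgue measure.\<close>
    have "lborel = distr lborel borel (\<lambda>x. A *v x)"
    proof (rule lborel_eqI)
      fix l u :: "real ^ 'n" assume lu: "\<And>b. b \<in> Basis \<Longrightarrow> l \<bullet> b \<le> u \<bullet> b"
      have lu': "l $ i \<le> u $ i" for i using lu[of "axis i 1"] by (simp add: inner_axis Basis_vec_real)
      have vim: "(\<lambda>x. A *v x) -` box l u = box (\<chi> i. l $ ?p i) (\<chi> i. u $ ?p i)"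
      proof (rule Set.set_eqI)
        fix x
        have "(\<forall>i. l $ i < x $ ?p i \<and> x $ ?p i < u $ i) \<longleftrightarrow> (\<forall>i. l $ ?p i < x $ i \<and> x $ i < u $ ?p i)"
          by (metis transpose_involutory)
        then show "x \<in> (\<lambda>x. A *v x) -` box l u \<longleftrightarrow> x \<in> box (\<chi> i. l $ ?p i) (\<chi> i. u $ ?p i)"
          by (simp add: mem_box_cart Av)
      qed
      have "emeasure (distr lborel borel (\<lambda>x. A *v x)) (box l u) = emeasure lborel (box (\<chi> i. l $ ?p i) (\<chi> i. u $ ?p i))"
        by (subst emeasure_distr) (simp_all add: vim)
      also have "\<dots> = ennreal (\<Prod>b\<in>Basis. ((\<chi> i. u $ ?p i) - (\<chi> i. l $ ?p i)) \<bullet> b)"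
        by (intro emeasure_lborel_box) (auto simp: Basis_vec_real inner_axis lu')
      also have "(\<Prod>b\<in>Basis. ((\<chi> i. u $ ?p i) - (\<chi> i. l $ ?p i)) \<bullet> b) = (\<Prod>i\<in>UNIV. u $ ?p i - l $ ?p i)"
        by (simp add: prod_Basis_vec inner_axis)
      also have "\<dots> = (\<Prod>i\<in>UNIV. u $ i - l $ i)"
        using prod.permute[OF perm, of "\<lambda>i. u $ i - l $ i"] by (simp add: o_def)
      finally show "emeasure (distr lborel borel (\<lambda>x. A *v x)) (box l u) = ennreal (\<Prod>b\<in>Basis. (u - l) \<bullet> b)"
        by (simp add: prod_Basis_vec inner_axis)
    qed simp
    note lborel = this
    have "(\<integral>\<^sup>+x. f x \<partial>lborel) = (\<integral>\<^sup>+x. f (A *v x) \<partial>lborel)" if [measurable]: "f \<in> borel_measurable borel" for f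
    proof -
      have "(\<integral>\<^sup>+x. f x \<partial>lborel) = (\<integral>\<^sup>+x. f x \<partial>distr lborel borel (\<lambda>x. A *v x))"
        using lborel by simp
      also have "\<dots> = (\<integral>\<^sup>+x. f (A *v x) \<partial>lborel)" by (rule nn_integral_distr) auto
      finally show ?thesis .
    qed
    then show ?case unfolding A_def[symmetric] \<open>\<bar>det A\<bar> = 1\<close> ennreal_1 mult_1 by blast
  next
    case (5 m n c)
    define A :: "real ^ 'n ^ 'n" where "A = (\<chi> i j. if i = m \<and> j = n then c else of_bool (i = j))"
    have Av: "(A *v x) $ i = (if i = m then x $ m + c * x $ n else x $ i)" for x i
    proof -
      have "(A *v x) $ i = (\<Sum>j\<in>UNIV. of_bool (i = j) * x $ j + of_bool (j = n) * (if i = m then c * x $ j else 0))"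
        unfolding matrix_vector_mult_def A_def using \<open>m \<noteq> n\<close> by (auto intro!: sum.cong simp: of_bool_def)
      then show ?thesis by (simp only: sum.distrib sum_of_bool_mult) simp
    qed
    have "det A = 1"
    proof -
      have "A = (\<chi> k. if k = m then row m (mat 1) + c *s row n (mat 1) else row k (mat 1))"
        using \<open>m \<noteq> n\<close> by (auto simp: A_def vec_eq_iff row_def mat_def of_bool_def)
      then show ?thesis using det_row_operation[OF \<open>m \<noteq> n\<close>, of "mat 1" c] by simp
    qed
    have "(\<integral>\<^sup>+x. f x \<partial>lborel) = (\<integral>\<^sup>+x. f (A *v x) \<partial>lborel)"
      if f [measurable]: "f \<in> borel_measurable borel" for f :: "real ^ 'n \<Rightarrow> ennreal"
    proof -
      \<comment> \<open>For the shear, coordinate \<open>m\<close> is integrated first: with the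
        others fixed it is merely translated, by \<open>c\<close> times coordinate
        \<open>n\<close>.\<close>
      interpret product_sigma_finite "\<lambda>_ :: real ^ 'n. lborel :: real measure" by standard
      define bm :: "real ^ 'n" where "bm = axis m 1"
      define bn :: "real ^ 'n" where "bn = axis n 1"
      define V where "V z = (\<Sum>b\<in>Basis. z b *\<^sub>R b)" for z :: "real ^ 'n \<Rightarrow> real"
      define I :: "(real ^ 'n) set" where "I = Basis - {bm}"
      have B: "Basis = insert bm I" "bm \<notin> I" "finite I" by (auto simp: I_def bm_def Basis_vec_real)
      have bmn: "bn \<noteq> bm" using \<open>m \<noteq> n\<close> by (simp add: bm_def bn_def axis_eq_axis)
      have [measurable]: "V \<in> Pi\<^sub>M Basis (\<lambda>_. lborel) \<rightarrow>\<^sub>M borel" unfolding V_def by measurable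
      have AV: "A *v V (x(bm := y)) = V (x(bm := c * x bn + 1 * y))" for x y
      proof (unfold vec_eq_iff, rule allI)
        fix i
        have Vn: "V z $ k = z (axis k 1)" for z k unfolding V_def by (rule sum_Basis_vec_nth)
        show "(A *v V (x(bm := y))) $ i = V (x(bm := c * x bn + 1 * y)) $ i"
          unfolding Av Vn using \<open>m \<noteq> n\<close> by (simp add: bm_def bn_def axis_eq_axis)
      qed
      have *: "(\<integral>\<^sup>+x. g x \<partial>lborel) = (\<integral>\<^sup>+x. (\<integral>\<^sup>+y. g (V (x(bm := y))) \<partial>lborel) \<partial>Pi\<^sub>M I (\<lambda>_. lborel))"
        if [measurable]: "g \<in> borel_measurable borel" for g :: "real ^ 'n \<Rightarrow> ennreal"
      proof -
        have L: "lborel = distr (Pi\<^sub>M Basis (\<lambda>_. lborel)) borel V"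
          unfolding V_def[abs_def] by (rule lborel_eq)
        have "(\<integral>\<^sup>+x. g x \<partial>lborel) = (\<integral>\<^sup>+x. g x \<partial>distr (Pi\<^sub>M Basis (\<lambda>_. lborel)) borel V)"
          by (rule arg_cong[OF L])
        also have "\<dots> = (\<integral>\<^sup>+x. g (V x) \<partial>Pi\<^sub>M Basis (\<lambda>_. lborel))"
          by (rule nn_integral_distr) auto
        also have "\<dots> = (\<integral>\<^sup>+x. (\<integral>\<^sup>+y. g (V (x(bm := y))) \<partial>lborel) \<partial>Pi\<^sub>M I (\<lambda>_. lborel))"
          unfolding B(1)
        proof (rule product_nn_integral_insert[OF B(3,2)])
          show "(\<lambda>x. g (V x)) \<in> borel_measurable (Pi\<^sub>M (insert bm I) (\<lambda>_. lborel))"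
            unfolding B(1)[symmetric] by measurable
        qed
        finally show ?thesis .
      qed
      have inner: "(\<integral>\<^sup>+y. f (V (x(bm := y))) \<partial>lborel) = (\<integral>\<^sup>+y. f (A *v V (x(bm := y))) \<partial>lborel)"
        if "x \<in> space (Pi\<^sub>M I (\<lambda>_. lborel))" for x
      proof -
        have "(\<lambda>y. x(bm := y)) \<in> lborel \<rightarrow>\<^sub>M Pi\<^sub>M Basis (\<lambda>_. lborel)"
          unfolding B(1) using that B(2) by (intro measurable_fun_upd[where J = I]) auto
        then have "(\<lambda>y. f (V (x(bm := y)))) \<in> borel_measurable borel"
          by measurable
        from nn_integral_real_affine[OF this, of 1 "c * x bn"] show ?thesis by (simp add: AV)
      qed
      have "(\<integral>\<^sup>+x. f x \<partial>lborel) = (\<integral>\<^sup>+x. (\<integral>\<^sup>+y. f (A *v V (x(bm := y))) \<partial>lborel) \<partial>Pi\<^sub>M I (\<lambda>_. lborel))"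
        unfolding *[OF f] by (intro nn_integral_cong inner)
      also have "\<dots> = (\<integral>\<^sup>+x. f (A *v x) \<partial>lborel)" by (rule *[symmetric]) simp
      finally show ?thesis .
    qed
    then show ?case unfolding A_def[symmetric] \<open>det A = 1\<close> abs_one ennreal_1 mult_1 by blast
  qed
  then show ?thesis using assms by blast
qed

section \<open>Gamma integrals\<close>

lemma nn_integral_power_exp_scaled:
  assumes "L > 0"
  shows "(\<integral>\<^sup>+t. ennreal (indicator {0<..} t * (t ^ m * exp (- (t * L)))) \<partial>lborel) = ennreal (fact m / L ^ Suc m)"
proof -
  define g :: "real \<Rightarrow> ennreal" where "g t = ennreal (t ^ m * exp (- t)) * indicator {0..} t" for t
  have [measurable]: "g \<in> borel_measurable borel" unfolding g_def by measurable
  have "(\<integral>\<^sup>+t. ennreal (indicator {0<..} t * (t ^ m * exp (- (t * L)))) \<partial>lborel) =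
      (\<integral>\<^sup>+t. ennreal (1 / L ^ m) * g (0 + L * t) \<partial>lborel)"
  proof (rule nn_integral_cong_AE)
    \<comment> \<open>At \<open>0\<close> the left integrand vanishes, but \<open>g\<close> does not
      when \<open>m = 0\<close>.\<close>
    have "AE t in lborel. t \<noteq> (0 :: real)" by (rule AE_lborel_singleton)
    then show "AE t in lborel. ennreal (indicator {0<..} t * (t ^ m * exp (- (t * L)))) = ennreal (1 / L ^ m) * g (0 + L * t)"
    proof (rule AE_mp, intro AE_I2 impI)
      fix t :: real assume "t \<noteq> 0"
      then show "ennreal (indicator {0<..} t * (t ^ m * exp (- (t * L)))) = ennreal (1 / L ^ m) * g (0 + L * t)"
        using assms
        by (auto simp: g_def indicator_def zero_le_mult_iff power_mult_distrib mult.commute ennreal_mult'[symmetric])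
    qed
  qed
  also have "\<dots> = ennreal (1 / L ^ m) * (\<integral>\<^sup>+t. g (0 + L * t) \<partial>lborel)"
    by (rule nn_integral_cmult) simp
  also have "(\<integral>\<^sup>+t. g t \<partial>lborel) = ennreal L * (\<integral>\<^sup>+t. g (0 + L * t) \<partial>lborel)"
    using nn_integral_real_affine[of g L 0] assms by simp
  then have "(\<integral>\<^sup>+t. g (0 + L * t) \<partial>lborel) = ennreal (1 / L) * (\<integral>\<^sup>+t. g t \<partial>lborel)"
    using assms by (simp add: mult.assoc[symmetric] ennreal_mult'[symmetric])
  also have "(\<integral>\<^sup>+t. g t \<partial>lborel) = ennreal (fact m)"
    unfolding g_def using nn_intergal_power_times_exp_Ici[of m] by simp
  finally show ?thesis using assms by (simp add: ennreal_mult'[symmetric] field_simps)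
qed

lemma nn_integral_monomial_exp:
  fixes L :: "'n::finite \<Rightarrow> real"
  assumes L: "\<And>i. L i > 0"
  shows "(\<integral>\<^sup>+t. ennreal (\<Prod>i\<in>UNIV. indicator {0<..} (t $ i) * (t $ i ^ \<mu> i * exp (- (t $ i * L i)))) \<partial>lborel) =
    ennreal (\<Prod>i\<in>UNIV. fact (\<mu> i) / L i ^ Suc (\<mu> i))"
proof -
  have nn: "0 \<le> indicator {0<..} s * (s ^ k * exp (- (s * l)))" for s l :: real and k
    by (auto simp: indicator_def)
  have "(\<integral>\<^sup>+t. ennreal (\<Prod>i\<in>UNIV. indicator {0<..} (t $ i) * (t $ i ^ \<mu> i * exp (- (t $ i * L i)))) \<partial>lborel) =
     (\<integral>\<^sup>+t. (\<Prod>i\<in>UNIV. (\<lambda>s. ennreal (indicator {0<..} s * (s ^ \<mu> i * exp (- (s * L i))))) (t $ i)) \<partial>lborel)"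
    by (intro nn_integral_cong) (simp add: prod_ennreal[OF nn])
  also have "\<dots> = (\<Prod>i\<in>UNIV. ennreal (fact (\<mu> i) / L i ^ Suc (\<mu> i)))"
    by (subst nn_integral_lborel_vec_prod) (simp_all add: nn_integral_power_exp_scaled[OF L] del: power_Suc)
  also have "\<dots> = ennreal (\<Prod>i\<in>UNIV. fact (\<mu> i) / L i ^ Suc (\<mu> i))"
    using L by (intro prod_ennreal) (auto simp: less_imp_le simp del: power_Suc)
  finally show ?thesis .
qed

text \<open>Homogeneous polynomials of degree \<open>d\<close> with rational coefficients, as
  functions of real variables. Building them monomial by monomial reduces the closure properties to
  inductions; \<open>rat_form_expand\<close> recovers the coefficients.\<close>

inductive rat_form :: "nat \<Rightarrow> (('n::finite \<Rightarrow> real) \<Rightarrow> real) \<Rightarrow> bool" where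
  zero: "rat_form d (\<lambda>t. 0)"
| monom_add: "rat_form d f \<Longrightarrow> (\<Sum>i\<in>UNIV. \<mu> i) = d \<Longrightarrow>
    rat_form d (\<lambda>t. of_rat q * (\<Prod>i\<in>UNIV. t i ^ \<mu> i) + f t)"

lemma rat_form_add: "rat_form d f \<Longrightarrow> rat_form d g \<Longrightarrow> rat_form d (\<lambda>t. f t + g t)"
  by (induction rule: rat_form.induct) (auto simp: add.assoc intro: rat_form.monom_add)

lemma rat_form_monom: "(\<Sum>i\<in>UNIV. \<mu> i) = d \<Longrightarrow> rat_form d (\<lambda>t. of_rat q * (\<Prod>i\<in>UNIV. t i ^ \<mu> i))"
  using rat_form.monom_add[OF rat_form.zero, of \<mu> d q] by simp

lemma rat_form_monom_mult:
  assumes "rat_form e g"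
  shows "rat_form ((\<Sum>i\<in>UNIV. \<mu> i) + e) (\<lambda>t. (of_rat q * (\<Prod>i\<in>UNIV. t i ^ \<mu> i)) * g t)"
  using assms
proof (induction rule: rat_form.induct)
  case (zero d)
  then show ?case by (simp add: rat_form.zero)
next
  case (monom_add d f \<nu> r)
  have "rat_form ((\<Sum>i\<in>UNIV. \<mu> i) + d) (\<lambda>t. of_rat (q * r) * (\<Prod>i\<in>UNIV. t i ^ (\<mu> i + \<nu> i)) +
      of_rat q * (\<Prod>i\<in>UNIV. t i ^ \<mu> i) * f t)"
    by (intro rat_form.monom_add monom_add.IH) (simp add: sum.distrib monom_add.hyps)
  then show ?case
    by (simp add: of_rat_mult power_add prod.distrib distrib_left mult_ac)
qed

lemma rat_form_mult: "rat_form d f \<Longrightarrow> rat_form e g \<Longrightarrow> rat_form (d + e) (\<lambda>t. f t * g t)"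
proof (induction rule: rat_form.induct)
  case (zero d)
  then show ?case by (simp add: rat_form.zero)
next
  case (monom_add d f \<mu> q)
  from rat_form_add[OF rat_form_monom_mult[OF monom_add.prems, of \<mu> q]] monom_add
  show ?case by (simp add: distrib_right)
qed

lemma rat_form_1: "rat_form 0 (\<lambda>t. 1)"
  using rat_form_monom[of "\<lambda>_. 0" 0 1] by simp

lemma rat_form_cmult: "rat_form d f \<Longrightarrow> rat_form d (\<lambda>t. of_rat q * f t)"
  using rat_form_monom_mult[of d f "\<lambda>_. 0" q] by simp

lemma rat_form_sum: "(\<And>a. a \<in> A \<Longrightarrow> rat_form d (f a)) \<Longrightarrow> rat_form d (\<lambda>t. \<Sum>a\<in>A. f a t)"
  by (induction A rule: infinite_finite_induct) (auto intro: rat_form.zero rat_form_add)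

lemma rat_form_prod:
  "finite A \<Longrightarrow> (\<And>a. a \<in> A \<Longrightarrow> rat_form d (f a)) \<Longrightarrow> rat_form (card A * d) (\<lambda>t. \<Prod>a\<in>A. f a t)"
  by (induction A rule: finite_induct) (auto intro: rat_form_1 rat_form_mult)

lemma rat_form_power: "rat_form d f \<Longrightarrow> rat_form (k * d) (\<lambda>t. f t ^ k)"
  by (induction k) (auto intro: rat_form_1 rat_form_mult)

lemma rat_form_linear:
  fixes q :: "'n::finite \<Rightarrow> rat"
  shows "rat_form 1 (\<lambda>t. \<Sum>i\<in>UNIV. t i * of_rat (q i))"
proof (rule rat_form_sum)
  fix i :: 'n
  have "(\<Prod>k\<in>UNIV. t k ^ of_bool (k = i)) = t i" for t :: "'n \<Rightarrow> real"
    by (subst prod.remove[of _ i]) auto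
  then show "rat_form 1 (\<lambda>t. t i * of_rat (q i))"
    using rat_form_monom[of "\<lambda>k. of_bool (k = i)" 1 "q i"] by (simp add: mult.commute of_bool_def)
qed

lemma rat_form_det:
  fixes A :: "'n::finite \<Rightarrow> rat ^ 'n ^ 'n"
  shows "rat_form CARD('n) (\<lambda>t. det (\<chi> r s. \<Sum>i\<in>UNIV. t i * of_rat (A i $ r $ s)))"
  unfolding det_def
proof (rule rat_form_sum)
  fix p :: "'n \<Rightarrow> 'n"
  have "rat_form (CARD('n) * 1) (\<lambda>t. \<Prod>r\<in>UNIV. \<Sum>i\<in>UNIV. t i * of_rat (A i $ r $ p r))"
    by (intro rat_form_prod rat_form_linear) auto
  then show "rat_form CARD('n) (\<lambda>t. of_int (sign p) * (\<Prod>r\<in>UNIV. (\<chi> r s. \<Sum>i\<in>UNIV. t i * of_rat (A i $ r $ s)) $ r $ p r))"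
    using rat_form_cmult[of "CARD('n)" _ "of_int (sign p)"] by simp
qed

lemma rat_form_expand:
  fixes f :: "('n::finite \<Rightarrow> real) \<Rightarrow> real"
  assumes "rat_form d f"
  shows "\<exists>c :: ('n \<Rightarrow> nat) \<Rightarrow> rat. \<forall>t. f t = (\<Sum>\<mu> | (\<Sum>i\<in>UNIV. \<mu> i) = d. of_rat (c \<mu>) * (\<Prod>i\<in>UNIV. t i ^ \<mu> i))"
  using assms
proof (induction rule: rat_form.induct)
  case (zero d)
  show ?case by (intro exI[of _ "\<lambda>_. 0"]) simp
next
  case (monom_add d f \<nu> q)
  then obtain c :: "('n \<Rightarrow> nat) \<Rightarrow> rat" where
    c: "\<And>t. f t = (\<Sum>\<mu> | (\<Sum>i\<in>UNIV. \<mu> i) = d. of_rat (c \<mu>) * (\<Prod>i\<in>UNIV. t i ^ \<mu> i))" by blast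
  have "finite {\<mu> :: 'n \<Rightarrow> nat. (\<Sum>i\<in>UNIV. \<mu> i) = d}"
  proof (rule finite_subset)
    show "{\<mu> :: 'n \<Rightarrow> nat. (\<Sum>i\<in>UNIV. \<mu> i) = d} \<subseteq> (\<Pi>\<^sub>E i\<in>UNIV. {..d})"
      by (auto intro: member_le_sum)
  qed (auto intro!: finite_PiE)
  then have "of_rat q * (\<Prod>i\<in>UNIV. t i ^ \<nu> i) + f t =
      (\<Sum>\<mu> | (\<Sum>i\<in>UNIV. \<mu> i) = d. of_rat (c \<mu> + (if \<mu> = \<nu> then q else 0)) * (\<Prod>i\<in>UNIV. t i ^ \<mu> i))" for t
    using monom_add.hyps
    by (simp add: c of_rat_add distrib_right sum.distrib if_distrib[of of_rat] if_distrib[of "\<lambda>x. x * _"] cong: if_cong)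
  then show ?case by (intro exI[of _ "\<lambda>\<mu>. c \<mu> + (if \<mu> = \<nu> then q else 0)"]) auto
qed

section \<open>Integrals over cones\<close>

context real_embeddings
begin

lemma measurable_in_cone [measurable]: "Measurable.pred borel (in_cone w)"
  unfolding in_cone_def[abs_def] by measurable

lemma measurable_act [measurable]: "act u \<in> borel_measurable borel"
proof -
  have "continuous_on UNIV (act u)"
    unfolding act_def by (intro continuous_on_vec_lambda continuous_intros)
  then show ?thesis by (rule borel_measurable_continuous_onI)
qed

lemma act_act: "act u (act u' y) = act (u * u') y"
  by (simp add: act_def vec_eq_iff \<tau>_mult mult.assoc)

lemma act_1 [simp]: "act 1 y = y"
  by (simp add: act_def vec_eq_iff)

lemma act_emb: "act u (emb x) = emb (u * x)"
  by (simp add: act_def vec_eq_iff \<tau>_mult)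

lemma inner_act_left: "act u z \<bullet> y = z \<bullet> act u y"
  by (simp add: act_def inner_vec_def mult_ac)

text \<open>The field is countable, so the excluded points form a countable union of
  hyperplanes.\<close>

lemma AE_generic: "AE y in lborel. generic y"
proof -
  obtain b :: "'n \<Rightarrow> 'a" where b: "rat_basis b" using rat_basis_exists by blast
  have "(UNIV :: 'a set) \<subseteq> range (\<lambda>q :: 'n \<Rightarrow> rat. \<Sum>i\<in>UNIV. of_rat (q i) * b i)"
  proof
    fix x :: 'a
    show "x \<in> range (\<lambda>q :: 'n \<Rightarrow> rat. \<Sum>i\<in>UNIV. of_rat (q i) * b i)"
      by (rule image_eqI, rule rat_basis_expand[OF b]) simp
  qed
  then have "countable (UNIV :: 'a set)"
    by (rule countable_subset) (intro countable_image uncountable_def countableI_type)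
  then have count: "countable {x :: 'a. x \<noteq> 0}" by (rule countable_subset[rotated]) auto
  have "AE y in lborel. emb x \<bullet> y \<noteq> 0" if "x \<noteq> 0" for x
  proof -
    have "emb x \<noteq> 0" using that emb_eq_iff[of x 0] by simp
    then have "negligible {y. emb x \<bullet> y = 0}" by (intro negligible_hyperplane) simp
    moreover have "{y. emb x \<bullet> y = 0} \<in> sets lborel" by measurable
    ultimately have "{y. emb x \<bullet> y = 0} \<in> null_sets lborel"
      by (simp add: negligible_iff_null_sets null_sets_completion_iff)
    then show ?thesis by (auto intro: AE_I')
  qed
  then have "AE y in lborel. \<forall>x\<in>{x. x \<noteq> 0}. emb x \<bullet> y \<noteq> 0"
    unfolding AE_ball_countable[OF count] by auto
  then show ?thesis by (simp add: generic_def)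
qed

lemma rat_form_norm_power:
  fixes w :: "'n \<Rightarrow> 'a"
  shows "rat_form (m * CARD('n)) (\<lambda>t. (\<Prod>j\<in>UNIV. \<Sum>i\<in>UNIV. t i * \<tau> j (w i)) ^ m)"
proof -
  obtain A :: "'n \<Rightarrow> rat ^ 'n ^ 'n" where
    A: "\<And>t. (\<Prod>j\<in>UNIV. \<Sum>i\<in>UNIV. t i * \<tau> j (w i)) = det (\<chi> r s. \<Sum>i\<in>UNIV. t i * of_rat (A i $ r $ s))"
    by (rule prod_linear_forms_eq_det[of w]) blast
  show ?thesis unfolding A by (intro rat_form_power rat_form_det)
qed

text \<open>Valued in \<open>ennreal\<close>, so that it can be summed over all units before
  convergence is known. It is used with \<open>m = k - 1\<close>.\<close>

definition cone_laplace :: "nat \<Rightarrow> ('n \<Rightarrow> 'a) \<Rightarrow> real ^ 'n \<Rightarrow> ennreal" where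
  "cone_laplace m w z =
    (\<integral>\<^sup>+y. indicator {y. in_cone w y} y * ennreal ((\<Prod>j\<in>UNIV. y $ j) ^ m * exp (- (z \<bullet> y))) \<partial>lborel)"

text \<open>The substitution by coordinates \<open>t\<close> in \<open>w\<close> has Jacobian
  \<open>\<bar>det (emat w)\<bar>\<close>, turns the norm power into a rational form in
  \<open>t\<close> and factors the exponential, so each monomial splits into Gamma integrals. One
  \<open>c\<close> serves all \<open>z\<close>. The signs of the \<open>c \<mu>\<close> are not
  tracked: the monomials are integrated as Bochner integrals, and nonnegativity of the total is read
  off from the integrand.\<close>

lemma cone_integral:
  assumes w: "indep w" "\<And>i j. \<tau> j (w i) > 0"
  obtains c :: "('n \<Rightarrow> nat) \<Rightarrow> rat" where
    "\<And>z. (\<And>j. z $ j > 0) \<Longrightarrow>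
      0 \<le> (\<Sum>\<mu> | (\<Sum>i\<in>UNIV. \<mu> i) = m * CARD('n). of_rat (c \<mu>) * (\<Prod>i\<in>UNIV. fact (\<mu> i) / (z \<bullet> emb (w i)) ^ Suc (\<mu> i))) \<and>
      cone_laplace m w z =
      ennreal (\<bar>det (emat w)\<bar> *
        (\<Sum>\<mu> | (\<Sum>i\<in>UNIV. \<mu> i) = m * CARD('n). of_rat (c \<mu>) * (\<Prod>i\<in>UNIV. fact (\<mu> i) / (z \<bullet> emb (w i)) ^ Suc (\<mu> i))))"
proof -
  obtain c :: "('n \<Rightarrow> nat) \<Rightarrow> rat" where
    c: "\<And>t. (\<Prod>j\<in>UNIV. \<Sum>i\<in>UNIV. t i * \<tau> j (w i)) ^ m =
      (\<Sum>\<mu> | (\<Sum>i\<in>UNIV. \<mu> i) = m * CARD('n). of_rat (c \<mu>) * (\<Prod>i\<in>UNIV. t i ^ \<mu> i))"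
    using rat_form_expand[OF rat_form_norm_power[of m w]] by blast
  let ?M = "{\<mu> :: 'n \<Rightarrow> nat. (\<Sum>i\<in>UNIV. \<mu> i) = m * CARD('n)}"
  show ?thesis
  proof (rule that[of c])
    fix z :: "real ^ 'n" assume z: "\<And>j. z $ j > 0"
    define L where "L i = z \<bullet> emb (w i)" for i
    have L: "L i > 0" for i unfolding L_def inner_vec_def using z w(2) by (auto intro!: sum_pos)
    define I where "I \<mu> = (\<Prod>i\<in>UNIV. fact (\<mu> i) / L i ^ Suc (\<mu> i))" for \<mu> :: "'n \<Rightarrow> nat"
    define h where "h \<mu> t = (\<Prod>i\<in>UNIV. indicator {0<..} (t $ i) * (t $ i ^ \<mu> i * exp (- (t $ i * L i))))"
      for \<mu> :: "'n \<Rightarrow> nat" and t :: "real ^ 'n"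
    have h_nonneg: "h \<mu> t \<ge> 0" for \<mu> t unfolding h_def by (auto intro!: prod_nonneg simp: indicator_def)
    have h_meas [measurable]: "h \<mu> \<in> borel_measurable borel" for \<mu> unfolding h_def[abs_def] by measurable
    have hI: "has_bochner_integral lborel (h \<mu>) (I \<mu>)" for \<mu>
    proof (rule has_bochner_integral_nn_integral)
      show "0 \<le> I \<mu>" unfolding I_def using L by (intro prod_nonneg) (auto simp: less_imp_le)
      show "(\<integral>\<^sup>+t. ennreal (h \<mu> t) \<partial>lborel) = ennreal (I \<mu>)"
        unfolding h_def I_def by (rule nn_integral_monomial_exp[OF L])
    qed (auto simp: h_nonneg)
    define F where "F t = (\<Sum>\<mu>\<in>?M. of_rat (c \<mu>) * h \<mu> t)" for t
    define S where "S = (\<Sum>\<mu>\<in>?M. of_rat (c \<mu>) * I \<mu>)"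
    have FS: "has_bochner_integral lborel F S"
      unfolding F_def S_def by (intro has_bochner_integral_sum has_bochner_integral_mult_right hI)
    define A where "A = transpose (emat w)"
    have Av: "A *v t = (\<Sum>i\<in>UNIV. (t $ i) *\<^sub>R emb (w i))" for t
      by (simp add: A_def vec_eq_iff matrix_vector_mult_def transpose_def mult.commute)
    have cone_A: "in_cone w (A *v t) \<longleftrightarrow> (\<forall>i. t $ i > 0)" for t
      unfolding in_cone_def Av by (simp only: coordinates[OF w(1)])
    define f where "f y = indicator {y. in_cone w y} y * ennreal ((\<Prod>j\<in>UNIV. y $ j) ^ m * exp (- (z \<bullet> y)))" for y
    have [measurable]: "f \<in> borel_measurable borel" unfolding f_def[abs_def] by measurable
    have fA: "f (A *v t) = ennreal (F t) \<and> F t \<ge> 0" for t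
    proof (cases "\<forall>i. t $ i > 0")
      case True
      have "h \<mu> t = (\<Prod>i\<in>UNIV. t $ i ^ \<mu> i) * exp (- (z \<bullet> (A *v t)))" for \<mu>
      proof -
        have "z \<bullet> (A *v t) = (\<Sum>i\<in>UNIV. t $ i * L i)"
          unfolding Av L_def by (simp add: inner_sum_right)
        then have "exp (- (z \<bullet> (A *v t))) = (\<Prod>i\<in>UNIV. exp (- (t $ i * L i)))"
          by (simp add: exp_sum sum_negf[symmetric])
        then show ?thesis using True by (simp add: h_def prod.distrib)
      qed
      then have "F t = (\<Sum>\<mu>\<in>?M. of_rat (c \<mu>) * (\<Prod>i\<in>UNIV. t $ i ^ \<mu> i)) * exp (- (z \<bullet> (A *v t)))"
        by (simp add: F_def sum_distrib_right mult.assoc)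
      also have "(\<Sum>\<mu>\<in>?M. of_rat (c \<mu>) * (\<Prod>i\<in>UNIV. t $ i ^ \<mu> i)) = (\<Prod>j\<in>UNIV. (A *v t) $ j) ^ m"
        unfolding c[of "\<lambda>i. t $ i", symmetric] by (simp add: Av)
      finally have F: "F t = (\<Prod>j\<in>UNIV. (A *v t) $ j) ^ m * exp (- (z \<bullet> (A *v t)))" .
      moreover have "(A *v t) $ j \<ge> 0" for j
        unfolding Av using True w(2) by (auto intro!: sum_nonneg simp: less_imp_le)
      ultimately show ?thesis using True by (auto simp: f_def cone_A intro!: mult_nonneg_nonneg prod_nonneg zero_le_power)
    next
      case False
      then obtain i where "\<not> t $ i > 0" by blast
      then have "indicator {0<..} (t $ i) = (0 :: real)" by simp
      then have "h \<mu> t = 0" for \<mu> unfolding h_def by (intro prod_zero) (auto intro!: bexI[of _ i])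
      then show ?thesis using False by (simp add: f_def cone_A F_def)
    qed
    have "(\<integral>\<^sup>+y. f y \<partial>lborel) = ennreal \<bar>det A\<bar> * (\<integral>\<^sup>+t. f (A *v t) \<partial>lborel)"
      by (rule nn_integral_matrix_vector_mult) (use w(1) in \<open>simp_all add: A_def det_transpose indep_def\<close>)
    also have "(\<integral>\<^sup>+t. f (A *v t) \<partial>lborel) = (\<integral>\<^sup>+t. ennreal (F t) \<partial>lborel)"
      using fA by simp
    also have "\<dots> = ennreal (integral\<^sup>L lborel F)"
      using FS fA by (intro nn_integral_eq_integral) (auto simp: has_bochner_integral_iff)
    also have "integral\<^sup>L lborel F = S" using FS by (simp add: has_bochner_integral_iff)
    finally have "(\<integral>\<^sup>+y. f y \<partial>lborel) = ennreal (\<bar>det A\<bar> * S)" by (simp add: ennreal_mult')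
    moreover have "S \<ge> 0"
      using FS fA integral_nonneg_AE[of F lborel] by (auto simp: has_bochner_integral_iff)
    ultimately show "0 \<le> (\<Sum>\<mu>\<in>?M. of_rat (c \<mu>) * (\<Prod>i\<in>UNIV. fact (\<mu> i) / (z \<bullet> emb (w i)) ^ Suc (\<mu> i))) \<and>
      cone_laplace m w z =
      ennreal (\<bar>det (emat w)\<bar> *
        (\<Sum>\<mu>\<in>?M. of_rat (c \<mu>) * (\<Prod>i\<in>UNIV. fact (\<mu> i) / (z \<bullet> emb (w i)) ^ Suc (\<mu> i))))"
      by (simp add: cone_laplace_def f_def S_def I_def L_def A_def det_transpose del: power_Suc)
  qed
qed

section \<open>A weighted fundamental domain for the totally positive units\<close>

lemma in_cone_positive:
  fixes w :: "'n \<Rightarrow> 'a"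
  assumes "indep w" "\<And>i j. \<tau> j (w i) > 0" "in_cone w y"
  shows "y $ j > 0"
  unfolding expand_component[OF assms(1), of y j] using assms(2,3) by (auto intro!: sum_pos simp: in_cone_def)

text \<open>The sign of \<open>\<beta>\<close> at a generic point is decided by the generators
  alone; lying in a translated cone thus becomes a condition on the whole part that no longer
  mentions \<open>y\<close>.\<close>

lemma unsplit_positive:
  assumes w: "indep w" and "unsplit \<beta> w" "\<beta> \<noteq> 0" "generic y" "in_cone w y"
  shows "emb \<beta> \<bullet> y > 0 \<longleftrightarrow> (\<forall>k. tr (\<beta> * w k) \<ge> 0)"
proof -
  define s where "s k = emb (dual w k) \<bullet> y" for k
  have s: "s k > 0" for k using assms(5) by (simp add: s_def in_cone_def)
  have "emb \<beta> \<bullet> y = emb \<beta> \<bullet> (\<Sum>k\<in>UNIV. s k *\<^sub>R emb (w k))"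
    unfolding s_def using expand_vec[OF w, of y] by simp
  also have "\<dots> = (\<Sum>k\<in>UNIV. s k * tr (\<beta> * w k))" by (simp add: inner_sum_right inner_emb)
  finally have eq: "emb \<beta> \<bullet> y = (\<Sum>k\<in>UNIV. s k * tr (\<beta> * w k))" .
  have nz: "emb \<beta> \<bullet> y \<noteq> 0" using assms(3,4) by (simp add: generic_def)
  show ?thesis
  proof
    assume "\<forall>k. tr (\<beta> * w k) \<ge> 0"
    then have "emb \<beta> \<bullet> y \<ge> 0" unfolding eq using s by (auto intro!: sum_nonneg simp: less_imp_le)
    with nz show "emb \<beta> \<bullet> y > 0" by simp
  next
    assume pos: "emb \<beta> \<bullet> y > 0"
    have "\<not> (\<forall>k. tr (\<beta> * w k) \<le> 0)"
    proof
      assume "\<forall>k. tr (\<beta> * w k) \<le> 0"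
      then have "emb \<beta> \<bullet> y \<le> 0" unfolding eq using s
        by (auto intro!: sum_nonpos mult_nonneg_nonpos simp: less_imp_le)
      with pos show False by simp
    qed
    with assms(2) show "\<forall>k. tr (\<beta> * w k) \<ge> 0" by (simp add: unsplit_def)
  qed
qed

text \<open>Here \<open>h w\<close> counts the unit translates of the initial Shintani cone that contain the part \<open>w\<close>.\<close>

lemma weighted_fundamental_domain:
  assumes \<alpha>: "indep \<alpha>"
  obtains W :: "('n \<Rightarrow> 'a) set" and h :: "('n \<Rightarrow> 'a) \<Rightarrow> nat" where
    "finite W" "\<And>w. w \<in> W \<Longrightarrow> indep w" "\<And>w i j. w \<in> W \<Longrightarrow> \<tau> j (w i) > 0"
    "\<And>w. w \<in> W \<Longrightarrow> integral_on \<alpha> w" "\<And>w. w \<in> W \<Longrightarrow> unimodular \<alpha> w"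
    "\<And>y. generic y \<Longrightarrow> (\<And>j. y $ j > 0) \<Longrightarrow>
      (\<integral>\<^sup>+u. (\<Sum>w\<in>W. ennreal (1 / real (h w)) * indicator {y. in_cone w y} (act u y)) \<partial>count_space pos_units) = 1"
proof -
  obtain v where v: "indep v" "\<And>i j. \<tau> j (v i) > 0"
    "\<And>y. (\<And>j. y $ j > 0) \<Longrightarrow> \<exists>u\<in>pos_units. in_cone v (act u y)"
    by (rule shintani_cone) blast
  define U where "U = {u \<in> pos_units. \<exists>y. in_cone v y \<and> in_cone v (act u y)}"
  have finU: "finite U" unfolding U_def by (rule finite_cone_overlaps[OF v(1,2)])
  \<comment> \<open>The facet normals of the finitely many translates that can meet the cone of
    \<open>v\<close>: \<open>act u y\<close> lies in that cone iff every \<open>u * dual v i\<close>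
    pairs positively with \<open>y\<close>.\<close>
  define L where "L = (\<lambda>(u, i). u * dual v i) ` (U \<times> UNIV)"
  have "finite L" unfolding L_def using finU by (intro finite_imageI finite_cartesian_product) auto
  obtain W where W: "subdivision W v"
    "\<And>w' \<beta>. w' \<in> W \<Longrightarrow> \<beta> \<in> L \<Longrightarrow> unsplit \<beta> w'"
    "\<And>w'. w' \<in> W \<Longrightarrow> integral_on \<alpha> w' \<and> unimodular \<alpha> w'"
    by (rule good_subdivision[OF \<alpha> v(1) \<open>finite L\<close>]) blast
  have ind: "indep w" if "w \<in> W" for w using W(1) that by (auto simp: subdivision_def)
  have pos: "\<tau> j (w i) > 0" if w: "w \<in> W" for w i j
  proof -
    have "\<forall>i. emb (v i) \<bullet> axis j 1 \<ge> 0" using v(2) by (simp add: inner_axis less_imp_le)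
    then have "emb (w i) \<bullet> axis j 1 \<ge> 0" using W(1) w unfolding subdivision_def by blast
    then have "\<tau> j (w i) \<ge> 0" by (simp add: inner_axis)
    moreover have "w i \<noteq> 0" using tr_dual[OF ind[OF w], of i i] by auto
    then have "\<tau> j (w i) \<noteq> 0" by simp
    ultimately show ?thesis by linarith
  qed
  define h where "h w = card {u \<in> U. \<forall>i k. tr (u * dual v i * w k) \<ge> 0}" for w :: "'n \<Rightarrow> 'a"
  have "(\<integral>\<^sup>+u. (\<Sum>w\<in>W. ennreal (1 / real (h w)) * indicator {y. in_cone w y} (act u y)) \<partial>count_space pos_units) = 1"
    if y: "generic y" "\<And>j. y $ j > 0" for y
  proof -
    \<comment> \<open>The units that move \<open>y\<close> into the cone of \<open>v\<close>.
      Replacing \<open>y\<close> by \<open>act u1 y\<close> multiplies this set by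
      \<open>inverse u1\<close>, so all representatives see the same cardinality, and each gets the
      weight \<open>1 / card E\<close>.\<close>
    define E where "E = {u \<in> pos_units. in_cone v (act u y)}"
    obtain u0 where u0: "u0 \<in> E" using v(3)[OF y(2)] by (auto simp: E_def)
    have shift: "{u \<in> pos_units. in_cone v (act u (act u1 y))} = (\<lambda>u. u * inverse u1) ` E" if u1: "u1 \<in> pos_units" for u1
    proof (intro equalityI subsetI)
      fix u assume "u \<in> {u \<in> pos_units. in_cone v (act u (act u1 y))}"
      then have "u * u1 \<in> E" using u1 by (simp add: E_def act_act pos_units_mult)
      then show "u \<in> (\<lambda>u. u * inverse u1) ` E"
        using pos_units_nz[OF u1] by (intro image_eqI[of _ _ "u * u1"]) (auto simp: field_simps)
    next
      fix u assume "u \<in> (\<lambda>u. u * inverse u1) ` E"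
      then show "u \<in> {u \<in> pos_units. in_cone v (act u (act u1 y))}"
        using pos_units_nz[OF u1] u1 by (auto simp: E_def act_act mult.assoc pos_units_mult pos_units_inverse)
    qed
    have sub: "{u \<in> pos_units. in_cone v (act u (act u1 y))} = {u \<in> U. in_cone v (act u (act u1 y))}" if "u1 \<in> E" for u1
      using that by (auto simp: U_def E_def)
    have card: "card E = card {u \<in> U. in_cone v (act u (act u1 y))}" and finite_E: "finite E" if "u1 \<in> E" for u1
    proof -
      have u1: "u1 \<in> pos_units" using that by (simp add: E_def)
      have inj: "inj_on (\<lambda>u. u * inverse u1) E" using pos_units_nz[OF u1] by (auto intro: inj_onI)
      have eq: "{u \<in> U. in_cone v (act u (act u1 y))} = (\<lambda>u. u * inverse u1) ` E"
        using shift[OF u1] sub[OF that] by simp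
      show "card E = card {u \<in> U. in_cone v (act u (act u1 y))}" unfolding eq using inj by (simp add: card_image)
      have "finite ((\<lambda>u. u * inverse u1) ` E)" unfolding eq[symmetric] using finU by simp
      then show "finite E" using inj by (rule finite_imageD)
    qed
    \<comment> \<open>No facet in \<open>L\<close> cuts through the part, so the count on generators
      in \<open>h\<close> agrees with the count at the point \<open>act u1 y\<close>.\<close>
    have hE: "h w = card E" if "u1 \<in> E" "w \<in> W" "in_cone w (act u1 y)" for u1 w
    proof -
      have u1: "u1 \<in> pos_units" using that by (simp add: E_def)
      have gen: "generic (act u1 y)" using generic_act[OF y(1) pos_units_nz[OF u1]] .
      have iff: "in_cone v (act u (act u1 y)) \<longleftrightarrow> (\<forall>i k. tr (u * dual v i * w k) \<ge> 0)" if "u \<in> U" for u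
      proof -
        have "emb (u * dual v i) \<bullet> act u1 y > 0 \<longleftrightarrow> (\<forall>k. tr (u * dual v i * w k) \<ge> 0)" for i
        proof (rule unsplit_positive[OF ind[OF \<open>w \<in> W\<close>] _ _ gen \<open>in_cone w (act u1 y)\<close>])
          show "unsplit (u * dual v i) w" using \<open>u \<in> U\<close> \<open>w \<in> W\<close> by (intro W(2)) (auto simp: L_def)
          have "dual v i \<noteq> 0" using tr_dual[OF v(1), of i i] by auto
          then show "u * dual v i \<noteq> 0" using \<open>u \<in> U\<close> pos_units_nz by (auto simp: U_def)
        qed
        then show ?thesis by (simp add: in_cone_def inner_act)
      qed
      then have "{u \<in> U. in_cone v (act u (act u1 y))} = {u \<in> U. \<forall>i k. tr (u * dual v i * w k) \<ge> 0}"
        by (intro Collect_cong conj_cong refl iff)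
      then show ?thesis using card[OF that(1)] by (simp add: h_def)
    qed
    have inner: "(\<Sum>w\<in>W. ennreal (1 / real (h w)) * indicator {y. in_cone w y} (act u y)) = (if u \<in> E then ennreal (1 / real (card E)) else 0)"
      if u: "u \<in> pos_units" for u
    proof (cases "u \<in> E")
      case True
      have gen: "generic (act u y)" using generic_act[OF y(1) pos_units_nz[OF u]] .
      have "in_cone v (act u y)" using True by (simp add: E_def)
      then have "\<exists>!w. w \<in> W \<and> in_cone w (act u y)" using W(1) gen by (auto simp: subdivision_def)
      then obtain w where w: "w \<in> W \<and> in_cone w (act u y)" "\<forall>x. x \<in> W \<and> in_cone x (act u y) \<longrightarrow> x = w"
        by (rule ex1E)
      have "(\<Sum>x\<in>W. ennreal (1 / real (h x)) * indicator {y. in_cone x y} (act u y)) = (\<Sum>x\<in>W. if x = w then ennreal (1 / real (h w)) else 0)"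
      proof (intro sum.cong refl)
        fix x assume "x \<in> W"
        then have "in_cone x (act u y) \<longleftrightarrow> x = w" using w by blast
        then show "ennreal (1 / real (h x)) * indicator {y. in_cone x y} (act u y) = (if x = w then ennreal (1 / real (h w)) else 0)"
          by (cases "x = w") simp_all
      qed
      also have "\<dots> = ennreal (1 / real (h w))"
        using W(1) w(1) by (simp add: subdivision_def)
      finally show ?thesis using True hE[OF True, of w] w(1) by simp
    next
      case False
      have "\<not> in_cone w (act u y)" if "w \<in> W" for w
        using subdivision_cone_subset[OF v(1) W(1) that generic_act[OF y(1) pos_units_nz[OF u]]] False u
        by (auto simp: E_def)
      then show ?thesis using False by simp
    qed
    have finE: "finite E" "card E \<noteq> 0" using finite_E[OF u0] u0 by auto
    have "(\<integral>\<^sup>+u. (\<Sum>w\<in>W. ennreal (1 / real (h w)) * indicator {y. in_cone w y} (act u y)) \<partial>count_space pos_units) =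
      (\<integral>\<^sup>+u. (if u \<in> E then ennreal (1 / real (card E)) else 0) \<partial>count_space pos_units)"
      by (intro nn_integral_cong) (simp add: inner)
    also have "\<dots> = (\<Sum>u\<in>E. if u \<in> E then ennreal (1 / real (card E)) else 0)"
      using finE by (intro nn_integral_count_space') (auto simp: E_def)
    also have "\<dots> = 1" using finE by (simp add: ennreal_of_nat_eq_real_of_nat ennreal_mult'[symmetric])
    finally show ?thesis .
  qed
  then show ?thesis
    using that[of W h] W ind pos by (auto simp: subdivision_def)
qed

section \<open>Unfolding the orthant along the units\<close>

lemma pos_orthant_integral:
  assumes "\<And>j. z $ j > 0"
  shows "(\<integral>\<^sup>+y. indicator {y. \<forall>j. y $ j > 0} y * ennreal ((\<Prod>j\<in>UNIV. (y :: real ^ 'n) $ j) ^ m * exp (- (z \<bullet> y))) \<partial>lborel) =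
    ennreal (\<Prod>j\<in>UNIV. fact m / z $ j ^ Suc m)"
proof -
  have "indicator {y. \<forall>j. y $ j > 0} y * ennreal ((\<Prod>j\<in>UNIV. y $ j) ^ m * exp (- (z \<bullet> y))) =
      ennreal (\<Prod>j\<in>UNIV. indicator {0<..} (y $ j) * (y $ j ^ m * exp (- (y $ j * z $ j))))" for y :: "real ^ 'n"
  proof (cases "\<forall>j. y $ j > 0")
    case True
    have "exp (- (z \<bullet> y)) = (\<Prod>j\<in>UNIV. exp (- (y $ j * z $ j)))"
      by (simp add: inner_vec_def exp_sum sum_negf[symmetric] mult.commute)
    then show ?thesis using True by (simp add: prod.distrib prod_power_distrib)
  next
    case False
    then obtain i where "\<not> y $ i > 0" by blast
    then have "indicator {0<..} (y $ i) = (0 :: real)" by simp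
    then have "(\<Prod>j\<in>UNIV. indicator {0<..} (y $ j) * (y $ j ^ m * exp (- (y $ j * z $ j)))) = 0"
      by (intro prod_zero) (auto intro!: bexI[of _ i])
    from this[THEN arg_cong, of ennreal] show ?thesis using False by (simp only: ennreal_0) simp
  qed
  then show ?thesis using nn_integral_monomial_exp[of "\<lambda>j. z $ j" "\<lambda>_. m"] assms by simp
qed

text \<open>The partition of unity is inserted under the orthant integral, sum and integral are
  exchanged by Tonelli, and \<open>y\<close> is replaced by \<open>act u y\<close>. As
  \<open>u\<close> has norm \<open>1\<close>, this has Jacobian \<open>1\<close> and preserves the
  product of the coordinates, while the exponential passes \<open>u\<close> on to
  \<open>z\<close>.\<close>

lemma norm_power_as_unit_sum:
  fixes W :: "('n \<Rightarrow> 'a) set" and h :: "('n \<Rightarrow> 'a) \<Rightarrow> nat"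
  assumes W: "finite W" "\<And>w. w \<in> W \<Longrightarrow> indep w" "\<And>w i j. w \<in> W \<Longrightarrow> \<tau> j (w i) > 0"
    and part: "\<And>y. generic y \<Longrightarrow> (\<And>j. y $ j > 0) \<Longrightarrow>
      (\<integral>\<^sup>+u. (\<Sum>w\<in>W. ennreal (1 / real (h w)) * indicator {y. in_cone w y} (act u y)) \<partial>count_space pos_units) = 1"
    and z: "\<And>j. z $ j > 0"
  shows "ennreal (\<Prod>j\<in>UNIV. fact m / z $ j ^ Suc m) =
    (\<integral>\<^sup>+u. (\<Sum>w\<in>W. ennreal (1 / real (h w)) * cone_laplace m w (act u z)) \<partial>count_space pos_units)"
proof -
  define P where "P = {y :: real ^ 'n. \<forall>j. y $ j > 0}"
  have [measurable]: "P \<in> sets borel" unfolding P_def by measurable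
  define K where "K z y = ennreal ((\<Prod>j\<in>UNIV. y $ j) ^ m * exp (- (z \<bullet> y)))" for z y :: "real ^ 'n"
  have [measurable]: "K z \<in> borel_measurable borel" for z unfolding K_def[abs_def] by measurable
  define S where "S y = (\<Sum>w\<in>W. ennreal (1 / real (h w)) * indicator {y. in_cone w y} y)" for y
  have [measurable]: "S \<in> borel_measurable borel" unfolding S_def[abs_def] by measurable
  \<comment> \<open>The partition of unity is summed over inverses, so that the later substitution
    by \<open>act u\<close> removes the unit from \<open>S\<close>.\<close>
  have bij: "bij_betw inverse pos_units pos_units"
    by (rule bij_betw_byWitness[of _ inverse]) (auto simp: pos_units_inverse)
  \<comment> \<open>For Tonelli with the counting measure; the units are covered by the finite sets
    of integers with conjugates bounded by \<open>K\<close>.\<close>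
  have count: "countable pos_units"
  proof -
    have "pos_units \<subseteq> (\<Union>K::nat. {a. algebraic_int a \<and> (\<forall>j. \<bar>\<tau> j a\<bar> \<le> K)})"
    proof
      fix u assume u: "u \<in> pos_units"
      obtain K :: nat where K: "(\<Sum>j\<in>UNIV. \<bar>\<tau> j u\<bar>) \<le> K" using real_arch_simple by blast
      have "\<bar>\<tau> j u\<bar> \<le> K" for j
        using member_le_sum[of j UNIV "\<lambda>j. \<bar>\<tau> j u\<bar>"] K by simp
      with u show "u \<in> (\<Union>K::nat. {a. algebraic_int a \<and> (\<forall>j. \<bar>\<tau> j a\<bar> \<le> K)})" by (auto simp: pos_units_iff)
    qed
    then show ?thesis
      by (rule countable_subset) (intro countable_UN countableI_type countable_finite finite_bounded_integers)
  qed
  have part': "(\<integral>\<^sup>+u. S (act (inverse u) y) \<partial>count_space pos_units) = 1" if "generic y" "y \<in> P" for y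
    using nn_integral_bij_count_space[OF bij, of "\<lambda>u. S (act u y)"] part[of y] that
    by (simp add: S_def P_def)
  have "ennreal (\<Prod>j\<in>UNIV. fact m / z $ j ^ Suc m) = (\<integral>\<^sup>+y. indicator P y * K z y \<partial>lborel)"
    unfolding P_def K_def by (rule pos_orthant_integral[OF z, symmetric])
  also have "\<dots> = (\<integral>\<^sup>+y. (\<integral>\<^sup>+u. indicator P y * K z y * S (act (inverse u) y) \<partial>count_space pos_units) \<partial>lborel)"
  proof (rule nn_integral_cong_AE)
    show "AE y in lborel. indicator P y * K z y = (\<integral>\<^sup>+u. indicator P y * K z y * S (act (inverse u) y) \<partial>count_space pos_units)"
      using AE_generic
    proof (rule AE_mp, intro AE_I2 impI)
      fix y :: "real ^ 'n" assume "generic y"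
      then show "indicator P y * K z y = (\<integral>\<^sup>+u. indicator P y * K z y * S (act (inverse u) y) \<partial>count_space pos_units)"
        by (cases "y \<in> P") (simp_all add: nn_integral_cmult part')
    qed
  qed
  also have "\<dots> = (\<integral>\<^sup>+u. (\<integral>\<^sup>+y. indicator P y * K z y * S (act (inverse u) y) \<partial>lborel) \<partial>count_space pos_units)"
    by (rule nn_integral_count_space_nn_integral[OF count]) measurable
  also have "\<dots> = (\<integral>\<^sup>+u. (\<Sum>w\<in>W. ennreal (1 / real (h w)) * (\<integral>\<^sup>+y. indicator {y. in_cone w y} y * K (act u z) y \<partial>lborel)) \<partial>count_space pos_units)"
  proof (rule nn_integral_cong)
    fix u assume "u \<in> space (count_space pos_units)"
    then have u: "u \<in> pos_units" by simp
    note u0 = pos_units_nz[OF u] and upos = pos_units_pos[OF u]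
    define D :: "real ^ 'n ^ 'n" where "D = (\<chi> i j. if i = j then \<tau> i u else 0)"
    have detD: "det D = 1" unfolding D_def using nrm_pos_unit[OF u] by (subst det_diagonal) (auto simp: nrm_def)
    have Dv: "D *v y = act u y" for y
      by (simp add: D_def act_def vec_eq_iff matrix_vector_mult_def if_distrib[of "\<lambda>x. x * _"] cong: if_cong)
    have "(\<integral>\<^sup>+y. indicator P y * K z y * S (act (inverse u) y) \<partial>lborel) =
      ennreal \<bar>det D\<bar> * (\<integral>\<^sup>+y. indicator P (D *v y) * K z (D *v y) * S (act (inverse u) (D *v y)) \<partial>lborel)"
      by (rule nn_integral_matrix_vector_mult) (use detD in \<open>simp, measurable\<close>)
    also have "\<dots> = (\<integral>\<^sup>+y. (\<Sum>w\<in>W. ennreal (1 / real (h w)) * (indicator {y. in_cone w y} y * K (act u z) y)) \<partial>lborel)"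
      unfolding detD abs_one ennreal_1 mult_1
    proof (rule nn_integral_cong)
      fix y
      have 1: "act (inverse u) (D *v y) = y" unfolding Dv act_act using u0 by simp
      have 2: "K z (D *v y) = K (act u z) y"
        unfolding K_def inner_act_left Dv using nrm_pos_unit[OF u] by (simp add: act_def prod.distrib nrm_def)
      have 3: "D *v y \<in> P \<longleftrightarrow> y \<in> P"
        unfolding Dv P_def using upos by (simp add: act_def zero_less_mult_iff less_not_sym[OF upos])
      have 4: "indicator P y * S y = S y"
      proof (cases "y \<in> P")
        case False
        then have "\<not> in_cone w y" if "w \<in> W" for w
          using in_cone_positive[OF W(2,3)[OF that]] by (auto simp: P_def)
        then show ?thesis by (simp add: S_def)
      qed simp
      have "indicator P (D *v y) * K z (D *v y) * S (act (inverse u) (D *v y)) = K (act u z) y * (indicator P y * S y)"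
        unfolding 1 2 using 3 by (simp add: indicator_def mult_ac)
      also have "\<dots> = (\<Sum>w\<in>W. ennreal (1 / real (h w)) * (indicator {y. in_cone w y} y * K (act u z) y))"
        unfolding 4 by (simp add: S_def sum_distrib_left mult_ac)
      finally show "indicator P (D *v y) * K z (D *v y) * S (act (inverse u) (D *v y)) =
        (\<Sum>w\<in>W. ennreal (1 / real (h w)) * (indicator {y. in_cone w y} y * K (act u z) y))" .
    qed
    also have "\<dots> = (\<Sum>w\<in>W. \<integral>\<^sup>+y. ennreal (1 / real (h w)) * (indicator {y. in_cone w y} y * K (act u z) y) \<partial>lborel)"
      by (rule nn_integral_sum) measurable
    also have "\<dots> = (\<Sum>w\<in>W. ennreal (1 / real (h w)) * (\<integral>\<^sup>+y. indicator {y. in_cone w y} y * K (act u z) y \<partial>lborel))"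
      by (intro sum.cong refl nn_integral_cmult) measurable
    finally show "(\<integral>\<^sup>+y. indicator P y * K z y * S (act (inverse u) y) \<partial>lborel) =
      (\<Sum>w\<in>W. ennreal (1 / real (h w)) * (\<integral>\<^sup>+y. indicator {y. in_cone w y} y * K (act u z) y \<partial>lborel))" .
  qed
  finally show ?thesis by (simp add: K_def cone_laplace_def)
qed

end

section \<open>Conical zeta values\<close>

lemma has_sum_finite_sum:
  fixes f :: "'i \<Rightarrow> 'a \<Rightarrow> real"
  assumes "finite I" "\<And>i. i \<in> I \<Longrightarrow> (f i has_sum s i) A"
  shows "((\<lambda>x. \<Sum>i\<in>I. f i x) has_sum (\<Sum>i\<in>I. s i)) A"
  using assms by (induction I rule: finite_induct) (auto intro: has_sum_add)

lemma infsum_eq_of_nn_integral: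
  fixes g :: "'a \<Rightarrow> real"
  assumes "\<And>x. x \<in> A \<Longrightarrow> 0 \<le> g x" "0 \<le> r" "(\<integral>\<^sup>+x. ennreal (g x) \<partial>count_space A) = ennreal r"
  shows "infsum g A = r"
proof -
  have "has_bochner_integral (count_space A) g r"
    using assms by (intro has_bochner_integral_nn_integral) (auto simp: AE_count_space)
  then have "Infinite_Set_Sum.abs_summable_on g A" "infsetsum g A = r"
    by (auto simp: has_bochner_integral_iff Infinite_Set_Sum.abs_summable_on_def infsetsum_def)
  then show ?thesis using infsetsum_infsum by metis
qed

text \<open>A finite set of lattice points fits into a box, over which the sum of products is a
  product of sums.\<close>

lemma summable_on_prod_inverse_squares:
  "(\<lambda>z :: real ^ 'n. \<Prod>i\<in>UNIV. inverse ((z $ i)\<^sup>2)) summable_on {z. \<forall>i. z $ i \<in> \<int> \<and> z $ i > 0}"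
    (is "?f summable_on ?A")
proof (rule nonneg_bdd_above_summable_on)
  show "?f z \<ge> 0" for z by (intro prod_nonneg) auto
  \<comment> \<open>The term at \<open>m = 0\<close> is \<open>inverse 0 = 0\<close>, so the sum may
    start there.\<close>
  define S where "S = (\<Sum>m. inverse (real m ^ 2))"
  have summ: "summable (\<lambda>m. inverse (real m ^ 2))" by (rule inverse_power_summable) simp
  show "bdd_above (sum ?f ` {F. F \<subseteq> ?A \<and> finite F})"
  proof (intro bdd_aboveI2)
    fix F assume F: "F \<in> {F. F \<subseteq> ?A \<and> finite F}"
    define g where "g z i = nat \<lfloor>z $ i\<rfloor>" for z :: "real ^ 'n" and i
    have zg: "z $ i = real (g z i)" if "z \<in> F" for z i
    proof -
      have "z $ i \<in> \<int>" "z $ i > 0" using F that by auto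
      then show ?thesis by (auto simp: g_def elim!: Ints_cases)
    qed
    define N where "N = Suc (\<Sum>z\<in>F. \<Sum>i\<in>UNIV. g z i)"
    have "g z i < N" if "z \<in> F" for z i
    proof -
      have "g z i \<le> (\<Sum>i\<in>UNIV. g z i)" by (rule member_le_sum) auto
      also have "\<dots> \<le> (\<Sum>z\<in>F. \<Sum>i\<in>UNIV. g z i)"
        using F that by (intro member_le_sum[of z F "\<lambda>z. \<Sum>i\<in>UNIV. g z i"]) auto
      finally show ?thesis by (simp add: N_def)
    qed
    then have sub: "g ` F \<subseteq> (\<Pi>\<^sub>E i\<in>UNIV. {..<N})" by (auto simp: PiE_iff)
    have inj: "inj_on g F"
    proof (rule inj_onI)
      fix x y assume "x \<in> F" "y \<in> F" "g x = g y"
      then show "x = y" using zg[of x] zg[of y] by (simp add: vec_eq_iff)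
    qed
    have "sum ?f F = (\<Sum>z\<in>F. \<Prod>i\<in>UNIV. inverse (real (g z i) ^ 2))"
      by (intro sum.cong refl prod.cong) (simp add: zg)
    also have "\<dots> = (\<Sum>h\<in>g ` F. \<Prod>i\<in>UNIV. inverse (real (h i) ^ 2))"
      using inj by (simp add: sum.reindex)
    also have "\<dots> \<le> (\<Sum>h\<in>(\<Pi>\<^sub>E i\<in>(UNIV :: 'n set). {..<N}). \<Prod>i\<in>UNIV. inverse (real (h i) ^ 2))"
      by (intro sum_mono2 sub finite_PiE prod_nonneg) auto
    also have "\<dots> = (\<Prod>i\<in>(UNIV :: 'n set). \<Sum>m<N. inverse (real m ^ 2))"
      by (subst prod_sum_PiE) auto
    also have "\<dots> \<le> (\<Prod>i\<in>(UNIV :: 'n set). S)"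
      unfolding S_def by (intro prod_mono conjI sum_nonneg sum_le_suminf summ) auto
    finally show "sum ?f F \<le> (\<Prod>i\<in>(UNIV :: 'n set). S)" .
  qed
qed

context real_embeddings
begin

text \<open>The image of the positive orthant under \<open>emat w\<close>, spanned by its columns:
  one generator per embedding \<open>\<tau> j\<close>, with entries \<open>\<tau> j (w i)\<close>.
  In contrast, \<open>in_cone w\<close> is the cone of the rows.\<close>

definition basis_cone :: "('n \<Rightarrow> 'a) \<Rightarrow> (real ^ 'n) set" where
  "basis_cone w = {\<chi> i. emb (w i) \<bullet> y | y. \<forall>j. y $ j > 0}"

lemma basis_cone_positive:
  assumes "\<And>i j. \<tau> j (w i) > 0" "z \<in> basis_cone w"
  shows "z $ i > 0"
  using assms by (auto simp: basis_cone_def inner_vec_def intro!: sum_pos)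

lemma basis_cone_eq_open_cone:
  obtains vs :: "(real ^ 'n) list" where
    "\<And>v. v \<in> set vs \<Longrightarrow> \<exists>j. v = (\<chi> i. \<tau> j (w i))" "open_cone vs = basis_cone w"
proof -
  obtain js :: "'n list" where js: "distinct js" "set js = UNIV"
    using finite_distinct_list[of "UNIV :: 'n set"] by auto
  define V where "V j = (\<chi> i. \<tau> j (w i))" for j
  have bij: "bij_betw (\<lambda>l. js ! l) {..<length js} UNIV"
    using js by (intro bij_betw_nth) auto
  have sum_js: "(\<Sum>l<length js. f (js ! l)) = (\<Sum>j\<in>UNIV. f j)" for f :: "'n \<Rightarrow> real ^ 'n"
    by (rule sum.reindex_bij_betw[OF bij])
  have V_sum: "(\<Sum>j\<in>UNIV. y $ j *\<^sub>R V j) = (\<chi> i. emb (w i) \<bullet> y)" for y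
    by (simp add: vec_eq_iff V_def inner_vec_def mult.commute)
  have "open_cone (map V js) = basis_cone w"
  proof (intro equalityI subsetI)
    fix x assume "x \<in> open_cone (map V js)"
    then obtain c where c: "\<forall>l<length js. c l > 0" "x = (\<Sum>l<length js. c l *\<^sub>R V (js ! l))"
      by (auto simp: open_cone_def)
    define idx where "idx = the_inv_into {..<length js} (\<lambda>l. js ! l)"
    have idx: "idx (js ! l) = l" if "l < length js" for l
      unfolding idx_def using bij that by (intro the_inv_into_f_f) (auto simp: bij_betw_def)
    have pos: "c (idx j) > 0" for j
    proof -
      obtain l where "l < length js" "js ! l = j" using js(2) by (metis UNIV_I in_set_conv_nth)
      then show ?thesis using idx[of l] c(1) by auto
    qed
    have "x = (\<Sum>l<length js. c (idx (js ! l)) *\<^sub>R V (js ! l))"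
      unfolding c(2) by (intro sum.cong refl) (simp add: idx)
    also have "\<dots> = (\<Sum>j\<in>UNIV. c (idx j) *\<^sub>R V j)" by (rule sum_js)
    also have "\<dots> = (\<chi> i. emb (w i) \<bullet> (\<chi> j. c (idx j)))" using V_sum[of "\<chi> j. c (idx j)"] by simp
    finally show "x \<in> basis_cone w" unfolding basis_cone_def using pos
      by (intro CollectI exI[of _ "\<chi> j. c (idx j)"]) simp
  next
    fix x assume "x \<in> basis_cone w"
    then obtain y where y: "\<forall>j. y $ j > 0" "x = (\<chi> i. emb (w i) \<bullet> y)" by (auto simp: basis_cone_def)
    then have "x = (\<Sum>l<length js. y $ (js ! l) *\<^sub>R V (js ! l))"
      using V_sum[of y] sum_js[of "\<lambda>j. y $ j *\<^sub>R V j"] by simp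
    then have "x = (\<Sum>l<length (map V js). y $ (js ! l) *\<^sub>R (map V js) ! l)" by simp
    then show "x \<in> open_cone (map V js)" unfolding open_cone_def using y(1)
      by (intro CollectI exI[of _ "\<lambda>l. y $ (js ! l)"]) simp
  qed
  moreover have "\<exists>j. v = (\<chi> i. \<tau> j (w i))" if "v \<in> set (map V js)" for v
    using that by (auto simp: V_def)
  ultimately show ?thesis by (intro that[of "map V js"])
qed

text \<open>Exponents equal to \<open>1\<close> do no harm: since the \<open>w i\<close> are totally
  positive, the coordinates of a point of the cone are comparable. Up to a constant only the total
  weight \<open>n * k\<close> counts, and it dominates exponent \<open>2\<close> in every
  coordinate.\<close>

lemma conical_zeta_basis_cone_converges:
  assumes w: "\<And>i j. \<tau> j (w i) > 0" and "k \<ge> 2" and \<kappa>: "\<kappa> \<in> indices_of_weight (CARD('n) * k)"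
  shows "conical_term \<kappa> summable_on lattice_points (basis_cone w)"
proof -
  obtain R where R: "R \<ge> 1" and entries: "\<And>i j i' j'. \<tau> j (w i) \<le> R * \<tau> j' (w i')"
    by (rule entries_comparable[of w, OF w]) blast
  have sum_\<kappa>: "(\<Sum>j\<in>UNIV. \<kappa> $ j) = CARD('n) * k" using \<kappa> by (simp add: indices_of_weight_def)
  have bound: "conical_term \<kappa> z \<le> R ^ (CARD('n) * k) * (\<Prod>i\<in>UNIV. inverse ((z $ i)\<^sup>2))"
    and nonneg: "conical_term \<kappa> z \<ge> 0" and z_pos: "\<forall>i. z $ i \<in> \<int> \<and> z $ i > 0"
    if "z \<in> lattice_points (basis_cone w)" for z
  proof -
    obtain y where y: "\<forall>j. y $ j > 0" "z = (\<chi> i. emb (w i) \<bullet> y)"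
      using \<open>z \<in> lattice_points (basis_cone w)\<close> unfolding lattice_points_def basis_cone_def by blast
    have int: "z $ j \<in> \<int>" for j using \<open>z \<in> lattice_points (basis_cone w)\<close> by (simp add: lattice_points_def)
    have ratio: "z $ i \<le> R * z $ l" for i l
    proof -
      have "z $ i = (\<Sum>j\<in>UNIV. \<tau> j (w i) * y $ j)" by (simp add: y(2) inner_vec_def)
      also have "\<dots> \<le> (\<Sum>j\<in>UNIV. R * (\<tau> j (w l) * y $ j))"
      proof (intro sum_mono)
        fix j
        show "\<tau> j (w i) * y $ j \<le> R * (\<tau> j (w l) * y $ j)"
          using entries[of j i j l] y(1) by (simp add: mult.assoc[symmetric])
      qed
      also have "\<dots> = R * z $ l" by (simp add: y(2) inner_vec_def sum_distrib_left)
      finally show ?thesis .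
    qed
    have pos: "z $ i > 0" for i using that w by (intro basis_cone_positive) (auto simp: lattice_points_def)
    then show "\<forall>i. z $ i \<in> \<int> \<and> z $ i > 0" using int by simp
    have ge1: "z $ i \<ge> 1" for i
    proof -
      obtain a where "z $ i = of_int a" using int[of i] by (auto elim: Ints_cases)
      then show ?thesis using pos[of i] by simp
    qed
    define i0 :: 'n where "i0 = undefined"
    define Z where "Z = Max (range (\<lambda>i. z $ i))"
    have Z: "z $ i \<le> Z" for i unfolding Z_def by (rule Max_ge) auto
    have "Z \<in> range (\<lambda>i. z $ i)" unfolding Z_def by (rule Max_in) auto
    then have ZR: "Z \<le> R * z $ i" for i using ratio by auto
    have Z0: "Z > 0" using pos[of i0] Z[of i0] by linarith
    show "conical_term \<kappa> z \<ge> 0" unfolding conical_term_def using pos by (intro prod_nonneg) (auto simp: less_imp_le)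
    have "(\<Prod>i\<in>UNIV. (z $ i)\<^sup>2) \<le> (\<Prod>i\<in>(UNIV :: 'n set). Z ^ k)"
    proof (intro prod_mono conjI)
      fix i
      have "(z $ i)\<^sup>2 \<le> (z $ i) ^ k" using ge1 \<open>k \<ge> 2\<close> by (intro power_increasing) auto
      also have "\<dots> \<le> Z ^ k" using Z pos by (intro power_mono) (auto simp: less_imp_le)
      finally show "(z $ i)\<^sup>2 \<le> Z ^ k" .
    qed simp
    also have "\<dots> = Z ^ (\<Sum>j\<in>UNIV. \<kappa> $ j)" by (simp add: sum_\<kappa> power_mult[symmetric] mult.commute)
    also have "\<dots> = (\<Prod>i\<in>UNIV. Z ^ \<kappa> $ i)" by (rule power_sum)
    also have "\<dots> \<le> (\<Prod>i\<in>UNIV. (R * z $ i) ^ \<kappa> $ i)"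
      using Z0 ZR by (intro prod_mono conjI power_mono) auto
    also have "\<dots> = R ^ (CARD('n) * k) * (\<Prod>i\<in>UNIV. z $ i ^ \<kappa> $ i)"
      by (simp add: power_mult_distrib prod.distrib flip: sum_\<kappa> power_sum)
    finally have le: "(\<Prod>i\<in>UNIV. (z $ i)\<^sup>2) \<le> R ^ (CARD('n) * k) * (\<Prod>i\<in>UNIV. z $ i ^ \<kappa> $ i)" .
    have p1: "(\<Prod>i\<in>UNIV. (z $ i)\<^sup>2) > 0" "(\<Prod>i\<in>UNIV. z $ i ^ \<kappa> $ i) > 0"
      using pos by (auto intro!: prod_pos zero_less_power)
    have "conical_term \<kappa> z = inverse (\<Prod>i\<in>UNIV. z $ i ^ \<kappa> $ i)"
      by (simp add: conical_term_def prod_inversef[symmetric] o_def)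
    also have "\<dots> \<le> R ^ (CARD('n) * k) * inverse (\<Prod>i\<in>UNIV. (z $ i)\<^sup>2)"
      using le p1 by (simp add: field_simps)
    finally show "conical_term \<kappa> z \<le> R ^ (CARD('n) * k) * (\<Prod>i\<in>UNIV. inverse ((z $ i)\<^sup>2))"
      by (simp add: prod_inversef[symmetric] o_def)
  qed
  have "(\<lambda>z. R ^ (CARD('n) * k) * (\<Prod>i\<in>UNIV. inverse ((z $ i)\<^sup>2))) summable_on {z :: real ^ 'n. \<forall>i. z $ i \<in> \<int> \<and> z $ i > 0}"
    by (intro summable_on_cmult_right summable_on_prod_inverse_squares)
  then have "(\<lambda>z. R ^ (CARD('n) * k) * (\<Prod>i\<in>UNIV. inverse ((z $ i)\<^sup>2))) summable_on lattice_points (basis_cone w)"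
    by (rule summable_on_subset_banach) (use z_pos in auto)
  then show ?thesis
    by (rule summable_on_comparison_test) (use bound nonneg in auto)
qed

text \<open>\<open>integral_on\<close> makes the images integral, independence gives injectivity.
  Surjectivity is \<open>unimodular\<close>, by which the trace dual of the lattice lies in the
  integer span of \<open>w\<close>.\<close>

lemma lattice_points_basis_cone:
  assumes \<alpha>: "indep \<alpha>" "\<And>x. x \<in> \<aa> \<longleftrightarrow> (\<exists>c :: 'n \<Rightarrow> int. x = (\<Sum>i\<in>UNIV. of_int (c i) * \<alpha> i))"
    and w: "indep w" "integral_on \<alpha> w" "unimodular \<alpha> w"
  shows "bij_betw (\<lambda>x. \<chi> i. tr (w i * x)) (totally_positive_part \<tau> \<aa>) (lattice_points (basis_cone w))"
proof (rule bij_betw_imageI)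
  let ?f = "\<lambda>x. \<chi> i. tr (w i * x) :: real ^ 'n"
  show "inj_on ?f (totally_positive_part \<tau> \<aa>)"
  proof (rule inj_onI)
    fix x y assume "?f x = ?f y"
    then have eq: "tr (w i * (x - y)) = 0" for i by (simp add: vec_eq_iff right_diff_distrib tr_diff)
    have "x - y = 0"
    proof -
      have "emat w *v emb (x - y) = 0"
        by (simp add: vec_eq_iff matrix_vector_mult_def) (simp add: eq[unfolded tr_def \<tau>_mult])
      moreover have "invertible (emat w)" using w(1) by (simp add: indep_def invertible_det_nz)
      ultimately have "emb (x - y) = 0"
        unfolding invertible_left_inverse matrix_left_invertible_ker by blast
      then show ?thesis using emb_eq_iff[of "x - y" 0] by simp
    qed
    then show "x = y" by simp
  qed
  show "?f ` totally_positive_part \<tau> \<aa> = lattice_points (basis_cone w)"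
  proof (intro equalityI subsetI)
    fix z assume "z \<in> ?f ` totally_positive_part \<tau> \<aa>"
    then obtain x where x: "x \<in> \<aa>" "\<forall>j. \<tau> j x > 0" "z = ?f x"
      by (auto simp: totally_positive_part_def totally_positive_def)
    have "z \<in> basis_cone w" unfolding basis_cone_def using x
      by (intro CollectI exI[of _ "emb x"]) (simp add: inner_emb)
    moreover have "z $ i \<in> \<int>" for i
    proof -
      obtain c :: "'n \<Rightarrow> int" where c: "x = (\<Sum>i\<in>UNIV. of_int (c i) * \<alpha> i)" using x(1) \<alpha>(2) by blast
      have "z $ i = (\<Sum>j\<in>UNIV. of_int (c j) * tr (w i * \<alpha> j))"
        by (simp add: x(3) c sum_distrib_left tr_sum mult.left_commute[of "w i"] tr_of_int_mult)
      also have "\<dots> \<in> \<int>" using w(2) by (intro Ints_sum Ints_mult) (auto simp: integral_on_def)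
      finally show ?thesis .
    qed
    ultimately show "z \<in> lattice_points (basis_cone w)" by (simp add: lattice_points_def)
  next
    fix z assume "z \<in> lattice_points (basis_cone w)"
    then obtain y where y: "\<forall>j. y $ j > 0" "z = (\<chi> i. emb (w i) \<bullet> y)" and int: "z $ i \<in> \<int>" for i
      by (auto simp: lattice_points_def basis_cone_def)
    \<comment> \<open>The \<open>\<alpha>\<close>-coordinates of \<open>y\<close> are integers:
      \<open>dual \<alpha> l\<close> is an integer combination of the \<open>w i\<close>, whose
      pairings with \<open>y\<close> are the integers \<open>z $ i\<close>.\<close>
    have "emb (dual \<alpha> l) \<bullet> y \<in> \<int>" for l
    proof -
      have dual_int: "tr (dual w i * dual \<alpha> l) \<in> \<int>" for i
      proof -
        have "tr (dual \<alpha> l * \<alpha> j) \<in> \<int>" for j by (simp add: tr_dual'[OF \<alpha>(1)])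
        then show ?thesis using w(3) by (simp add: unimodular_def)
      qed
      have "emb (dual \<alpha> l) = (\<Sum>i\<in>UNIV. tr (dual w i * dual \<alpha> l) *\<^sub>R emb (w i))"
        using expand_vec[OF w(1), of "emb (dual \<alpha> l)"] by (simp add: inner_emb)
      then have "emb (dual \<alpha> l) \<bullet> y = (\<Sum>i\<in>UNIV. tr (dual w i * dual \<alpha> l) *\<^sub>R emb (w i)) \<bullet> y" by simp
      also have "\<dots> = (\<Sum>i\<in>UNIV. tr (dual w i * dual \<alpha> l) * z $ i)"
        by (simp add: inner_sum_left y(2))
      also have "\<dots> \<in> \<int>" using dual_int int by (intro Ints_sum Ints_mult)
      finally show ?thesis .
    qed
    then have fl: "emb (dual \<alpha> l) \<bullet> y = of_int \<lfloor>emb (dual \<alpha> l) \<bullet> y\<rfloor>" for l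
      by (metis Ints_cases floor_of_int)
    define x where "x = (\<Sum>l\<in>UNIV. of_int \<lfloor>emb (dual \<alpha> l) \<bullet> y\<rfloor> * \<alpha> l)"
    have "emb x = (\<Sum>l\<in>UNIV. (emb (dual \<alpha> l) \<bullet> y) *\<^sub>R emb (\<alpha> l))"
      by (simp add: x_def emb_sum emb_of_int_mult flip: fl)
    then have xy: "emb x = y" by (simp flip: expand_vec[OF \<alpha>(1)])
    have "x \<in> \<aa>" unfolding \<alpha>(2) x_def by (rule exI[of _ "\<lambda>l. \<lfloor>emb (dual \<alpha> l) \<bullet> y\<rfloor>"]) (rule refl)
    moreover have "\<tau> j x > 0" for j using y(1) xy by (metis emb_nth)
    ultimately have "x \<in> totally_positive_part \<tau> \<aa>" by (simp add: totally_positive_part_def totally_positive_def)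
    moreover have "z = ?f x" by (simp add: y(2) flip: xy inner_emb)
    ultimately show "z \<in> ?f ` totally_positive_part \<tau> \<aa>" by blast
  qed
qed

section \<open>The narrow partial zeta function as a sum over unit orbits\<close>

lemma equiv_unit_orbit_rel: "equiv (totally_positive_part \<tau> \<aa>) (unit_orbit_rel \<tau> \<aa>)"
proof (rule equivI)
  show "unit_orbit_rel \<tau> \<aa> \<subseteq> totally_positive_part \<tau> \<aa> \<times> totally_positive_part \<tau> \<aa>"
    by (auto simp: unit_orbit_rel_def)
  show "refl_on (totally_positive_part \<tau> \<aa>) (unit_orbit_rel \<tau> \<aa>)"
    using pos_units_1 by (auto simp: refl_on_def unit_orbit_rel_def intro!: bexI[of _ 1])
  show "sym (unit_orbit_rel \<tau> \<aa>)"
  proof (rule symI)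
    fix x y assume "(x, y) \<in> unit_orbit_rel \<tau> \<aa>"
    then obtain u where u: "u \<in> pos_units" "y = u * x" "x \<in> totally_positive_part \<tau> \<aa>" "y \<in> totally_positive_part \<tau> \<aa>"
      by (auto simp: unit_orbit_rel_def)
    then have "x = inverse u * y" using pos_units_nz[OF u(1)] by simp
    then show "(y, x) \<in> unit_orbit_rel \<tau> \<aa>" using u pos_units_inverse by (auto simp: unit_orbit_rel_def)
  qed
  show "trans (unit_orbit_rel \<tau> \<aa>)"
  proof (rule transI)
    fix x y z assume "(x, y) \<in> unit_orbit_rel \<tau> \<aa>" "(y, z) \<in> unit_orbit_rel \<tau> \<aa>"
    then obtain u v where "u \<in> pos_units" "y = u * x" "v \<in> pos_units" "z = v * y"
      "x \<in> totally_positive_part \<tau> \<aa>" "z \<in> totally_positive_part \<tau> \<aa>"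
      by (auto simp: unit_orbit_rel_def)
    then show "(x, z) \<in> unit_orbit_rel \<tau> \<aa>"
      using pos_units_mult[of v u] by (auto simp: unit_orbit_rel_def mult.assoc intro!: bexI[of _ "v * u"])
  qed
qed

lemma unit_orbit_eq:
  assumes "fractional_ideal \<aa>" "x \<in> totally_positive_part \<tau> \<aa>"
  shows "unit_orbit_rel \<tau> \<aa> `` {x} = (\<lambda>u. u * x) ` pos_units"
proof -
  have "u * x \<in> totally_positive_part \<tau> \<aa>" if "u \<in> pos_units" for u
  proof -
    have "u * x \<in> \<aa>"
      using assms that unfolding fractional_ideal_def totally_positive_part_def integer_units_def by blast
    then show ?thesis
      using assms(2) pos_units_pos[OF that] by (simp add: totally_positive_part_def totally_positive_def \<tau>_mult)
  qed
  with assms(2) show ?thesis by (auto simp: unit_orbit_rel_def)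
qed

text \<open>A summable family over the totally positive elements may be grouped by orbits; units act
  freely on nonzero elements, so each orbit sum is a sum over units, to which \<open>orbit\<close>
  applies.\<close>

lemma narrow_partial_zeta_unfold:
  fixes g :: "'a \<Rightarrow> real"
  assumes \<aa>: "fractional_ideal \<aa>" and g: "(g has_sum G) (totally_positive_part \<tau> \<aa>)"
    and orbit: "\<And>x. x \<in> totally_positive_part \<tau> \<aa> \<Longrightarrow> infsum (\<lambda>u. g (u * x)) pos_units = inverse (nrm x ^ k)"
  shows "narrow_partial_zeta_inv \<tau> \<aa> (of_nat k) = complex_of_real G"
proof -
  let ?A = "totally_positive_part \<tau> \<aa>" and ?r = "unit_orbit_rel \<tau> \<aa>"
  note eq = equiv_unit_orbit_rel[of \<aa>]
  have bij: "bij_betw snd (Sigma (?A // ?r) (\<lambda>X. X)) ?A"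
  proof (rule bij_betw_imageI)
    show "inj_on snd (Sigma (?A // ?r) (\<lambda>X. X))"
      using quotient_disj[OF eq] by (auto simp: inj_on_def)
    have "snd ` Sigma (?A // ?r) (\<lambda>X. X) = \<Union>(?A // ?r)" by force
    then show "snd ` Sigma (?A // ?r) (\<lambda>X. X) = ?A" using Union_quotient[OF eq] by simp
  qed
  have S: "((\<lambda>(X, x). g x) has_sum G) (Sigma (?A // ?r) (\<lambda>X. X))"
    using has_sum_reindex_bij_betw[OF bij, of g G] g by (simp add: case_prod_unfold)
  have "G = (\<Sum>\<^sub>\<infinity>(X, x)\<in>Sigma (?A // ?r) (\<lambda>X. X). g x)"
    using S by (simp add: has_sum_iff)
  also have "\<dots> = (\<Sum>\<^sub>\<infinity>X\<in>?A // ?r. infsum g X)"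
    using infsum_Sigma'_banach[of "\<lambda>X x. g x" "?A // ?r" "\<lambda>X. X"] S by (simp add: has_sum_iff)
  finally have G: "G = (\<Sum>\<^sub>\<infinity>X\<in>?A // ?r. infsum g X)" .
  have summ: "infsum g summable_on (?A // ?r)"
    using summable_on_Sigma_banach[of "\<lambda>X x. g x" "?A // ?r" "\<lambda>X. X"] S by (simp add: has_sum_iff)
  have zeta_term: "of_rat (the_elem (field_norm TYPE('n) ` X)) powr (- of_nat k) = complex_of_real (infsum g X)"
    if X: "X \<in> ?A // ?r" for X
  proof -
    obtain x where x: "x \<in> ?A" "X = ?r `` {x}" using X by (auto simp: quotient_def)
    then have X_eq: "X = (\<lambda>u. u * x) ` pos_units" using unit_orbit_eq[OF \<aa>] by simp
    have x0: "x \<noteq> 0" and npos: "nrm x > 0"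
      using x(1) by (auto simp: totally_positive_part_def totally_positive_def nrm_def intro!: prod_pos)
    have norm_const: "field_norm TYPE('n) y = field_norm TYPE('n) x" if y: "y \<in> X" for y
    proof -
      obtain u where "u \<in> pos_units" "y = u * x" using y X_eq by blast
      then have "nrm y = nrm x" by (simp add: nrm_mult nrm_pos_unit)
      then have "real_of_rat (field_norm TYPE('n) y) = real_of_rat (field_norm TYPE('n) x)"
        by (simp add: field_norm_eq)
      then show ?thesis by simp
    qed
    have xX: "x \<in> X" unfolding X_eq using pos_units_1 by (auto intro: image_eqI[of _ _ 1])
    have "field_norm TYPE('n) ` X = (\<lambda>_. field_norm TYPE('n) x) ` X"
      by (intro image_cong refl norm_const)
    also have "\<dots> = {field_norm TYPE('n) x}" by (rule image_constant[OF xX])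
    finally have "field_norm TYPE('n) ` X = {field_norm TYPE('n) x}" .
    moreover have "of_rat s = complex_of_real (of_rat s)" for s
      by (cases s) (simp add: of_rat_rat)
    ultimately have "of_rat (the_elem (field_norm TYPE('n) ` X)) = complex_of_real (nrm x)"
      by (simp flip: field_norm_eq)
    moreover have "complex_of_real (nrm x) powr (- of_nat k) = complex_of_real (inverse (nrm x ^ k))"
      using x0 by (simp add: powr_minus powr_nat)
    moreover have "inj_on (\<lambda>u. u * x) pos_units" using x0 by (auto intro: inj_onI)
    then have "infsum g X = inverse (nrm x ^ k)"
      unfolding X_eq using orbit[OF x(1)] by (simp add: infsum_reindex o_def)
    ultimately show ?thesis by simp
  qed
  have "narrow_partial_zeta_inv \<tau> \<aa> (of_nat k) = (\<Sum>\<^sub>\<infinity>X\<in>?A // ?r. complex_of_real (infsum g X))"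
    unfolding narrow_partial_zeta_inv_def by (intro infsum_cong zeta_term)
  also have "\<dots> = complex_of_real (\<Sum>\<^sub>\<infinity>X\<in>?A // ?r. infsum g X)"
    using has_sum_of_real[OF has_sum_infsum[OF summ], where 'a = complex] by (simp add: has_sum_iff)
  finally show ?thesis by (simp add: G)
qed

text \<open>The Gamma integral of a power \<open>\<mu> i\<close> has exponent
  \<open>\<mu> i + 1\<close>; one shift per coordinate raises the weight from
  \<open>(k - 1) * n\<close> to \<open>n * k\<close>.\<close>

lemma sum_indices_of_weight:
  fixes f :: "nat ^ 'n \<Rightarrow> real"
  assumes "k \<ge> 1"
  shows "(\<Sum>\<kappa>\<in>indices_of_weight (CARD('n) * k). f \<kappa>) =
    (\<Sum>\<mu> | (\<Sum>i\<in>UNIV. \<mu> i) = (k - 1) * CARD('n). f (\<chi> i. Suc (\<mu> i)))"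
proof (rule sum.reindex_bij_witness[where i = "\<lambda>\<mu>. \<chi> i. Suc (\<mu> i)" and j = "\<lambda>\<kappa> i. \<kappa> $ i - 1"])
  fix \<kappa> :: "nat ^ 'n" assume "\<kappa> \<in> indices_of_weight (CARD('n) * k)"
  then have \<kappa>: "\<And>i. 1 \<le> \<kappa> $ i" "(\<Sum>i\<in>UNIV. \<kappa> $ i) = CARD('n) * k" by (auto simp: indices_of_weight_def)
  have "Suc (\<kappa> $ i - 1) = \<kappa> $ i" for i using \<kappa>(1)[of i] by simp
  then show eq: "(\<chi> i. Suc (\<kappa> $ i - 1)) = \<kappa>" by (simp only: vec_eq_iff vec_lambda_beta) simp
  then show "f (\<chi> i. Suc (\<kappa> $ i - 1)) = f \<kappa>" by simp
  have "(\<Sum>i\<in>UNIV. \<kappa> $ i - 1) = (\<Sum>i\<in>UNIV. \<kappa> $ i) - (\<Sum>i\<in>(UNIV :: 'n set). 1)"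
    using \<kappa>(1) by (intro sum_subtractf_nat) auto
  then show "(\<lambda>i. \<kappa> $ i - 1) \<in> {\<mu>. (\<Sum>i\<in>UNIV. \<mu> i) = (k - 1) * CARD('n)}"
    by (simp add: \<kappa>(2) mult.commute[of _ k] diff_mult_distrib)
next
  fix \<mu> :: "'n \<Rightarrow> nat" assume \<mu>: "\<mu> \<in> {\<mu>. (\<Sum>i\<in>UNIV. \<mu> i) = (k - 1) * CARD('n)}"
  show "(\<lambda>i. (\<chi> i. Suc (\<mu> i)) $ i - 1) = \<mu>" by simp
  have "(\<Sum>i\<in>UNIV. Suc (\<mu> i)) = (\<Sum>i\<in>UNIV. \<mu> i) + CARD('n)" by (rule sum_Suc)
  also have "\<dots> = CARD('n) * k" using \<mu> assms by (cases k) (auto simp: mult.commute)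
  finally show "(\<chi> i. Suc (\<mu> i)) \<in> indices_of_weight (CARD('n) * k)"
    by (simp add: indices_of_weight_def)
qed

text \<open>\<open>W\<close> depends only on the ideal and the field. The exponent \<open>k\<close>
  affects the expansion of the norm power, the factorials and thereby \<open>q\<close>.\<close>

lemma zeta_decomposition:
  assumes \<aa>: "fractional_ideal (\<aa> :: 'a set)"
  obtains W :: "('n \<Rightarrow> 'a) set" where "finite W" "\<And>w i j. w \<in> W \<Longrightarrow> \<tau> j (w i) > 0"
    "\<And>k. k \<ge> 2 \<Longrightarrow> \<exists>q :: ('n \<Rightarrow> 'a) \<Rightarrow> nat ^ 'n \<Rightarrow> rat.
      narrow_partial_zeta_inv \<tau> \<aa> (of_nat k) =
        complex_of_real (1 / sqrt (of_rat (field_discriminant TYPE('n) TYPE('a))) *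
          (\<Sum>w\<in>W. \<Sum>\<kappa>\<in>indices_of_weight (CARD('n) * k). of_rat (q w \<kappa>) * conical_zeta (basis_cone w) \<kappa>))"
proof -
  define \<delta> where "\<delta> = sqrt (of_rat (field_discriminant TYPE('n) TYPE('a)))"
  obtain \<alpha> where \<alpha>: "indep \<alpha>" "\<And>x. x \<in> \<aa> \<longleftrightarrow> (\<exists>c :: 'n \<Rightarrow> int. x = (\<Sum>i\<in>UNIV. of_int (c i) * \<alpha> i))"
    by (rule fractional_ideal_basis_exists[OF \<aa>]) blast
  obtain W :: "('n \<Rightarrow> 'a) set" and h :: "('n \<Rightarrow> 'a) \<Rightarrow> nat" where
    W: "finite W" "\<And>w. w \<in> W \<Longrightarrow> indep w" "\<And>w i j. w \<in> W \<Longrightarrow> \<tau> j (w i) > 0"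
    "\<And>w. w \<in> W \<Longrightarrow> integral_on \<alpha> w" "\<And>w. w \<in> W \<Longrightarrow> unimodular \<alpha> w"
    and part: "\<And>y. generic y \<Longrightarrow> (\<And>j. y $ j > 0) \<Longrightarrow>
      (\<integral>\<^sup>+u. (\<Sum>w\<in>W. ennreal (1 / real (h w)) * indicator {y. in_cone w y} (act u y)) \<partial>count_space pos_units) = 1"
    by (rule weighted_fundamental_domain[OF \<alpha>(1)]) blast
  let ?A = "totally_positive_part \<tau> \<aa>"
  have "\<exists>q :: ('n \<Rightarrow> 'a) \<Rightarrow> nat ^ 'n \<Rightarrow> rat.
      narrow_partial_zeta_inv \<tau> \<aa> (of_nat k) =
        complex_of_real (1 / \<delta> * (\<Sum>w\<in>W. \<Sum>\<kappa>\<in>indices_of_weight (CARD('n) * k). of_rat (q w \<kappa>) * conical_zeta (basis_cone w) \<kappa>))"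
    if k: "k \<ge> 2" for k
  proof -
    define m where "m = k - 1"
    have km: "k = Suc m" using k by (simp add: m_def)
    let ?M = "{\<mu> :: 'n \<Rightarrow> nat. (\<Sum>i\<in>UNIV. \<mu> i) = m * CARD('n)}"
    define T where "T c w z = (\<Sum>\<mu>\<in>?M. of_rat (c \<mu>) * (\<Prod>i\<in>UNIV. fact (\<mu> i) / (z \<bullet> emb (w i)) ^ Suc (\<mu> i)))"
      for c :: "('n \<Rightarrow> nat) \<Rightarrow> rat" and w :: "'n \<Rightarrow> 'a" and z :: "real ^ 'n"
    have "\<exists>c. \<forall>z. (\<forall>j. z $ j > 0) \<longrightarrow> 0 \<le> T c w z \<and>
        cone_laplace m w z =
        ennreal (\<bar>det (emat w)\<bar> * T c w z)" if "w \<in> W" for w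
      unfolding T_def by (rule cone_integral[OF W(2,3)[OF that], of m]) blast
    then have "\<forall>w\<in>W. \<exists>c. \<forall>z. (\<forall>j. z $ j > 0) \<longrightarrow> 0 \<le> T c w z \<and>
        cone_laplace m w z =
        ennreal (\<bar>det (emat w)\<bar> * T c w z)" by blast
    from bchoice[OF this] obtain c where c: "\<And>w z. w \<in> W \<Longrightarrow> (\<forall>j. z $ j > 0) \<Longrightarrow> 0 \<le> T (c w) w z"
      "\<And>w z. w \<in> W \<Longrightarrow> (\<forall>j. z $ j > 0) \<Longrightarrow>
        cone_laplace m w z =
        ennreal (\<bar>det (emat w)\<bar> * T (c w) w z)" by blast
    have "\<forall>w. \<exists>r::rat. \<bar>det (emat w)\<bar> = of_rat r / \<delta>"
      unfolding \<delta>_def by (intro allI abs_det_emat_rational_multiple)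
    from choice[OF this] obtain r :: "('n \<Rightarrow> 'a) \<Rightarrow> rat" where r: "\<And>w. \<bar>det (emat w)\<bar> = of_rat (r w) / \<delta>" by blast
    \<comment> \<open>Cancels the value \<open>fact m\<close>, contributed once per coordinate by
      the integral over the orthant.\<close>
    define C :: real where "C = 1 / fact m ^ CARD('n)"
    \<comment> \<open>The share of a single \<open>x\<close>, to be summed in two ways: over all
      totally positive elements it yields conical zeta values (\<open>g_sum\<close>), over the unit
      orbit of \<open>x\<close> the inverse norm power (\<open>orbit\<close>).\<close>
    define g where "g x = C * (\<Sum>w\<in>W. 1 / real (h w) * (\<bar>det (emat w)\<bar> * T (c w) w (emb x)))" for x
    \<comment> \<open>Collects the weight \<open>1 / h w\<close>, the rational part
      \<open>r w\<close> of the Jacobian, the coefficient of the norm form and the factorials. The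
      truncated subtraction undoes the shift of exponents and is exact, as the indices are at least
      \<open>1\<close>.\<close>
    define q :: "('n \<Rightarrow> 'a) \<Rightarrow> nat ^ 'n \<Rightarrow> rat" where
      "q w \<kappa> = 1 / of_nat (fact m) ^ CARD('n) * (1 / of_nat (h w) * r w * c w (\<lambda>i. \<kappa> $ i - 1) * (\<Prod>i\<in>UNIV. of_nat (fact (\<kappa> $ i - 1))))" for w \<kappa>
    define G where "G = 1 / \<delta> * (\<Sum>w\<in>W. \<Sum>\<kappa>\<in>indices_of_weight (CARD('n) * k). of_rat (q w \<kappa>) * conical_zeta (basis_cone w) \<kappa>)"
    have zeta_term: "((\<lambda>x. \<Prod>i\<in>UNIV. fact (\<mu> i) / (emb x \<bullet> emb (w i)) ^ Suc (\<mu> i)) has_sum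
        (\<Prod>i\<in>UNIV. fact (\<mu> i)) * conical_zeta (basis_cone w) (\<chi> i. Suc (\<mu> i))) ?A"
      if w: "w \<in> W" and \<mu>: "\<mu> \<in> ?M" for w \<mu>
    proof -
      let ?\<kappa> = "\<chi> i. Suc (\<mu> i)"
      have "(\<Sum>i\<in>UNIV. Suc (\<mu> i)) = CARD('n) * k"
        using \<mu> by (simp add: km sum_Suc mult.commute)
      then have "?\<kappa> \<in> indices_of_weight (CARD('n) * k)" by (simp add: indices_of_weight_def)
      then have "conical_term ?\<kappa> summable_on lattice_points (basis_cone w)"
        by (intro conical_zeta_basis_cone_converges[OF W(3)[OF w] k])
      then have "(conical_term ?\<kappa> has_sum conical_zeta (basis_cone w) ?\<kappa>) (lattice_points (basis_cone w))"
        by (simp add: conical_zeta_def)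
      then have "((\<lambda>x. conical_term ?\<kappa> (\<chi> i. tr (w i * x))) has_sum conical_zeta (basis_cone w) ?\<kappa>) ?A"
        using has_sum_reindex_bij_betw[OF lattice_points_basis_cone[OF \<alpha> W(2,4,5)[OF w]], of "conical_term ?\<kappa>"] by simp
      from has_sum_cmult_right[OF this, of "\<Prod>i\<in>UNIV. fact (\<mu> i)"] show ?thesis
        by (simp add: conical_term_def prod_dividef divide_inverse prod.distrib inner_emb mult.commute[of _ "w _"] del: power_Suc)
    qed
    have of_rat_fact: "of_rat (fact i) = (fact i :: real)" for i
      by (metis of_nat_fact of_rat_of_nat_eq)
    have g_sum: "(g has_sum G) ?A"
    proof -
      have "(g has_sum C * (\<Sum>w\<in>W. 1 / real (h w) * (\<bar>det (emat w)\<bar> *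
        (\<Sum>\<mu>\<in>?M. of_rat (c w \<mu>) * ((\<Prod>i\<in>UNIV. fact (\<mu> i)) * conical_zeta (basis_cone w) (\<chi> i. Suc (\<mu> i))))))) ?A"
        unfolding g_def T_def
      proof (intro has_sum_cmult_right has_sum_finite_sum W(1) zeta_term)
        show "finite ?M"
        proof (rule finite_subset)
          show "?M \<subseteq> (\<Pi>\<^sub>E i\<in>UNIV. {..m * CARD('n)})"
          proof
            fix \<mu> assume "\<mu> \<in> ?M"
            then have "\<mu> i \<le> m * CARD('n)" for i using member_le_sum[of i UNIV \<mu>] by simp
            then show "\<mu> \<in> (\<Pi>\<^sub>E i\<in>UNIV. {..m * CARD('n)})" by (simp add: PiE_iff)
          qed
        qed (intro finite_PiE, auto)
      qed auto
      also have "C * (\<Sum>w\<in>W. 1 / real (h w) * (\<bar>det (emat w)\<bar> *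
        (\<Sum>\<mu>\<in>?M. of_rat (c w \<mu>) * ((\<Prod>i\<in>UNIV. fact (\<mu> i)) * conical_zeta (basis_cone w) (\<chi> i. Suc (\<mu> i)))))) =
        1 / \<delta> * (\<Sum>w\<in>W. \<Sum>\<mu>\<in>?M. of_rat (q w (\<chi> i. Suc (\<mu> i))) * conical_zeta (basis_cone w) (\<chi> i. Suc (\<mu> i)))"
        by (simp add: r q_def C_def sum_distrib_left of_rat_fact of_rat_mult of_rat_inverse of_rat_power of_rat_prod divide_inverse mult_ac)
      also have "\<dots> = G"
        unfolding G_def using k by (subst sum_indices_of_weight) (simp_all add: m_def)
      finally show ?thesis .
    qed
    have orbit: "infsum (\<lambda>u. g (u * x)) pos_units = inverse (nrm x ^ k)" if x: "x \<in> ?A" for x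
    proof (rule infsum_eq_of_nn_integral)
      have xpos: "\<tau> j x > 0" for j using x by (simp add: totally_positive_part_def totally_positive_def)
      have uxpos: "\<forall>j. emb (u * x) $ j > 0" if "u \<in> pos_units" for u
        using pos_units_pos[OF that] xpos by (simp add: \<tau>_mult)
      have C: "C > 0" by (simp add: C_def)
      show "0 \<le> g (u * x)" if "u \<in> pos_units" for u
        unfolding g_def using C c(1)[OF _ uxpos[OF that]] by (auto intro!: mult_nonneg_nonneg sum_nonneg)
      have nx: "nrm x > 0" unfolding nrm_def using xpos by (intro prod_pos) auto
      then show "0 \<le> inverse (nrm x ^ k)" by simp
      have "(\<integral>\<^sup>+u. ennreal (g (u * x)) \<partial>count_space pos_units) =
        (\<integral>\<^sup>+u. ennreal C * (\<Sum>w\<in>W. ennreal (1 / real (h w)) * cone_laplace m w (act u (emb x))) \<partial>count_space pos_units)"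
      proof (rule nn_integral_cong)
        fix u assume "u \<in> space (count_space pos_units)"
        then have u: "\<forall>j. emb (u * x) $ j > 0" using uxpos by simp
        have "ennreal (g (u * x)) = ennreal C * (\<Sum>w\<in>W. ennreal (1 / real (h w) * (\<bar>det (emat w)\<bar> * T (c w) w (emb (u * x)))))"
          unfolding g_def using C c(1)[OF _ u]
          by (subst ennreal_mult) (auto intro!: sum_nonneg mult_nonneg_nonneg simp: sum_ennreal)
        also have "\<dots> = ennreal C * (\<Sum>w\<in>W. ennreal (1 / real (h w)) * cone_laplace m w (act u (emb x)))"
          unfolding act_emb
        proof (intro arg_cong[of _ _ "\<lambda>t. ennreal C * t"] sum.cong refl)
          fix w assume "w \<in> W"
          show "ennreal (1 / real (h w) * (\<bar>det (emat w)\<bar> * T (c w) w (emb (u * x)))) =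
            ennreal (1 / real (h w)) * cone_laplace m w (emb (u * x))"
            unfolding c(2)[OF \<open>w \<in> W\<close> u] by (rule ennreal_mult') simp
        qed
        finally show "ennreal (g (u * x)) = \<dots>" .
      qed
      also have "\<dots> = ennreal C * ennreal (\<Prod>j\<in>UNIV. fact m / emb x $ j ^ Suc m)"
      proof (subst nn_integral_cmult)
        have "ennreal (\<Prod>j\<in>UNIV. fact m / emb x $ j ^ Suc m) =
          (\<integral>\<^sup>+u. (\<Sum>w\<in>W. ennreal (1 / real (h w)) * cone_laplace m w (act u (emb x))) \<partial>count_space pos_units)"
        proof (rule norm_power_as_unit_sum)
          show "finite W" by (rule W(1))
          show "emb x $ j > 0" for j using xpos by simp
        qed (rule W(2) W(3) part; assumption)+
        then show "ennreal C * (\<integral>\<^sup>+u. (\<Sum>w\<in>W. ennreal (1 / real (h w)) * cone_laplace m w (act u (emb x))) \<partial>count_space pos_units) =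
          ennreal C * ennreal (\<Prod>j\<in>UNIV. fact m / emb x $ j ^ Suc m)" by simp
      qed simp
      also have "\<dots> = ennreal (C * (\<Prod>j\<in>UNIV. fact m / emb x $ j ^ Suc m))"
        using C by (simp add: ennreal_mult')
      also have "C * (\<Prod>j\<in>UNIV. fact m / emb x $ j ^ Suc m) = inverse (nrm x ^ k)"
        by (simp add: C_def prod_dividef nrm_def km prod_power_distrib inverse_eq_divide del: power_Suc)
      finally show "(\<integral>\<^sup>+u. ennreal (g (u * x)) \<partial>count_space pos_units) = ennreal (inverse (nrm x ^ k))" .
    qed
    show ?thesis
      using narrow_partial_zeta_unfold[OF \<aa> g_sum orbit] unfolding G_def by blast
  qed
  then show ?thesis using W(1,3) that unfolding \<delta>_def by blast
qed

end

theorem theorem2p3: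
  fixes \<tau> :: "'n::finite \<Rightarrow> 'a::field_char_0 \<Rightarrow> real"
    and F' :: "real set"
    and \<aa> :: "'a set"
  assumes "totally_real_number_field TYPE('a) CARD('n)"
    and "bij_betw \<tau> UNIV {\<sigma>. field_embedding \<sigma>}"
    and "F' = subfield_of_reals hull (\<Union>i. range (\<tau> i))"
    and "fractional_ideal \<aa>"
  shows "\<exists>(m::nat) (C :: nat \<Rightarrow> (real ^ 'n) set).
    (\<forall>i<m. rational_cone F' (C i) \<and> totally_positive_cone (C i)) \<and>
    (\<forall>k\<ge>(2::nat).
      (\<forall>i<m. \<forall>\<kappa>\<in>indices_of_weight (CARD('n) * k). conical_zeta_converges (C i) \<kappa>) \<and>
      (\<exists>q :: nat \<Rightarrow> nat ^ 'n \<Rightarrow> rat.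
        narrow_partial_zeta_inv \<tau> \<aa> (of_nat k) =
          complex_of_real (1 / sqrt (of_rat (field_discriminant TYPE('n) TYPE('a))) *
            (\<Sum>i<m. \<Sum>\<kappa>\<in>indices_of_weight (CARD('n) * k).
               of_rat (q i \<kappa>) * conical_zeta (C i) \<kappa>))))"
proof -
  interpret real_embeddings \<tau>
  proof
    show "field_embedding (\<tau> i)" for i using assms(2) by (auto simp: bij_betw_def)
    show "inj \<tau>" using assms(2) by (simp add: bij_betw_def)
    show "degree_over_rat TYPE('a) = CARD('n)" using assms(1) by (simp add: totally_real_number_field_def)
  qed
  obtain W :: "('n \<Rightarrow> 'a) set" where W: "finite W" "\<And>w i j. w \<in> W \<Longrightarrow> \<tau> j (w i) > 0"
    and zeta: "\<And>k. k \<ge> 2 \<Longrightarrow> \<exists>q :: ('n \<Rightarrow> 'a) \<Rightarrow> nat ^ 'n \<Rightarrow> rat.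
      narrow_partial_zeta_inv \<tau> \<aa> (of_nat k) =
        complex_of_real (1 / sqrt (of_rat (field_discriminant TYPE('n) TYPE('a))) *
          (\<Sum>w\<in>W. \<Sum>\<kappa>\<in>indices_of_weight (CARD('n) * k). of_rat (q w \<kappa>) * conical_zeta (basis_cone w) \<kappa>))"
    by (rule zeta_decomposition[OF assms(4)]) blast
  obtain e where e: "bij_betw e {..<card W} W"
    using ex_bij_betw_nat_finite[OF W(1)] by (auto simp: atLeast0LessThan)
  have eW: "e i \<in> W" if "i < card W" for i using e that by (auto simp: bij_betw_def)
  have F': "\<tau> j x \<in> F'" for j x
    unfolding assms(3) by (rule hull_inc) auto
  have rat: "rational_cone F' (basis_cone w)" and pos: "totally_positive_cone (basis_cone w)" if w: "w \<in> W" for w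
  proof -
    obtain vs :: "(real ^ 'n) list" where vs: "\<And>v. v \<in> set vs \<Longrightarrow> \<exists>j. v = (\<chi> i. \<tau> j (w i))" "open_cone vs = basis_cone w"
      by (rule basis_cone_eq_open_cone[of w]) blast
    have "v \<noteq> 0 \<and> (\<forall>i. v $ i \<in> F')" if v: "v \<in> set vs" for v
    proof -
      obtain j where j: "v = (\<chi> i. \<tau> j (w i))" using vs(1)[OF v] by blast
      have "v $ undefined > 0" using W(2)[OF w] by (simp add: j)
      then have "v \<noteq> 0" by auto
      then show ?thesis using F' by (simp add: j)
    qed
    then show "rational_cone F' (basis_cone w)" unfolding rational_cone_def using vs(2) by blast
    show "totally_positive_cone (basis_cone w)"
      unfolding totally_positive_cone_def using basis_cone_positive[of w, OF W(2)[OF w]] by blast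
  qed
  have "\<exists>q :: nat \<Rightarrow> nat ^ 'n \<Rightarrow> rat.
        narrow_partial_zeta_inv \<tau> \<aa> (of_nat k) =
          complex_of_real (1 / sqrt (of_rat (field_discriminant TYPE('n) TYPE('a))) *
            (\<Sum>i<card W. \<Sum>\<kappa>\<in>indices_of_weight (CARD('n) * k).
               of_rat (q i \<kappa>) * conical_zeta (basis_cone (e i)) \<kappa>))" if k: "k \<ge> 2" for k
  proof -
    obtain q :: "('n \<Rightarrow> 'a) \<Rightarrow> nat ^ 'n \<Rightarrow> rat" where q: "narrow_partial_zeta_inv \<tau> \<aa> (of_nat k) =
        complex_of_real (1 / sqrt (of_rat (field_discriminant TYPE('n) TYPE('a))) *
          (\<Sum>w\<in>W. \<Sum>\<kappa>\<in>indices_of_weight (CARD('n) * k). of_rat (q w \<kappa>) * conical_zeta (basis_cone w) \<kappa>))"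
      using zeta[OF k] by blast
    show ?thesis
      by (rule exI[of _ "\<lambda>i. q (e i)"])
         (simp only: q sum.reindex_bij_betw[OF e, of "\<lambda>w. \<Sum>\<kappa>\<in>indices_of_weight (CARD('n) * k). of_rat (q w \<kappa>) * conical_zeta (basis_cone w) \<kappa>"])
  qed
  moreover have "conical_zeta_converges (basis_cone (e i)) \<kappa>"
    if "i < card W" "k \<ge> 2" "\<kappa> \<in> indices_of_weight (CARD('n) * k)" for i k \<kappa>
    unfolding conical_zeta_converges_def
    by (rule conical_zeta_basis_cone_converges[OF W(2)[OF eW[OF that(1)]] that(2,3)])
  ultimately show ?thesis
    using rat pos eW by (intro exI[of _ "card W"] exI[of _ "\<lambda>i. basis_cone (e i)"]) blast
qed

end
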